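(* Let $N \ge 2$ be an integer, let $a > 0$, let $1 < p < \infty$ if $N = 2$ and $1 < p < 2^*$ if $N \ge 3$, let $1 \le q < \infty$ with $pq > 2$, and let $1 < b < b_*$. Let $f : \mathbb{R} \to \mathbb{R}$ be a continuous function such that $$|f(t)| \le C\left(|t|^{s_1 - 1} + |t|^{s_2 - 1}\right) \quad \forall t \in \mathbb{R},$$ where $C > 0$ is a constant and $2^{p,q}_{b,*} < s_1 \le s_2$, with $s_2 < \infty$ if $N = 2$ and $s_2 \le 2^*$ if $N \ge 3$. Then every weak radial solution $u \in E^{p,q}_{b,\mathrm{rad}}(\mathbb{R}^N)$ of the equation $$-\Delta u + \Phi_u(|x|)\, |u|^{p-2} u = f(u) \quad \text{in } \mathbb{R}^N$$ satisfies the Pohožaev identity $$\frac{N-2}{2} \int_{\mathbb{R}^N} |\nabla u|^2\, dx + \frac{a\,(Nq + 1 - b)}{pq} \int_0^\infty \rho^{-b}\, h_u^q(\rho)\, d\rho = N \int_{\mathbb{R}^N} F(u)\, dx,$$ the Nehari identity $$\int_{\mathbb{R}^N} |\nabla u|^2\, dx + a \int_0^\infty \rho^{-b}\, h_u^q(\rho)\, d\rho = \int_{\mathbb{R}^N} f(u)\, u\, dx,$$ and the scaling identity $$\sigma \left(\frac{1}{2} \int_{\mathbb{R}^N} |\nabla u|^2\, dx + \frac{a}{pq} \int_0^\infty \rho^{-b}\, h_u^q(\rho)\, d\rho\right) = \int_{\mathbb{R}^N} \big(\alpha f(u)\, u - N F(u)\big)\, dx,$$ where $F(t) = \int_0^t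 f(\tau)\, d\tau$.
   Context: $2^* = 2N/(N-2)$ for $N \ge 3$. $b_* = 1 + 2q$ if $N = 2$ and $b_* = 1 + Nq\,(1 - p/2^* )$ if $N \ge 3$. $$2^{p,q}_{b,*} = \frac{2\,[(N-1)pq + b - 1]}{2(N-1)q + 1 - b}, \qquad \alpha = \frac{N(q-1) + 3 - b}{pq - 2}, \qquad \sigma = 2\alpha + 2 - N = \frac{2\,(b_* - b)}{pq - 2}.$$ $B_\rho = \{x \in \mathbb{R}^N : |x| < \rho\}$, $h_u(\rho) = \int_{B_\rho} |u|^p\, dy$, and $\Phi_u(r) = a \int_r^\infty \rho^{-b}\, h_u^{q-1}(\rho)\, d\rho$ for $r > 0$. $E^{p,q}_b(\mathbb{R}^N)$ is the space of all weakly differentiable functions $u : \mathbb{R}^N \to \mathbb{R}$ such that $\int_{\mathbb{R}^N} |\nabla u|^2\, dx + \int_0^\infty \rho^{-b}\, h_u^q(\rho)\, d\rho < \infty$, and $E^{p,q}_{b,\mathrm{rad}}(\mathbb{R}^N)$ is its subspace of radially symmetric functions. A weak radial solution of the equation is a function $u \in E^{p,q}_{b,\mathrm{rad}}(\mathbb{R}^N)$ satisfying $$\int_{\mathbb{R}^N} \nabla u \cdot \nabla v\, dx + \int_{\mathbb{R}^N} \Phi_u(|x|)\, |u|^{p-2} u v\, dx = \int_{\mathbb{R}^N} f(u)\, v\, dx \quad \forall v \in E^{p,q}_{b,\mathrm{rad}}(\mathbb{R}^N).$$ *)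

theory Defs
  imports "HOL-Analysis.Analysis"
begin

section \<open>Weak differentiability\<close>

fun Ck :: "nat \<Rightarrow> ('a::euclidean_space \<Rightarrow> real) \<Rightarrow> bool" where
  "Ck 0 \<phi> \<longleftrightarrow> continuous_on UNIV \<phi>"
| "Ck (Suc k) \<phi> \<longleftrightarrow> (\<forall>x. \<phi> differentiable (at x)) \<and>
     (\<forall>e\<in>Basis. Ck k (\<lambda>x. frechet_derivative \<phi> (at x) e))"

definition test_function :: "('a::euclidean_space \<Rightarrow> real) \<Rightarrow> bool" where
  "test_function \<phi> \<longleftrightarrow> (\<forall>k. Ck k \<phi>) \<and> compact (closure {x. \<phi> x \<noteq> 0})"

definition locally_integrable ::
    "('a::euclidean_space \<Rightarrow> 'b::euclidean_space) \<Rightarrow> bool" where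
  "locally_integrable g \<longleftrightarrow> (\<forall>K. compact K \<longrightarrow> set_integrable lebesgue K g)"

definition is_weak_grad ::
    "('a::euclidean_space \<Rightarrow> real) \<Rightarrow> ('a \<Rightarrow> 'a) \<Rightarrow> bool" where
  "is_weak_grad u g \<longleftrightarrow> locally_integrable u \<and> locally_integrable g \<and>
     (\<forall>\<phi>. test_function \<phi> \<longrightarrow> (\<forall>e\<in>Basis.
        (LINT x|lebesgue. u x * frechet_derivative \<phi> (at x) e) =
        - (LINT x|lebesgue. (g x \<bullet> e) * \<phi> x)))"

definition weakly_differentiable :: "('a::euclidean_space \<Rightarrow> real) \<Rightarrow> bool" where
  "weakly_differentiable u \<longleftrightarrow> (\<exists>g. is_weak_grad u g)"

text \<open>A weak gradient is determined up to a null set, so the choice of representative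
  does not affect any integral below.\<close>

definition weak_grad :: "('a::euclidean_space \<Rightarrow> real) \<Rightarrow> 'a \<Rightarrow> 'a" where
  "weak_grad u = (SOME g. is_weak_grad u g)"


section \<open>The function space\<close>

definition h_mass :: "real \<Rightarrow> ('a::euclidean_space \<Rightarrow> real) \<Rightarrow> real \<Rightarrow> real" where
  "h_mass p u \<rho> = (LINT y:ball 0 \<rho>|lebesgue. \<bar>u y\<bar> powr p)"

definition coulomb_integral ::
    "real \<Rightarrow> real \<Rightarrow> real \<Rightarrow> ('a::euclidean_space \<Rightarrow> real) \<Rightarrow> real" where
  "coulomb_integral p q b u = (LINT \<rho>:{0<..}|lebesgue. \<rho> powr (-b) * h_mass p u \<rho> powr q)"

definition dirichlet_integral :: "('a::euclidean_space \<Rightarrow> real) \<Rightarrow> real" where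
  "dirichlet_integral u = (LINT x|lebesgue. (norm (weak_grad u x))\<^sup>2)"

text \<open>Finiteness of \<open>\<integral>\<rho>\<^sup>-\<^sup>b h\<^sub>u\<^sup>q d\<rho>\<close> includes \<open>h\<^sub>u(\<rho>) < \<infinity>\<close> for every \<open>\<rho>\<close> (as \<open>h\<^sub>u\<close> is
  nondecreasing).  Since the Bochner integral of a non-integrable function is \<open>0\<close> rather than
  \<open>\<infinity>\<close>, this has to be a separate clause.\<close>

definition E_space ::
    "real \<Rightarrow> real \<Rightarrow> real \<Rightarrow> ('a::euclidean_space \<Rightarrow> real) set" where
  "E_space p q b = {u. weakly_differentiable u \<and>
     integrable lebesgue (\<lambda>x. (norm (weak_grad u x))\<^sup>2) \<and>
     (\<forall>\<rho>>0. set_integrable lebesgue (ball 0 \<rho>) (\<lambda>y. \<bar>u y\<bar> powr p)) \<and>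
     set_integrable lebesgue {0<..} (\<lambda>\<rho>. \<rho> powr (-b) * h_mass p u \<rho> powr q)}"

text \<open>Functions are identified when they agree almost everywhere, hence so is radial symmetry.\<close>

definition radially_symmetric :: "('a::euclidean_space \<Rightarrow> real) \<Rightarrow> bool" where
  "radially_symmetric u \<longleftrightarrow> (\<exists>w :: real \<Rightarrow> real. AE x in lebesgue. u x = w (norm x))"

definition E_rad ::
    "real \<Rightarrow> real \<Rightarrow> real \<Rightarrow> ('a::euclidean_space \<Rightarrow> real) set" where
  "E_rad p q b = {u \<in> E_space p q b. radially_symmetric u}"


section \<open>The equation\<close>

text \<open>In HOL \<open>0 powr 0 = 0\<close>, whereas \<open>h\<^sub>u\<^sup>q\<^sup>-\<^sup>1\<close> is the constant \<open>1\<close> for \<open>q = 1\<close>.\<close>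

definition pow0 :: "real \<Rightarrow> real \<Rightarrow> real" where
  "pow0 x s = (if s = 0 then 1 else x powr s)"

definition Phi ::
    "real \<Rightarrow> real \<Rightarrow> real \<Rightarrow> real \<Rightarrow> ('a::euclidean_space \<Rightarrow> real) \<Rightarrow> real \<Rightarrow> real" where
  "Phi a p q b u r =
     a * (LINT \<rho>:{r<..}|lebesgue. \<rho> powr (-b) * pow0 (h_mass p u \<rho>) (q - 1))"

definition weak_radial_solution ::
    "real \<Rightarrow> real \<Rightarrow> real \<Rightarrow> real \<Rightarrow> (real \<Rightarrow> real) \<Rightarrow> ('a::euclidean_space \<Rightarrow> real) \<Rightarrow> bool" where
  "weak_radial_solution a p q b f u \<longleftrightarrow> u \<in> E_rad p q b \<and>
     (\<forall>v \<in> E_rad p q b.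
        (LINT x|lebesgue. weak_grad u x \<bullet> weak_grad v x) +
        (LINT x|lebesgue. Phi a p q b u (norm x) * \<bar>u x\<bar> powr (p - 2) * u x * v x) =
        (LINT x|lebesgue. f (u x) * v x))"

text \<open>The interval integral is oriented, so negative \<open>t\<close> is covered.\<close>

definition primitive :: "(real \<Rightarrow> real) \<Rightarrow> real \<Rightarrow> real" where
  "primitive f t = (LBINT \<tau>=ereal 0..ereal t. f \<tau>)"


section \<open>Exponents\<close>

definition two_star :: "nat \<Rightarrow> real" where
  "two_star N = 2 * real N / (real N - 2)"

definition b_star :: "nat \<Rightarrow> real \<Rightarrow> real \<Rightarrow> real" where
  "b_star N p q = (if N = 2 then 1 + 2 * q else 1 + real N * q * (1 - p / two_star N))"

definition two_lower_star :: "nat \<Rightarrow> real \<Rightarrow> real \<Rightarrow> real \<Rightarrow> real" where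
  "two_lower_star N p q b =
     2 * ((real N - 1) * p * q + b - 1) / (2 * (real N - 1) * q + 1 - b)"

definition alpha_exp :: "nat \<Rightarrow> real \<Rightarrow> real \<Rightarrow> real \<Rightarrow> real" where
  "alpha_exp N p q b = (real N * (q - 1) + 3 - b) / (p * q - 2)"

definition sigma_exp :: "nat \<Rightarrow> real \<Rightarrow> real \<Rightarrow> real \<Rightarrow> real" where
  "sigma_exp N p q b = 2 * alpha_exp N p q b + 2 - real N"

lemma sigma_exp_eq:
  assumes "N \<ge> 2" "p * q > 2"
  shows "sigma_exp N p q b = 2 * (b_star N p q - b) / (p * q - 2)"
proof -
  have "b_star N p q = 1 + q * (real N - (real N - 2) * p / 2)"
  proof (cases "N = 2")
    case False
    then have "real N * (1 - p / two_star N) = real N - (real N - 2) * p / 2"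
      using assms by (simp add: two_star_def field_simps)
    moreover have "b_star N p q = 1 + q * (real N * (1 - p / two_star N))"
      using False by (simp add: b_star_def)
    ultimately show ?thesis by simp
  qed (simp add: b_star_def)
  then show ?thesis
    using assms by (simp add: sigma_exp_def alpha_exp_def field_simps)
qed

end

theory Submission
  imports Defs
begin

text \<open>
  A radial weak solution is \<open>u(x) = W(|x|)\<close>.  Testing the definition of the weak gradient with the fields
  \<open>\<theta>(|x|) x\<close> shows that the profile is locally bounded on \<open>(0, \<infinity>)\<close>, and testing the equation with
  \<open>\<psi>(|x|)\<close>, where \<open>\<psi>\<close> is supported away from \<open>0\<close>, then gives a distributional ODE, so that
  \<open>(r^(N-1) W')' = r^(N-1) (\<Phi> |W|^(p-2) W - f(W))\<close> holds classically.

  Integrability of \<open>f(u) u\<close> and \<open>F(u)\<close>: near \<open>0\<close> it follows from Hardy's inequality and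
  \<open>|W| \<le> C r^(-(N-2)/2)\<close> (a logarithmic bound if \<open>N = 2\<close>).  At infinity, finiteness of the Coulomb term gives
  \<open>h(R) \<le> C R^((b-1)/q)\<close>, hence \<open>\<integral> r^(N-1-\<gamma>) |W|^p dr < \<infinity>\<close> for \<open>\<gamma> > (b-1)/q\<close>; combined with
  \<open>\<integral> r^(N-1) W'^2 dr < \<infinity>\<close> this yields a decay rate of \<open>W\<close>, and the exponents \<open>s\<close> with \<open>u \<in> L^s\<close>
  reached in this way are exactly those above \<open>two_lower_star\<close>.

  The Nehari identity is the equation tested with \<open>u\<close> itself.  For the Pohozaev identity, the function
  \<open>G(r) = r^N (W'^2 / 2 + F(W) - \<Phi> |W|^p / p) - a / (p q \<omega>) r^(1-b) h^q\<close> has an integrable derivative, which is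
  the integrand of the identity, and \<open>G(r) / r\<close> is integrable too, which forces \<open>G\<close> to vanish at both ends.
  The scaling identity is \<open>\<alpha>\<close> times the Nehari identity minus the Pohozaev identity.
\<close>

section \<open>Smooth functions\<close>

text \<open>Origin of \<open>two_lower_star\<close>: with \<nu> = (b-1)/q and \<gamma> slightly
  above \<nu>, Young's inequality bounds |W'| |W|^(p/2) by the two available integrands and gives
  |W|^(p/2+1) \<le> C r^(-(N-1-\<gamma>/2)). This bound makes |W|^s \<le> C' r^(-\<gamma>) |W|^p as
  soon as \<gamma> (s+2) \<le> 2 (N-1) (s-p), and solving \<nu> (s+2) < 2 (N-1) (s-p) for s gives s
  > \<open>two_lower_star\<close>. The last term of G answers the nonlocality of \<Phi>:
  differentiating \<Phi> produces r^(N-b) h^(q-1) |W|^p, which is a constant times r^(1-b) (h^q)'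
  because h' = \<omega> r^(N-1) |W|^p. Two obstacles shape the first half. The solution and its weak
  gradient are only Lebesgue measurable and known almost everywhere, with an arbitrary profile, and
  |x| is singular at 0; hence Borel representatives and test functions vanishing near 0. And f is
  merely continuous, so W has to be locally bounded before f(W) is known to be locally integrable.
  As the Bochner integral of a non-integrable function is 0, the integrability of f(u) u and F(u) is
  proved together with the identities, which would say little without it.\<close>

lemma Ck_SucI:
  assumes "\<And>x. (\<phi> has_derivative D x) (at x)" "\<And>e. e \<in> Basis \<Longrightarrow> Ck k (\<lambda>x. D x e)"
  shows "Ck (Suc k) \<phi>"
proof -
  have "frechet_derivative \<phi> (at x) = D x" for x
    using frechet_derivative_at[OF assms(1)] by simp
  then show ?thesis using assms by (auto simp: differentiable_def)
qed

lemma Ck_Suc_imp_Ck: "Ck (Suc k) \<phi> \<Longrightarrow> Ck k \<phi>"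
proof (induction k arbitrary: \<phi>)
  case 0
  then show ?case
    by (auto intro!: differentiable_imp_continuous_on differentiable_at_imp_differentiable_on)
next
  case (Suc k)
  then show ?case by (metis Ck.simps(2))
qed

lemma Ck_imp_continuous: "Ck k \<phi> \<Longrightarrow> continuous_on UNIV \<phi>"
  by (induction k) (auto dest: Ck_Suc_imp_Ck simp del: Ck.simps(2))

lemma Ck_Suc_D:
  "Ck (Suc k) \<phi> \<Longrightarrow> (\<phi> has_derivative frechet_derivative \<phi> (at x)) (at x)"
  "Ck (Suc k) \<phi> \<Longrightarrow> e \<in> Basis \<Longrightarrow> Ck k (\<lambda>x. frechet_derivative \<phi> (at x) e)"
  by (auto simp: frechet_derivative_works[symmetric])

lemma Ck_const: "Ck k (\<lambda>x. c)"
  by (induction k arbitrary: c) (auto intro!: Ck_SucI derivative_eq_intros simp del: Ck.simps(2))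

lemma Ck_inner: "Ck k (\<lambda>x. x \<bullet> c)"
proof (cases k)
  case (Suc n)
  show ?thesis unfolding Suc
    by (rule Ck_SucI[where D="\<lambda>x y. y \<bullet> c"]) (auto intro!: derivative_eq_intros Ck_const)
qed (auto intro!: continuous_intros)

lemma Ck_add: "Ck k f \<Longrightarrow> Ck k g \<Longrightarrow> Ck k (\<lambda>x. f x + g x)"
proof (induction k arbitrary: f g)
  case (Suc k)
  show ?case
    by (rule Ck_SucI[OF has_derivative_add[OF Ck_Suc_D(1)[OF Suc.prems(1)] Ck_Suc_D(1)[OF Suc.prems(2)]]])
      (auto intro!: Suc.IH Ck_Suc_D(2)[OF Suc.prems(1)] Ck_Suc_D(2)[OF Suc.prems(2)])
qed (auto intro!: continuous_intros)

lemma Ck_mult: "Ck k f \<Longrightarrow> Ck k g \<Longrightarrow> Ck k (\<lambda>x. f x * g x)"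
proof (induction k arbitrary: f g)
  case (Suc k)
  note D = Ck_Suc_D[OF Suc.prems(1)] Ck_Suc_D[OF Suc.prems(2)]
  show ?case
    by (rule Ck_SucI[OF has_derivative_mult[OF D(1) D(3)]])
      (auto intro!: Ck_add Suc.IH D Ck_Suc_imp_Ck[OF Suc.prems(1)] Ck_Suc_imp_Ck[OF Suc.prems(2)])
qed (auto intro!: continuous_intros)

lemma Ck_minus: "Ck k f \<Longrightarrow> Ck k (\<lambda>x. - f x)"
  using Ck_mult[OF Ck_const[of k "-1"]] by simp

lemma Ck_diff: "Ck k f \<Longrightarrow> Ck k g \<Longrightarrow> Ck k (\<lambda>x. f x - g x)"
  using Ck_add[of k f "\<lambda>x. - g x"] Ck_minus[of k g] by simp

lemma Ck_prod: "(\<And>i. i \<in> I \<Longrightarrow> Ck k (f i)) \<Longrightarrow> Ck k (\<lambda>x. \<Prod>i\<in>I. f i x)"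
proof (induction I rule: infinite_finite_induct)
  case (insert i F)
  then show ?case by (auto intro!: Ck_mult)
qed (auto intro: Ck_const)

lemma Ck_inverse:
  assumes "\<And>x. f x \<noteq> 0"
  shows "Ck k f \<Longrightarrow> Ck k (\<lambda>x. inverse (f x))"
proof (induction k)
  case 0
  then show ?case using assms by (auto intro!: continuous_intros)
next
  case (Suc k)
  note D = Ck_Suc_D[OF Suc.prems]
  have "((\<lambda>x. inverse (f x)) has_derivative
      (\<lambda>h. - (frechet_derivative f (at x) h * (inverse (f x) * inverse (f x))))) (at x)" for x
    by (rule derivative_eq_intros D(1) assms | simp add: algebra_simps assms)+
  then show ?case
    by (rule Ck_SucI) (auto intro!: Ck_minus Ck_mult D Suc Ck_Suc_imp_Ck[OF Suc.prems])
qed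

lemma Ck_Suc_realI:
  assumes "\<And>x. (\<phi> has_real_derivative D x) (at x)" "Ck k D"
  shows "Ck (Suc k) (\<phi> :: real \<Rightarrow> real)"
  by (rule Ck_SucI[where D="\<lambda>x y. D x * y"])
    (use assms in \<open>auto simp: has_field_derivative_def\<close>)

lemma Ck_Suc_realD:
  fixes \<phi> :: "real \<Rightarrow> real"
  assumes "Ck (Suc k) \<phi>"
  shows "(\<phi> has_real_derivative deriv \<phi> x) (at x)" "Ck k (deriv \<phi>)"
proof -
  have D: "(\<phi> has_real_derivative frechet_derivative \<phi> (at x) 1) (at x)" for x
  proof -
    note * = Ck_Suc_D(1)[OF assms, of x]
    define c where "c = frechet_derivative \<phi> (at x) 1"
    have "frechet_derivative \<phi> (at x) = (*) c"
    proof
      show "frechet_derivative \<phi> (at x) h = c * h" for h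
        using linear_scale[OF has_derivative_linear[OF *], of h 1] by (simp add: c_def)
    qed
    with * show ?thesis by (simp add: has_field_derivative_def)
  qed
  then have "deriv \<phi> = (\<lambda>x. frechet_derivative \<phi> (at x) 1)"
    using DERIV_imp_deriv by blast
  then show "(\<phi> has_real_derivative deriv \<phi> x) (at x)" "Ck k (deriv \<phi>)"
    using D Ck_Suc_D(2)[OF assms, of 1] by auto
qed

lemma Ck_compose:
  fixes \<theta> :: "real \<Rightarrow> real"
  shows "Ck k \<theta> \<Longrightarrow> Ck k \<phi> \<Longrightarrow> Ck k (\<lambda>x. \<theta> (\<phi> x))"
proof (induction k arbitrary: \<theta>)
  case 0
  then show ?case
    using continuous_on_compose2[of UNIV \<theta> UNIV \<phi>] by auto
next
  case (Suc k)
  note D = Ck_Suc_realD[OF Suc.prems(1)] Ck_Suc_D[OF Suc.prems(2)]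
  have "((\<lambda>x. \<theta> (\<phi> x)) has_derivative (\<lambda>h. deriv \<theta> (\<phi> x) * frechet_derivative \<phi> (at x) h)) (at x)" for x
    using has_derivative_compose[OF D(3) D(1)[unfolded has_field_derivative_def]] by simp
  then show ?case
    by (rule Ck_SucI) (auto intro!: Ck_mult D Suc.IH Ck_Suc_imp_Ck[OF Suc.prems(2)])
qed

text \<open>The powers in the denominator make the family closed under differentiation.\<close>

definition exp_cutoff :: "nat \<Rightarrow> real \<Rightarrow> real" where
  "exp_cutoff m t = (if 0 < t then exp (- inverse t) * inverse t ^ m else 0)"

text \<open>The substitution s = 1/t turns this into the decay of s^m / exp s at infinity.\<close>

lemma exp_cutoff_tendsto_0: "(exp_cutoff m \<longlongrightarrow> 0) (at_right 0)"
proof -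
  have "((\<lambda>s::real. s ^ m / exp s) \<longlongrightarrow> 0) at_top"
    by (rule tendsto_power_div_exp_0)
  then have "((\<lambda>t::real. inverse t ^ m / exp (inverse t)) \<longlongrightarrow> 0) (at_right 0)"
    by (rule filterlim_compose) (rule filterlim_inverse_at_top_right)
  moreover have "eventually (\<lambda>t::real. inverse t ^ m / exp (inverse t) = exp_cutoff m t) (at_right 0)"
    by (auto simp: eventually_at_filter exp_cutoff_def exp_minus field_simps)
  ultimately show ?thesis by (rule Lim_transform_eventually)
qed

lemma exp_cutoff_has_derivative:
  "(exp_cutoff m has_real_derivative exp_cutoff (m + 2) t - real m * exp_cutoff (m + 1) t) (at t)"
proof -
  consider "t > 0" | "t < 0" | "t = 0" by linarith
  then show ?thesis
  proof cases
    case 1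
    have inv: "(inverse has_real_derivative - (inverse t * inverse t)) (at t)"
      using 1 by (auto intro!: derivative_eq_intros simp: power2_eq_square)
    have pow: "((\<lambda>t. inverse t ^ m) has_real_derivative - real m * inverse t ^ (m + 1)) (at t)"
    proof (cases m)
      case (Suc n)
      then show ?thesis using DERIV_power_Suc[OF inv, of n] by (simp add: algebra_simps)
    qed simp
    have "((\<lambda>t. exp (- inverse t)) has_real_derivative exp (- inverse t) * (inverse t * inverse t)) (at t)"
      using DERIV_fun_exp[OF DERIV_minus[OF inv]] by simp
    from DERIV_mult[OF this pow]
    have "((\<lambda>t. exp (- inverse t) * inverse t ^ m) has_real_derivative
        exp_cutoff (m + 2) t - real m * exp_cutoff (m + 1) t) (at t)"
      using 1 by (simp add: exp_cutoff_def algebra_simps)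
    then show ?thesis
      by (rule DERIV_cong_ev[THEN iffD1, rotated -1, OF _ refl _ refl])
        (use 1 in \<open>auto simp: exp_cutoff_def eventually_nhds intro!: exI[of _ "{0<..}"]\<close>)
  next
    case 2
    have "((\<lambda>t. 0) has_real_derivative exp_cutoff (m + 2) t - real m * exp_cutoff (m + 1) t) (at t)"
      using 2 by (auto simp: exp_cutoff_def)
    then show ?thesis
      by (rule DERIV_cong_ev[THEN iffD1, rotated -1, OF _ refl _ refl])
        (use 2 in \<open>auto simp: exp_cutoff_def eventually_nhds intro!: exI[of _ "{..<0}"]\<close>)
  next
    case 3
    \<comment> \<open>For h > 0 the difference quotient at 0 is \<open>exp_cutoff (Suc m) h\<close>,
      so the limit already proved applies one index higher.\<close>
    have "((\<lambda>h. exp_cutoff m h / h) \<longlongrightarrow> 0) (at_right 0)"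
      using exp_cutoff_tendsto_0[of "Suc m"]
      by (rule Lim_transform_eventually)
        (auto simp: eventually_at_filter exp_cutoff_def field_simps)
    moreover have "((\<lambda>h. exp_cutoff m h / h) \<longlongrightarrow> 0) (at_left 0)"
      by (rule tendsto_eventually) (auto simp: eventually_at_filter exp_cutoff_def)
    ultimately have "((\<lambda>h. exp_cutoff m h / h) \<longlongrightarrow> 0) (at 0)"
      by (simp add: filterlim_split_at)
    then show ?thesis using 3 by (simp add: DERIV_def exp_cutoff_def)
  qed
qed

lemma Ck_exp_cutoff: "Ck k (exp_cutoff m)"
proof (induction k arbitrary: m)
  case 0
  show ?case
    using DERIV_continuous_on[OF exp_cutoff_has_derivative] by auto
next
  case (Suc k)
  show ?case
    by (rule Ck_Suc_realI[OF exp_cutoff_has_derivative]) (intro Ck_diff Ck_mult Ck_const Suc)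
qed

lemma deriv_vanishing_below:
  fixes \<theta> :: "real \<Rightarrow> real"
  assumes "\<And>r. r < \<delta> \<Longrightarrow> \<theta> r = 0" "r < \<delta>"
  shows "deriv \<theta> r = 0"
proof (rule DERIV_imp_deriv)
  show "(\<theta> has_real_derivative 0) (at r)"
    by (rule has_field_derivative_transform_within_open[OF DERIV_const, where S="{..<\<delta>}"])
      (use assms in auto)
qed

text \<open>A factor that vanishes below \<delta> > 0 removes every trouble of \<open>powr\<close>
  at and below 0. The exponent varies in the induction because differentiation lowers it by
  one.\<close>

lemma Ck_mult_powr:
  fixes \<theta> :: "real \<Rightarrow> real"
  assumes "Ck k \<theta>" "\<delta> > 0" "\<And>r. r < \<delta> \<Longrightarrow> \<theta> r = 0"
  shows "Ck k (\<lambda>r. \<theta> r * r powr s)"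
  using assms(1,3)
proof (induction k arbitrary: \<theta> s)
  case 0
  have "continuous_on ({0<..} \<union> {..<\<delta>}) (\<lambda>r. \<theta> r * r powr s)"
  proof (rule continuous_on_open_Un)
    show "continuous_on {0<..} (\<lambda>r. \<theta> r * r powr s)"
      using 0 by (auto intro!: continuous_intros intro: continuous_on_subset)
    show "continuous_on {..<\<delta>} (\<lambda>r. \<theta> r * r powr s)"
      using 0 by (subst continuous_on_cong[OF refl, of _ _ "\<lambda>_. 0"]) auto
  qed auto
  moreover have "{0<..} \<union> {..<\<delta>} = UNIV" using assms(2) by auto
  ultimately show ?case by simp
next
  case (Suc k)
  note D = Ck_Suc_realD[OF Suc.prems(1)]
  note z = deriv_vanishing_below[OF Suc.prems(2)]
  have "((\<lambda>r. \<theta> r * r powr s) has_real_derivative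
      deriv \<theta> r * r powr s + s * (\<theta> r * r powr (s - 1))) (at r)" for r
  proof (cases "r < \<delta>")
    case True
    have "((\<lambda>r. 0) has_real_derivative deriv \<theta> r * r powr s + s * (\<theta> r * r powr (s - 1))) (at r)"
      using True z Suc.prems(2) by auto
    then show ?thesis
      by (rule DERIV_cong_ev[THEN iffD1, rotated -1, OF _ refl _ refl])
        (use True Suc.prems(2) in \<open>auto simp: eventually_nhds intro!: exI[of _ "{..<\<delta>}"]\<close>)
  next
    case False
    then show ?thesis using assms(2)
      by (auto intro!: derivative_eq_intros D(1) simp: field_simps)
  qed
  then show ?case
    by (rule Ck_Suc_realI)
      (intro Ck_add Ck_mult[OF Ck_const] Suc.IH D(2) z Ck_Suc_imp_Ck[OF Suc.prems(1)] Suc.prems(2); simp)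
qed

section \<open>Radial functions and the singularity of the norm at the origin\<close>

lemma norm_has_derivative_at:
  "x \<noteq> 0 \<Longrightarrow> (norm has_derivative (\<lambda>h. (x \<bullet> h) / norm x)) (at (x::'a::euclidean_space))"
  using has_derivative_norm[of x] by (simp add: sgn_div_norm divide_inverse mult.commute inner_commute)

lemma has_derivative_radial:
  fixes \<psi> :: "real \<Rightarrow> real"
  assumes "(\<psi> has_real_derivative D) (at (norm x))" "x \<noteq> 0"
  shows "((\<lambda>x::'a::euclidean_space. \<psi> (norm x)) has_derivative (\<lambda>h. D * (x \<bullet> h) / norm x)) (at x)"
  using has_derivative_compose[OF norm_has_derivative_at[OF assms(2)] assms(1)[unfolded has_field_derivative_def]]
  by simp

lemma has_derivative_radial_vanishing:
  fixes \<psi> :: "real \<Rightarrow> real" and x :: "'a::euclidean_space"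
  assumes "\<And>r. r > 0 \<Longrightarrow> (\<psi> has_real_derivative \<psi>' r) (at r)" "\<delta> > 0" "\<And>r. r < \<delta> \<Longrightarrow> \<psi> r = 0"
  shows "((\<lambda>x. \<psi> (norm x)) has_derivative (\<lambda>h. \<psi>' (norm x) * (x \<bullet> h) / norm x)) (at x)"
proof (cases "x = 0")
  case True
  have "((\<lambda>x. 0) has_derivative (\<lambda>h. \<psi>' (norm x) * (x \<bullet> h) / norm x)) (at x)"
    using True by simp
  then show ?thesis
    by (rule has_derivative_transform_within_open[where s="ball 0 \<delta>"])
       (use assms True in auto)
qed (use assms in \<open>auto intro!: has_derivative_radial\<close>)

text \<open>The gradient is (\<psi>'(r) / r) x, and \<psi>'(r) / r is again a smooth profile
  vanishing near 0, so the induction closes: each derivative is a radial function of the same kind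
  times a linear one.\<close>

lemma Ck_radial:
  fixes \<psi> :: "real \<Rightarrow> real"
  assumes "Ck k \<psi>" "\<delta> > 0" "\<And>r. r < \<delta> \<Longrightarrow> \<psi> r = 0"
  shows "Ck k (\<lambda>x::'a::euclidean_space. \<psi> (norm x))"
  using assms(1,3)
proof (induction k arbitrary: \<psi>)
  case 0
  then show ?case
    using continuous_on_compose2[of UNIV \<psi> UNIV "norm :: 'a \<Rightarrow> real"] by (auto intro: continuous_intros)
next
  case (Suc k)
  note D = Ck_Suc_realD[OF Suc.prems(1)]
  note z = deriv_vanishing_below[OF Suc.prems(2)]
  have "((\<lambda>x. \<psi> (norm x)) has_derivative
      (\<lambda>h. deriv \<psi> (norm x) * norm x powr (-1) * (x \<bullet> h))) (at x)" for x :: 'a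
  proof (cases "x = 0")
    case True
    then show ?thesis using has_derivative_radial_vanishing[of \<psi> "deriv \<psi>" \<delta> x] D(1) assms(2) Suc.prems(2)
      by (simp add: True)
  next
    case False
    then have "deriv \<psi> (norm x) * (x \<bullet> h) / norm x = deriv \<psi> (norm x) * norm x powr (-1) * (x \<bullet> h)" for h
      by (simp add: powr_minus field_simps)
    then show ?thesis using has_derivative_radial[OF D(1) False] by simp
  qed
  then show ?case
  proof (rule Ck_SucI)
    fix e :: 'a
    have "Ck k (\<lambda>x::'a. (\<lambda>r. deriv \<psi> r * r powr (-1)) (norm x))"
      by (rule Suc.IH[OF Ck_mult_powr[OF D(2) assms(2) z]]) (use z in auto)
    then show "Ck k (\<lambda>x. deriv \<psi> (norm x) * norm x powr (-1) * (x \<bullet> e))"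
      by (rule Ck_mult[OF _ Ck_inner])
  qed
qed

section \<open>The fundamental lemma of the calculus of variations\<close>

lemma integrable_lborel_compact_support:
  fixes f :: "'a::euclidean_space \<Rightarrow> 'b::euclidean_space"
  assumes "continuous_on UNIV f" "compact K" "\<And>x. x \<notin> K \<Longrightarrow> f x = 0"
  shows "integrable lborel f"
proof -
  have "integrable lborel (\<lambda>x. indicator K x *\<^sub>R f x)"
    using assms by (intro borel_integrable_compact) (auto intro: continuous_on_subset)
  also have "(\<lambda>x. indicator K x *\<^sub>R f x) = f"
    using assms(3) by (auto simp: indicator_def)
  finally show ?thesis .
qed

text \<open>The positive and negative parts of h are densities of two finite measures that agree on
  boxes, an intersection-stable generator, hence everywhere. Since \<open>ennreal\<close> truncates
  at 0, equality of the densities at x forces h x = 0.\<close>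

lemma AE_zero_if_integral_boxes_zero:
  fixes h :: "'a::euclidean_space \<Rightarrow> real"
  assumes h: "integrable lborel h" and zero: "\<And>c d. (LBINT x. h x * indicator (box c d) x) = 0"
  shows "AE x in lborel. h x = 0"
proof -
  have [measurable]: "h \<in> borel_measurable borel" using h by auto
  define P where "P = density lborel (\<lambda>x. ennreal (h x))"
  define Q where "Q = density lborel (\<lambda>x. ennreal (- h x))"
  have fin: "(\<integral>\<^sup>+x. ennreal (h x) \<partial>lborel) \<noteq> \<infinity>" "(\<integral>\<^sup>+x. ennreal (- h x) \<partial>lborel) \<noteq> \<infinity>"
    using h by (auto simp: real_integrable_def)
  have "P = Q"
  proof (rule measure_eqI_generator_eq[where E="range (\<lambda>(a, b). box a b)" and \<Omega>=UNIV
        and A="\<lambda>n::nat. box (- (real n *\<^sub>R One)) (real n *\<^sub>R One)"])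
    show "Int_stable (range (\<lambda>(a, b). box a b :: 'a set))"
      by (auto simp: Int_stable_def box_Int_box)
    fix X assume "X \<in> range (\<lambda>(a, b). box a b :: 'a set)"
    then obtain c d where X: "X = box c d" by auto
    have i: "integrable lborel (\<lambda>x. h x * indicator (box c d) x)"
      using integrable_mult_indicator[OF _ h, of "box c d"] by (simp add: mult.commute)
    have "(\<integral>\<^sup>+x. ennreal (h x * indicator (box c d) x) \<partial>lborel)
        = (\<integral>\<^sup>+x. ennreal (- (h x * indicator (box c d) x)) \<partial>lborel)" (is "?A = ?B")
    proof -
      have "?A < top" "?B < top" using i by (auto simp: real_integrable_def less_top)
      moreover have "enn2real ?A = enn2real ?B"
        using real_lebesgue_integral_def[OF i] zero[of c d] by simp
      ultimately show ?thesis by (metis ennreal_enn2real)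
    qed
    moreover have "(\<integral>\<^sup>+x. ennreal (h x * indicator (box c d) x) \<partial>lborel) = emeasure P X"
      by (auto simp: P_def X emeasure_density intro!: nn_integral_cong split: split_indicator)
    moreover have "(\<integral>\<^sup>+x. ennreal (- (h x * indicator (box c d) x)) \<partial>lborel) = emeasure Q X"
      by (auto simp: Q_def X emeasure_density intro!: nn_integral_cong split: split_indicator)
    ultimately show "emeasure P X = emeasure Q X" by simp
  next
    show "sets P = sigma_sets UNIV (range (\<lambda>(a, b). box a b))"
      "sets Q = sigma_sets UNIV (range (\<lambda>(a, b). box a b))"
      by (auto simp: P_def Q_def borel_eq_box)
    show "range (\<lambda>n::nat. box (- (real n *\<^sub>R One)) (real n *\<^sub>R One)) \<subseteq> range (\<lambda>(a, b). box a b :: 'a set)"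
      by auto
    show "(\<Union>n::nat. box (- (real n *\<^sub>R One)) (real n *\<^sub>R One)) = (UNIV :: 'a set)"
      by (rule UN_box_eq_UNIV)
    fix n :: nat
    have "emeasure P (box (- (real n *\<^sub>R One)) (real n *\<^sub>R One)) \<le> emeasure P UNIV"
      by (intro emeasure_mono) (auto simp: P_def)
    also have "\<dots> = (\<integral>\<^sup>+x. ennreal (h x) \<partial>lborel)" by (simp add: P_def emeasure_density)
    also have "\<dots> < \<infinity>" using fin by (simp add: less_top)
    finally show "emeasure P (box (- (real n *\<^sub>R One)) (real n *\<^sub>R One)) \<noteq> \<infinity>" by simp
  qed auto
  then have "AE x in lborel. ennreal (h x) = ennreal (- h x)"
    unfolding P_def Q_def
    by (subst (asm) finite_density_unique) (use fin in auto)
  then show ?thesis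
  proof eventually_elim
    case (elim x)
    then show ?case
      by (metis add.inverse_inverse ennreal_eq_0_iff ennreal_inj linorder_le_cases neg_0_le_iff_le
          neg_le_0_iff_le order_antisym)
  qed
qed

text \<open>In contrast to \<open>test_function\<close>, the set outside which the function vanishes
  is named, so that supports can be followed through products, derivatives and restrictions to an
  open set. K need not be compact or closed; compactness is added where it is used.\<close>

definition smooth_supp :: "'a set \<Rightarrow> ('a::euclidean_space \<Rightarrow> real) \<Rightarrow> bool" where
  "smooth_supp K \<phi> \<longleftrightarrow> (\<forall>k. Ck k \<phi>) \<and> (\<forall>x. x \<notin> K \<longrightarrow> \<phi> x = 0)"

lemma smooth_suppI:
  "(\<And>k. Ck k \<phi>) \<Longrightarrow> (\<And>x. x \<notin> K \<Longrightarrow> \<phi> x = 0) \<Longrightarrow> smooth_supp K \<phi>"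
  by (simp add: smooth_supp_def)

lemma smooth_supp_mono: "smooth_supp K \<phi> \<Longrightarrow> K \<subseteq> L \<Longrightarrow> smooth_supp L \<phi>"
  by (auto simp: smooth_supp_def)

lemma smooth_supp_Ck: "smooth_supp K \<phi> \<Longrightarrow> Ck k \<phi>"
  and smooth_supp_zero: "smooth_supp K \<phi> \<Longrightarrow> x \<notin> K \<Longrightarrow> \<phi> x = 0"
  by (auto simp: smooth_supp_def)

lemma smooth_supp_continuous: "smooth_supp K \<phi> \<Longrightarrow> continuous_on A \<phi>"
  using Ck_imp_continuous[of 0 \<phi>] continuous_on_subset[of UNIV \<phi> A] by (auto simp: smooth_supp_def)

lemma smooth_supp_borel: "smooth_supp K \<phi> \<Longrightarrow> \<phi> \<in> borel_measurable borel"
  by (intro borel_measurable_continuous_onI smooth_supp_continuous)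

lemma smooth_supp_test_function:
  assumes "smooth_supp K \<phi>" "compact K"
  shows "test_function \<phi>"
proof -
  have "closure {x. \<phi> x \<noteq> 0} \<subseteq> K"
    using assms by (intro closure_minimal compact_imp_closed) (auto simp: smooth_supp_def)
  then have "compact (closure {x. \<phi> x \<noteq> 0})"
    using assms(2) compact_Int_closed[of K "closure {x. \<phi> x \<noteq> 0}"] by (simp add: Int_absorb1)
  then show ?thesis using assms by (auto simp: test_function_def smooth_supp_def)
qed

lemma test_function_smooth_supp:
  assumes "test_function \<phi>"
  obtains R where "R > 0" "smooth_supp (cball 0 R) \<phi>"
proof -
  have "bounded (closure {x. \<phi> x \<noteq> 0})"
    using assms by (auto simp: test_function_def compact_imp_bounded)
  then obtain R where R: "R > 0" "closure {x. \<phi> x \<noteq> 0} \<subseteq> cball 0 R"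
    unfolding bounded_pos by (auto simp: subset_iff)
  have "smooth_supp (cball 0 R) \<phi>"
    using assms R closure_subset[of "{x. \<phi> x \<noteq> 0}"] by (auto simp: smooth_supp_def test_function_def)
  with R that show ?thesis by blast
qed

lemma box_bump:
  fixes c d :: "'a::euclidean_space"
  obtains \<beta> where "smooth_supp (box c d) \<beta>" "\<And>x. \<beta> x \<ge> 0" "\<And>x. x \<in> box c d \<Longrightarrow> \<beta> x > 0"
proof
  let ?b = "\<lambda>x. \<Prod>i\<in>Basis. exp_cutoff 0 (x \<bullet> i - c \<bullet> i) * exp_cutoff 0 (d \<bullet> i - x \<bullet> i)"
  have ge: "exp_cutoff 0 t \<ge> 0" and gr: "t > 0 \<Longrightarrow> exp_cutoff 0 t > 0" for t
    by (auto simp: exp_cutoff_def)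
  show "smooth_supp (box c d) ?b"
  proof (rule smooth_suppI)
    show "Ck k ?b" for k
      by (intro Ck_prod Ck_mult Ck_compose[OF Ck_exp_cutoff] Ck_diff Ck_inner Ck_const)
    show "?b x = 0" if "x \<notin> box c d" for x
    proof -
      from that obtain i where "i \<in> Basis" "x \<bullet> i \<le> c \<bullet> i \<or> d \<bullet> i \<le> x \<bullet> i"
        by (auto simp: mem_box not_less)
      then show ?thesis by (auto intro!: bexI[of _ i] simp: exp_cutoff_def)
    qed
  qed
  show "?b x \<ge> 0" for x by (intro prod_nonneg mult_nonneg_nonneg ballI ge)
  show "?b x > 0" if "x \<in> box c d" for x
    using that by (intro prod_pos mult_pos_pos ballI gr) (auto simp: mem_box)
qed

text \<open>Indicators of boxes are pointwise limits of admissible test functions bounded by 1, so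
  dominated convergence reduces the claim to the statement about boxes; countably many closed boxes
  then exhaust U.\<close>

lemma fundamental_lemma:
  fixes h :: "'a::euclidean_space \<Rightarrow> real"
  assumes "open U" and [measurable]: "h \<in> borel_measurable borel"
    and h: "\<And>K. compact K \<Longrightarrow> K \<subseteq> U \<Longrightarrow> set_integrable lborel K h"
    and zero: "\<And>K \<phi>. compact K \<Longrightarrow> K \<subseteq> U \<Longrightarrow> smooth_supp K \<phi> \<Longrightarrow> (LBINT x. h x * \<phi> x) = 0"
  shows "AE x in lborel. x \<in> U \<longrightarrow> h x = 0"
proof -
  have step: "AE x in lborel. x \<in> cbox a b \<longrightarrow> h x = 0" if ab: "cbox a b \<subseteq> U" for a b
  proof -
    have hab: "integrable lborel (\<lambda>x. h x * indicator (cbox a b) x)"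
      using h[OF compact_cbox ab] by (simp add: set_integrable_def mult.commute)
    have hab': "integrable lborel (\<lambda>x. h x * indicator (box a b) x)"
      by (rule Bochner_Integration.integrable_bound[OF hab])
        (use box_subset_cbox[of a b] in \<open>auto split: split_indicator\<close>)
    have "AE x in lborel. h x * indicator (box a b) x = 0"
    proof (rule AE_zero_if_integral_boxes_zero[OF hab'])
      fix c d :: 'a
      obtain c' d' where cd: "box a b \<inter> box c d = box c' d'" unfolding box_Int_box by blast
      obtain \<beta> where \<beta>: "smooth_supp (box c' d') \<beta>" "\<And>x. \<beta> x \<ge> 0" "\<And>x. x \<in> box c' d' \<Longrightarrow> \<beta> x > 0"
        using box_bump[of c' d'] by blast
      note [measurable] = smooth_supp_borel[OF \<beta>(1)]
      \<comment> \<open>With \<beta> positive exactly on the box, \<beta> / (\<beta> + 1/(n+1)) is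
        smooth, lies in [0, 1] and tends to the indicator of the box.\<close>
      define \<phi> where "\<phi> n x = \<beta> x * inverse (\<beta> x + inverse (real (Suc n)))" for n x
      have pos: "\<beta> x + inverse (real (Suc n)) > 0" for n x
        using \<beta>(2)[of x] by (intro add_nonneg_pos) auto
      have supp: "smooth_supp (cbox a b) (\<phi> n)" for n
      proof (rule smooth_suppI)
        show "Ck k (\<phi> n)" for k
          unfolding \<phi>_def
          by (intro Ck_mult Ck_inverse Ck_add Ck_const smooth_supp_Ck[OF \<beta>(1)])
            (use pos in \<open>metis less_irrefl\<close>)
        show "\<phi> n x = 0" if "x \<notin> cbox a b" for x
          using that smooth_supp_zero[OF \<beta>(1), of x] cd box_subset_cbox[of a b] by (auto simp: \<phi>_def)
      qed
      have bnd: "\<bar>\<phi> n x\<bar> \<le> 1" for n x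
        using \<beta>(2)[of x] pos[of x n] by (auto simp: \<phi>_def abs_mult field_simps)
      have lim: "(\<lambda>n. \<phi> n x) \<longlonglongrightarrow> indicator (box c' d') x" for x
      proof (cases "x \<in> box c' d'")
        case True
        have "(\<lambda>n. \<phi> n x) \<longlonglongrightarrow> \<beta> x * inverse (\<beta> x + 0)"
          unfolding \<phi>_def using \<beta>(3)[OF True]
          by (intro tendsto_intros LIMSEQ_inverse_real_of_nat) auto
        then show ?thesis using True \<beta>(3)[OF True] by simp
      next
        case False
        then show ?thesis using smooth_supp_zero[OF \<beta>(1), of x] by (simp add: \<phi>_def)
      qed
      have "(\<lambda>n. LBINT x. h x * \<phi> n x) \<longlonglongrightarrow> (LBINT x. h x * indicator (box c' d') x)"
      proof (rule integral_dominated_convergence[where w="\<lambda>x. \<bar>h x * indicator (cbox a b) x\<bar>"])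
        show "(\<lambda>x. h x * \<phi> n x) \<in> borel_measurable lborel" for n unfolding \<phi>_def by measurable
        show "AE x in lborel. (\<lambda>n. h x * \<phi> n x) \<longlonglongrightarrow> h x * indicator (box c' d') x"
          by (intro AE_I2 tendsto_intros lim)
        show "AE x in lborel. norm (h x * \<phi> n x) \<le> \<bar>h x * indicator (cbox a b) x\<bar>" for n
        proof (rule AE_I2)
          fix x show "norm (h x * \<phi> n x) \<le> \<bar>h x * indicator (cbox a b) x\<bar>"
            using bnd[of n x] smooth_supp_zero[OF supp[of n], of x]
            by (cases "x \<in> cbox a b") (auto simp: abs_mult intro: mult_left_le)
        qed
      qed (use hab in auto)
      moreover have "(LBINT x. h x * \<phi> n x) = 0" for n
        by (rule zero[OF compact_cbox ab supp])
      ultimately have "(LBINT x. h x * indicator (box c' d') x) = 0"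
        by (simp add: LIMSEQ_const_iff)
      then show "(LBINT x. h x * indicator (box a b) x * indicator (box c d) x) = 0"
        by (simp add: cd[symmetric] indicator_inter_arith mult.assoc)
    qed
    \<comment> \<open>The argument works on the open box; its boundary is a null set.\<close>
    moreover have "AE x in lborel. x \<notin> cbox a b - box a b"
      using negligible_frontier_interval[of a b]
      by (intro AE_not_in) (auto simp: null_sets_completion_iff negligible_iff_null_sets)
    ultimately show ?thesis by eventually_elim auto
  qed
  obtain D where D: "countable D" "D \<subseteq> Pow U" "\<And>X. X \<in> D \<Longrightarrow> \<exists>a b. X = cbox a b" "\<Union>D = U"
    using open_countable_Union_open_cbox[OF assms(1)] by blast
  have "AE x in lborel. \<forall>X\<in>D. x \<in> X \<longrightarrow> h x = 0"
    using D(1)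
  proof (rule AE_ball_countable[THEN iffD2], intro ballI)
    fix X assume "X \<in> D"
    then show "AE x in lborel. x \<in> X \<longrightarrow> h x = 0" using D(2,3) step by blast
  qed
  then show ?thesis
    by eventually_elim (use D(4) in auto)
qed

lemma has_derivative_outside_support:
  assumes "(\<phi> has_derivative D) (at x)" "closed K" "\<And>y. y \<notin> K \<Longrightarrow> \<phi> y = 0" "x \<notin> K"
  shows "D = (\<lambda>h. 0)"
proof -
  have "((\<lambda>x. 0) has_derivative D) (at x)"
    by (rule has_derivative_transform_within_open[OF assms(1), of "- K"]) (use assms in auto)
  then show ?thesis using has_derivative_unique[OF _ has_derivative_const] by blast
qed

text \<open>Difference quotients of F in direction e integrate to 0 by translation invariance, and
  they converge to the derivative dominatedly. This is the source of all integration by parts in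
  space.\<close>

lemma integral_directional_derivative_zero:
  fixes F :: "'a::euclidean_space \<Rightarrow> real"
  assumes D: "\<And>x. (F has_derivative D x) (at x)" and cont: "continuous_on UNIV (\<lambda>x. D x e)"
    and supp: "\<And>x. x \<notin> cball 0 R \<Longrightarrow> F x = 0"
  shows "(LBINT x. D x e) = 0"
proof -
  have contF: "continuous_on UNIV F"
    using D by (meson continuous_at_imp_continuous_on has_derivative_continuous)
  then have [measurable]: "F \<in> borel_measurable borel" by (rule borel_measurable_continuous_onI)
  have intF: "integrable lborel F"
    using integrable_lborel_compact_support[OF contF compact_cball supp] .
  have z: "D x e = 0" if "x \<notin> cball 0 R" for x
    using has_derivative_outside_support[OF D closed_cball supp that] by simp
  have "compact ((\<lambda>x. D x e) ` cball 0 R)"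
    by (intro compact_continuous_image continuous_on_subset[OF cont]) auto
  then have "\<exists>M0. \<forall>x\<in>cball 0 R. \<bar>D x e\<bar> \<le> M0"
    using compact_imp_bounded[of "(\<lambda>x. D x e) ` cball 0 R"] by (simp add: bounded_iff)
  then obtain M0 where M0: "\<And>x. x \<in> cball 0 R \<Longrightarrow> \<bar>D x e\<bar> \<le> M0" by blast
  define M where "M = max M0 0"
  have M: "\<bar>D x e\<bar> \<le> M" for x
    using M0[of x] z[of x] by (cases "x \<in> cball 0 R") (auto simp: M_def)
  define s where "s n x = (F (inverse (real (Suc n)) *\<^sub>R e + x) - F x) / inverse (real (Suc n))" for n x
  have shift: "(LBINT x. F (c + x)) = (LBINT x. F x)" "integrable lborel (\<lambda>x. F (c + x))" for c
  proof -
    have "integral\<^sup>L (distr lborel borel ((+) c)) F = (LBINT x. F (c + x))"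
      by (rule integral_distr) auto
    then show "(LBINT x. F (c + x)) = (LBINT x. F x)" by (simp add: lborel_distr_plus)
    have "integrable (distr lborel borel ((+) c)) F" using intF by (simp add: lborel_distr_plus)
    then show "integrable lborel (\<lambda>x. F (c + x))" by (subst (asm) integrable_distr_eq) auto
  qed
  have int0: "(LBINT x. s n x) = 0" for n
    unfolding s_def using shift intF by simp
  have line: "((\<lambda>t. F (t *\<^sub>R e + x)) has_real_derivative D (t *\<^sub>R e + x) e) (at t)" for t x
  proof -
    have "((\<lambda>t. t *\<^sub>R e + x) has_derivative (\<lambda>h. h *\<^sub>R e)) (at t)"
      by (auto intro!: derivative_eq_intros)
    note has_derivative_compose[OF this D]
    moreover have "(\<lambda>h. D (t *\<^sub>R e + x) (h *\<^sub>R e)) = (*) (D (t *\<^sub>R e + x) e)"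
      using linear_scale[OF has_derivative_linear[OF D]] by (auto simp: fun_eq_iff)
    ultimately show ?thesis by (simp add: has_field_derivative_def)
  qed
  \<comment> \<open>By the mean value theorem the quotient is a derivative at a point shifted by at
    most |e|, as the step is at most 1; hence the bound M and the ball enlarged by |e|.\<close>
  have bnd: "\<bar>s n x\<bar> \<le> M * indicator (cball 0 (R + norm e)) x" for n x
  proof -
    have p: "inverse (real (Suc n)) > 0" "inverse (real (Suc n)) \<le> 1" by (auto simp: field_simps)
    obtain \<xi> where \<xi>: "0 < \<xi>" "\<xi> < inverse (real (Suc n))"
      "F (inverse (real (Suc n)) *\<^sub>R e + x) - F (0 *\<^sub>R e + x) = (inverse (real (Suc n)) - 0) * D (\<xi> *\<^sub>R e + x) e"
      using MVT2[OF p(1), of "\<lambda>t. F (t *\<^sub>R e + x)" "\<lambda>t. D (t *\<^sub>R e + x) e"] line by blast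
    then have sn: "s n x = D (\<xi> *\<^sub>R e + x) e" using p by (simp add: s_def)
    show ?thesis
    proof (cases "x \<in> cball 0 (R + norm e)")
      case False
      have "norm x \<le> norm (\<xi> *\<^sub>R e + x) + norm (\<xi> *\<^sub>R e)"
        using norm_triangle_ineq4[of "\<xi> *\<^sub>R e + x" "\<xi> *\<^sub>R e"] by simp
      moreover have "norm (\<xi> *\<^sub>R e) \<le> norm e" using \<xi> p by (simp add: mult_left_le_one_le)
      ultimately have "\<xi> *\<^sub>R e + x \<notin> cball 0 R" using False by auto
      then show ?thesis using sn z False by simp
    qed (use sn M in auto)
  qed
  have lim: "(\<lambda>n. s n x) \<longlonglongrightarrow> D x e" for x
  proof -
    have "(\<lambda>h. (F ((0 + h) *\<^sub>R e + x) - F (0 *\<^sub>R e + x)) / h) \<midarrow>0\<rightarrow> D (0 *\<^sub>R e + x) e"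
      using line[of x 0] by (simp add: DERIV_def)
    moreover have "filterlim (\<lambda>n. inverse (real (Suc n))) (at 0) sequentially"
      using LIMSEQ_inverse_real_of_nat by (auto simp: filterlim_at)
    ultimately have "(\<lambda>n. (F ((0 + inverse (real (Suc n))) *\<^sub>R e + x) - F (0 *\<^sub>R e + x)) / inverse (real (Suc n)))
      \<longlonglongrightarrow> D (0 *\<^sub>R e + x) e"
      by (rule filterlim_compose)
    then show ?thesis by (simp add: s_def)
  qed
  have "(\<lambda>n. LBINT x. s n x) \<longlonglongrightarrow> (LBINT x. D x e)"
  proof (rule integral_dominated_convergence[where w="\<lambda>x. M * indicator (cball 0 (R + norm e)) x"])
    show "(\<lambda>x. D x e) \<in> borel_measurable lborel"
      using borel_measurable_continuous_onI[OF cont] by simp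
    show "s n \<in> borel_measurable lborel" for n unfolding s_def by measurable
    show "integrable lborel (\<lambda>x. M * indicator (cball 0 (R + norm e)) x)"
      by (intro integrable_mult_right integrable_real_indicator) (use emeasure_lborel_cball_finite[of 0 "R + norm e"] in \<open>auto simp: less_top\<close>)
  qed (use lim bnd in auto)
  then show ?thesis by (simp add: int0 LIMSEQ_const_iff)
qed

section \<open>Distributions on the half-line\<close>

lemma smooth_supp_has_deriv:
  fixes \<eta> :: "real \<Rightarrow> real"
  shows "smooth_supp K \<eta> \<Longrightarrow> (\<eta> has_real_derivative deriv \<eta> x) (at x)"
  using Ck_Suc_realD(1)[of 0 \<eta> x] by (simp only: smooth_supp_def)

lemma smooth_supp_deriv:
  fixes \<eta> :: "real \<Rightarrow> real"
  assumes "smooth_supp K \<eta>" "closed K"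
  shows "smooth_supp K (deriv \<eta>)"
proof (rule smooth_suppI)
  show "Ck k (deriv \<eta>)" for k
    using Ck_Suc_realD(2)[of k \<eta>] assms(1) by (simp only: smooth_supp_def)
  fix x assume x: "x \<notin> K"
  have "(\<eta> has_real_derivative 0) (at x)"
    by (rule has_field_derivative_transform_within_open[OF DERIV_const, where S="- K"])
      (use assms x in \<open>auto simp: smooth_supp_zero\<close>)
  then show "deriv \<eta> x = 0" by (rule DERIV_imp_deriv)
qed

lemma smooth_supp_mult_powr:
  assumes "smooth_supp {\<alpha>..\<beta>} \<eta>" "\<alpha> > 0"
  shows "smooth_supp {\<alpha>..\<beta>} (\<lambda>r. \<eta> r * r powr s)"
  using assms by (intro smooth_suppI Ck_mult_powr[of _ _ \<alpha>]) (auto simp: smooth_supp_def)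

lemma smooth_supp_lincomb:
  "smooth_supp K f \<Longrightarrow> smooth_supp K g \<Longrightarrow> smooth_supp K (\<lambda>x. f x - c * g x)"
  by (auto simp: smooth_supp_def intro!: Ck_diff Ck_mult Ck_const)

lemma smooth_supp_integrable:
  "smooth_supp K \<eta> \<Longrightarrow> compact K \<Longrightarrow> integrable lborel \<eta>"
  by (rule integrable_lborel_compact_support[of _ K]) (auto intro: smooth_supp_continuous smooth_supp_zero)

lemma integrable_mult_smooth_supp:
  fixes Y :: "'a::euclidean_space \<Rightarrow> real"
  assumes "set_integrable lborel K Y" "smooth_supp K \<eta>" "compact K" "Y \<in> borel_measurable borel"
  shows "integrable lborel (\<lambda>r. Y r * \<eta> r)"
proof -
  note [measurable] = smooth_supp_borel[OF assms(2)] assms(4)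
  obtain M where M: "\<And>x. x \<in> K \<Longrightarrow> \<bar>\<eta> x\<bar> \<le> M"
    using compact_imp_bounded[OF compact_continuous_image[OF smooth_supp_continuous[OF assms(2), of K] assms(3)]]
    by (auto simp: bounded_iff)
  have "integrable lborel (\<lambda>x. M * (indicator K x *\<^sub>R Y x))"
    using assms(1) by (auto simp: set_integrable_def)
  then show ?thesis
  proof (rule Bochner_Integration.integrable_bound)
    show "AE x in lborel. norm (Y x * \<eta> x) \<le> norm (M * (indicator K x *\<^sub>R Y x))"
    proof (rule AE_I2)
      fix x
      show "norm (Y x * \<eta> x) \<le> norm (M * (indicator K x *\<^sub>R Y x))"
        using M[of x] smooth_supp_zero[OF assms(2), of x]
        by (cases "x \<in> K") (auto simp: abs_mult mult.commute[of _ "\<bar>Y x\<bar>"] intro!: mult_left_mono)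
    qed
  qed measurable
qed

lemma integral_smooth_supp_tail:
  fixes \<eta> :: "real \<Rightarrow> real"
  assumes "smooth_supp {\<alpha>..\<beta>} \<eta>"
  shows "(LBINT t. deriv \<eta> t * indicator {s..} t) = - \<eta> s"
    and "(LBINT t. deriv \<eta> t) = 0"
proof -
  have tail: "(LBINT t. deriv \<eta> t * indicator {s..} t) = - \<eta> s" for s
  proof -
    define b where "b = max s \<beta> + 1"
    have "(LBINT t. deriv \<eta> t * indicator {s..} t) = (LBINT t. deriv \<eta> t * indicator {s..b} t)"
      by (intro Bochner_Integration.integral_cong)
        (auto simp: b_def split: split_indicator intro!: smooth_supp_zero[OF smooth_supp_deriv[OF assms]])
    also have "\<dots> = \<eta> b - \<eta> s"
      using smooth_supp_continuous[OF smooth_supp_deriv[OF assms], of UNIV] smooth_supp_has_deriv[OF assms]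
      by (intro integral_FTC_Icc_real) (auto simp: b_def continuous_on_eq_continuous_at)
    finally have "(LBINT t. deriv \<eta> t * indicator {s..} t) = \<eta> b - \<eta> s" .
    moreover have "\<eta> b = 0" by (rule smooth_supp_zero[OF assms]) (auto simp: b_def)
    ultimately show ?thesis by simp
  qed
  then show "(LBINT t. deriv \<eta> t * indicator {s..} t) = - \<eta> s" .
  have "(LBINT t. deriv \<eta> t) = (LBINT t. deriv \<eta> t * indicator {\<alpha> - 1..} t)"
    by (intro Bochner_Integration.integral_cong)
      (auto split: split_indicator intro!: smooth_supp_zero[OF smooth_supp_deriv[OF assms]])
  then show "(LBINT t. deriv \<eta> t) = 0"
    using tail smooth_supp_zero[OF assms, of "\<alpha> - 1"] by simp
qed

text \<open>The primitive from the left is constant to the right of the support, and that constant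
  is the total integral; mean zero is what keeps the support compact.\<close>

lemma smooth_supp_antideriv:
  fixes \<zeta> :: "real \<Rightarrow> real"
  assumes \<zeta>: "smooth_supp {\<alpha>..\<beta>} \<zeta>" and zero: "(LBINT t. \<zeta> t) = 0"
  obtains \<eta> where "smooth_supp {\<alpha>..\<beta>} \<eta>" "deriv \<eta> = \<zeta>"
proof
  note int = smooth_supp_integrable[OF \<zeta> compact_Icc]
  note [measurable] = smooth_supp_borel[OF \<zeta>]
  define \<eta> where "\<eta> t = (LBINT s. \<zeta> s * indicator {..t} s)" for t
  have D: "(\<eta> has_real_derivative \<zeta> t) (at t)" for t
  proof -
    \<comment> \<open>A base point to the left of both the support and t: starting there loses no
      mass, and t is interior to the interval on which the fundamental theorem is applied.\<close>
    define a where "a = min \<alpha> t - 1"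
    have eq: "\<eta> x = integral {a..x} \<zeta>" if "x > a" for x
    proof -
      have "\<eta> x = (LBINT s:{a..x}. \<zeta> s)"
        unfolding \<eta>_def set_lebesgue_integral_def
        by (intro Bochner_Integration.integral_cong)
          (auto simp: a_def split: split_indicator intro!: smooth_supp_zero[OF \<zeta>])
      also have "\<dots> = integral {a..x} \<zeta>"
        by (intro set_borel_integral_eq_integral borel_integrable_atLeastAtMost' smooth_supp_continuous[OF \<zeta>])
      finally show ?thesis .
    qed
    have "((\<lambda>x. integral {a..x} \<zeta>) has_real_derivative \<zeta> t) (at t within {a..t + 1})"
      by (rule integral_has_real_derivative[OF smooth_supp_continuous[OF \<zeta>]]) (auto simp: a_def)
    then have der: "((\<lambda>x. integral {a..x} \<zeta>) has_real_derivative \<zeta> t) (at t)"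
      by (subst (asm) at_within_Icc_at) (auto simp: a_def)
    have "t \<in> {a<..}" by (simp add: a_def)
    then show ?thesis
      by (rule has_field_derivative_transform_within_open[OF der open_greaterThan]) (simp add: eq)
  qed
  show "deriv \<eta> = \<zeta>" using DERIV_imp_deriv[OF D] by auto
  show "smooth_supp {\<alpha>..\<beta>} \<eta>"
  proof (rule smooth_suppI)
    fix k show "Ck k \<eta>"
    proof (cases k)
      case 0
      then show ?thesis using DERIV_continuous_on[OF D] by simp
    next
      case (Suc n)
      then show ?thesis using Ck_Suc_realI[OF D smooth_supp_Ck[OF \<zeta>]] by simp
    qed
  next
    fix x assume "x \<notin> {\<alpha>..\<beta>}"
    then consider "x < \<alpha>" | "x > \<beta>" by fastforce
    then show "\<eta> x = 0"
    proof cases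
      case 1
      have z: "\<zeta> s * indicator {..x} s = 0" for s
        using 1 by (auto split: split_indicator intro!: smooth_supp_zero[OF \<zeta>])
      show ?thesis unfolding \<eta>_def z by simp
    next
      case 2
      have "\<eta> x = (LBINT s. \<zeta> s)"
        unfolding \<eta>_def
        by (intro Bochner_Integration.integral_cong)
          (use 2 in \<open>auto split: split_indicator intro!: smooth_supp_zero[OF \<zeta>]\<close>)
      then show ?thesis using zero by simp
    qed
  qed
qed

lemma real_bump:
  fixes \<alpha> \<beta> :: real
  assumes "\<alpha> < \<beta>"
  obtains \<eta> where "smooth_supp {\<alpha>..\<beta>} \<eta>" "(LBINT t. \<eta> t) = 1"
proof -
  obtain \<beta>' where b: "smooth_supp (box \<alpha> \<beta>) \<beta>'" "\<And>x. \<beta>' x \<ge> 0" "\<And>x. x \<in> box \<alpha> \<beta> \<Longrightarrow> \<beta>' x > 0"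
    using box_bump[of \<alpha> \<beta>] by blast
  have s: "smooth_supp {\<alpha>..\<beta>} \<beta>'"
    using b(1) by (rule smooth_supp_mono) (auto simp: box_real)
  have "(LBINT t. \<beta>' t) \<noteq> 0"
  proof
    assume "(LBINT t. \<beta>' t) = 0"
    then have "AE t in lborel. \<beta>' t = 0"
      using integral_nonneg_eq_0_iff_AE[OF smooth_supp_integrable[OF s compact_Icc]] b(2) by auto
    then have "AE t in lborel. t \<notin> {\<alpha><..<\<beta>}"
      by eventually_elim (use b(3) in \<open>force simp: box_real\<close>)
    then have "emeasure lborel {\<alpha><..<\<beta>} = 0"
      by (subst (asm) AE_iff_measurable[of "{\<alpha><..<\<beta>}"]) auto
    then show False using assms by simp
  qed
  then have "smooth_supp {\<alpha>..\<beta>} (\<lambda>t. inverse (LBINT t. \<beta>' t) * \<beta>' t)"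
    "(LBINT t. inverse (LBINT t. \<beta>' t) * \<beta>' t) = 1"
    using s by (auto simp: smooth_supp_def intro!: Ck_mult Ck_const)
  then show ?thesis using that by blast
qed

text \<open>Subtracting a multiple of one fixed bump \<eta>0 of mass 1 makes any test function
  \<zeta> a derivative. The hypothesis then says that Y - c, with c = \<integral> Y \<eta>0,
  annihilates \<zeta>, and the fundamental lemma applies.\<close>

lemma du_Bois_Reymond:
  fixes Y :: "real \<Rightarrow> real"
  assumes [measurable]: "Y \<in> borel_measurable borel"
    and Y: "\<And>\<alpha> \<beta>. l < \<alpha> \<Longrightarrow> set_integrable lborel {\<alpha>..\<beta>} Y"
    and zero: "\<And>\<eta> \<alpha> \<beta>. l < \<alpha> \<Longrightarrow> smooth_supp {\<alpha>..\<beta>} \<eta> \<Longrightarrow> (LBINT t. Y t * deriv \<eta> t) = 0"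
  shows "\<exists>c. AE t in lborel. l < t \<longrightarrow> Y t = c"
proof -
  obtain \<eta>0 where \<eta>0: "smooth_supp {l + 1..l + 2} \<eta>0" "(LBINT t. \<eta>0 t) = 1"
    using real_bump[of "l + 1" "l + 2"] by auto
  note [measurable] = smooth_supp_borel[OF \<eta>0(1)]
  define c where "c = (LBINT t. Y t * \<eta>0 t)"
  have "AE t in lborel. t \<in> {l<..} \<longrightarrow> Y t - c = 0"
  proof (rule fundamental_lemma)
    show "(\<lambda>t. Y t - c) \<in> borel_measurable borel" by measurable
    fix K assume K: "compact K" "K \<subseteq> {l<..}"
    obtain \<alpha> \<beta> where ab: "l < \<alpha>" "K \<subseteq> {\<alpha>..\<beta>}"
    proof (cases "K = {}")
      case True
      then show ?thesis using that[of "l + 1" "l + 1"] by auto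
    next
      case False
      obtain x y where "x \<in> K" "\<forall>z\<in>K. x \<le> z" "\<forall>z\<in>K. z \<le> y"
        using compact_attains_inf[OF K(1) False] compact_attains_sup[OF K(1) False] by auto
      then show ?thesis using K(2) by (intro that[of x y]) auto
    qed
    have "set_integrable lborel {\<alpha>..\<beta>} (\<lambda>t. Y t - c)"
      by (intro set_integral_diff Y ab borel_integrable_atLeastAtMost' continuous_on_const)
    then show "set_integrable lborel K (\<lambda>t. Y t - c)"
      by (rule set_integrable_subset) (use ab K in \<open>auto simp: compact_imp_closed borel_closed\<close>)
    fix \<zeta> assume "smooth_supp K \<zeta>"
    \<comment> \<open>One interval that contains the supports of both \<zeta> and the fixed
      bump.\<close>
    define \<alpha>' \<beta>' where "\<alpha>' = min \<alpha> (l + 1)" and "\<beta>' = max \<beta> (l + 2)"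
    have \<alpha>': "l < \<alpha>'" using ab by (simp add: \<alpha>'_def)
    have \<zeta>: "smooth_supp {\<alpha>'..\<beta>'} \<zeta>"
      by (rule smooth_supp_mono[OF \<open>smooth_supp K \<zeta>\<close>])
        (use ab in \<open>auto simp: \<alpha>'_def \<beta>'_def min_le_iff_disj le_max_iff_disj subset_iff\<close>)
    have \<eta>0': "smooth_supp {\<alpha>'..\<beta>'} \<eta>0"
      by (rule smooth_supp_mono[OF \<eta>0(1)]) (auto simp: \<alpha>'_def \<beta>'_def)
    define \<kappa> where "\<kappa> = (LBINT t. \<zeta> t)"
    note int = smooth_supp_integrable[OF \<zeta> compact_Icc] smooth_supp_integrable[OF \<eta>0' compact_Icc]
    note intY = integrable_mult_smooth_supp[OF Y[OF \<alpha>'] \<zeta> compact_Icc assms(1)]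
      integrable_mult_smooth_supp[OF Y[OF \<alpha>'] \<eta>0' compact_Icc assms(1)]
    have "(LBINT t. \<zeta> t - \<kappa> * \<eta>0 t) = 0"
      using int \<eta>0(2) by (simp add: \<kappa>_def)
    then obtain \<eta> where \<eta>: "smooth_supp {\<alpha>'..\<beta>'} \<eta>" "deriv \<eta> = (\<lambda>t. \<zeta> t - \<kappa> * \<eta>0 t)"
      using smooth_supp_antideriv[OF smooth_supp_lincomb[OF \<zeta> \<eta>0', of \<kappa>]] by metis
    have "0 = (LBINT t. Y t * \<zeta> t - \<kappa> * (Y t * \<eta>0 t))"
      using zero[OF \<alpha>' \<eta>(1)] \<eta>(2) by (simp add: algebra_simps)
    also have "\<dots> = (LBINT t. Y t * \<zeta> t) - \<kappa> * c"
      using intY by (simp add: c_def)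
    also have "\<dots> = (LBINT t. (Y t - c) * \<zeta> t)"
      using intY int by (simp add: left_diff_distrib \<kappa>_def)
    finally show "(LBINT t. (Y t - c) * \<zeta> t) = 0" by simp
  qed auto
  then show ?thesis by (intro exI[of _ c]) (auto elim: eventually_mono)
qed

text \<open>Fubini in layer-cake form: integration by parts along \<open>\<nu>\<close> for a function \<open>j\<close> that is merely integrable.\<close>

lemma integral_layer:
  fixes j :: "'a \<Rightarrow> real" and \<nu> :: "'a \<Rightarrow> real"
  assumes "sigma_finite_measure M" and [measurable]: "\<nu> \<in> borel_measurable M" "j \<in> borel_measurable M"
    and \<psi>: "smooth_supp {\<alpha>..\<beta>} \<psi>" and "\<delta> < \<alpha>"
    and j: "integrable M (\<lambda>x. j x * indicator {\<delta><..\<beta>} (\<nu> x))"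
  shows "(LINT x|M. j x * \<psi> (\<nu> x)) =
    - (LBINT t. deriv \<psi> t * (LINT x|M. j x * indicator {\<delta><..t} (\<nu> x)))"
proof -
  interpret pair_sigma_finite M lborel
    by (intro pair_sigma_finite.intro assms(1) sigma_finite_lborel)
  note \<psi>' = smooth_supp_deriv[OF \<psi> closed_atLeastAtMost]
  note [measurable] = smooth_supp_borel[OF \<psi>]  smooth_supp_borel[OF \<psi>']
  note int\<psi>' = smooth_supp_integrable[OF \<psi>' compact_Icc]
  \<comment> \<open>Since \<psi>(\<nu> x) is minus the integral of \<psi>' over t \<ge> \<nu> x,
    integrating g in t first gives - j \<psi>(\<nu>), while integrating in x first gives \<psi>'
    times the truncated integral of j. The strict lower cut at \<delta> < \<alpha> is invisible to
    \<psi>.\<close>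
  define g where "g x t = (j x * indicator {\<delta><..\<beta>} (\<nu> x)) * (deriv \<psi> t * indicator {\<nu> x..} t)" for x t
  have "integrable (M \<Otimes>\<^sub>M lborel) (\<lambda>(x, t). (j x * indicator {\<delta><..\<beta>} (\<nu> x)) * deriv \<psi> t)"
    using integrable_norm[OF j] j int\<psi>' by (intro Fubini_integrable) (auto simp: abs_mult)
  then have "integrable (M \<Otimes>\<^sub>M lborel) (case_prod g)"
  proof (rule Bochner_Integration.integrable_bound)
    have [measurable]: "Measurable.pred (M \<Otimes>\<^sub>M lborel) (\<lambda>x. snd x \<in> {\<nu> (fst x)..})"
      unfolding atLeast_iff by measurable
    show "case_prod g \<in> borel_measurable (M \<Otimes>\<^sub>M lborel)"
      unfolding g_def case_prod_beta' indicator_def by measurable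
  qed (auto simp: g_def abs_mult split: split_indicator)
  then have "(LBINT t. (LINT x|M. g x t)) = (LINT x|M. (LBINT t. g x t))"
    by (rule Fubini_integral)
  also have "(LINT x|M. (LBINT t. g x t)) = - (LINT x|M. j x * \<psi> (\<nu> x))"
  proof -
    have "(LBINT t. g x t) = - (j x * \<psi> (\<nu> x))" for x
    proof -
      have "(LBINT t. g x t) = (j x * indicator {\<delta><..\<beta>} (\<nu> x)) * (- \<psi> (\<nu> x))"
        unfolding g_def integral_mult_right_zero integral_smooth_supp_tail(1)[OF \<psi>] ..
      then show ?thesis
        using smooth_supp_zero[OF \<psi>, of "\<nu> x"] assms(5) by (auto split: split_indicator)
    qed
    then show ?thesis by simp
  qed
  also have "(LBINT t. (LINT x|M. g x t)) = (LBINT t. deriv \<psi> t * (LINT x|M. j x * indicator {\<delta><..t} (\<nu> x)))"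
  proof (rule Bochner_Integration.integral_cong[OF refl])
    fix t :: real
    show "(LINT x|M. g x t) = deriv \<psi> t * (LINT x|M. j x * indicator {\<delta><..t} (\<nu> x))"
    proof (cases "t \<in> {\<alpha>..\<beta>}")
      case True
      have "(LINT x|M. g x t) = (LINT x|M. deriv \<psi> t * (j x * indicator {\<delta><..t} (\<nu> x)))"
        using True by (intro Bochner_Integration.integral_cong) (auto simp: g_def split: split_indicator)
      then show ?thesis by simp
    next
      case False
      then show ?thesis using smooth_supp_zero[OF \<psi>', of t] by (simp add: g_def)
    qed
  qed
  finally show ?thesis by simp
qed

section \<open>Primitives on the open half-line\<close>

text \<open>There is no base point: k need not be integrable near 0, so only increments between
  positive points are prescribed, and K is free up to an additive constant.\<close>

definition primitive_of :: "(real \<Rightarrow> real) \<Rightarrow> (real \<Rightarrow> real) \<Rightarrow> bool" where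
  "primitive_of k K \<longleftrightarrow> (\<forall>s t. 0 < s \<longrightarrow> s \<le> t \<longrightarrow> K t - K s = integral {s..t} k)"

lemma primitive_ofD: "primitive_of k K \<Longrightarrow> 0 < s \<Longrightarrow> s \<le> t \<Longrightarrow> K t = K s + integral {s..t} k"
  unfolding primitive_of_def by (metis add.commute diff_add_cancel)

lemma primitive_exists:
  assumes k: "\<And>\<alpha> \<beta>. 0 < \<alpha> \<Longrightarrow> set_integrable lborel {\<alpha>..\<beta>} k"
  shows "\<exists>K. primitive_of k K"
proof -
  define K where "K t = (if 1 \<le> t then integral {1..t} k else - integral {t..1} k)" for t
  have int: "k integrable_on {\<alpha>..\<beta>}" if "0 < \<alpha>" for \<alpha> \<beta>
    using set_borel_integral_eq_integral(1)[OF k[OF that]] .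
  have "K t - K s = integral {s..t} k" if st: "0 < s" "s \<le> t" for s t
  proof -
    consider "1 \<le> s" | "s \<le> 1" "1 \<le> t" | "t \<le> 1" by linarith
    then show ?thesis
    proof cases
      case 1
      have "integral {1..s} k + integral {s..t} k = integral {1..t} k"
        by (rule Henstock_Kurzweil_Integration.integral_combine) (use 1 st int in auto)
      then show ?thesis using 1 st by (simp add: K_def)
    next
      case 2
      have "integral {s..1} k + integral {1..t} k = integral {s..t} k"
        by (rule Henstock_Kurzweil_Integration.integral_combine) (use 2 st int in auto)
      then show ?thesis using 2 st by (cases "s = 1") (auto simp add: K_def)
    next
      case 3
      have "integral {s..t} k + integral {t..1} k = integral {s..1} k"
        by (rule Henstock_Kurzweil_Integration.integral_combine) (use 3 st int in auto)
      then show ?thesis using 3 st by (cases "t = 1"; cases "s = 1") (auto simp add: K_def)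
    qed
  qed
  then show ?thesis by (auto simp: primitive_of_def)
qed

lemma primitive_of_continuous:
  assumes k: "\<And>\<alpha> \<beta>. 0 < \<alpha> \<Longrightarrow> set_integrable lborel {\<alpha>..\<beta>} k" and K: "primitive_of k K"
  shows "continuous_on {0<..} K"
  unfolding continuous_on_eq_continuous_at[OF open_greaterThan]
proof
  fix t :: real assume "t \<in> {0<..}"
  then have t: "t > 0" by simp
  have cont: "continuous_on {t / 2..t + 1} (\<lambda>x. K (t / 2) + integral {t / 2..x} k)"
    using set_borel_integral_eq_integral(1)[OF k, of "t / 2" "t + 1"] t
    by (intro continuous_intros indefinite_integral_continuous_1) auto
  have eq: "K (t / 2) + integral {t / 2..x} k = K x" if "x \<in> {t / 2..t + 1}" for x
    using primitive_ofD[OF K, of "t / 2" x] that t by simp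
  have "continuous_on {t / 2..t + 1} K" by (rule continuous_on_eq[OF cont eq])
  then show "isCont K t"
    by (rule continuous_on_interior) (use t in auto)
qed

lemma primitive_of_has_derivative:
  assumes k: "continuous_on {0<..} k" and K: "primitive_of k K" and "t > 0"
  shows "(K has_real_derivative k t) (at t)"
proof -
  have "((\<lambda>x. K (t / 2) + integral {t / 2..x} k) has_real_derivative 0 + k t) (at t within {t / 2..t + 1})"
    using assms by (intro DERIV_add DERIV_const integral_has_real_derivative continuous_on_subset[OF k]) auto
  then have "((\<lambda>x. K (t / 2) + integral {t / 2..x} k) has_real_derivative k t) (at t)"
    using assms(3) by (subst (asm) at_within_Icc_at) auto
  moreover have "K (t / 2) + integral {t / 2..x} k = K x" if "x \<in> {t / 2<..}" for x
    using primitive_ofD[OF K, of "t / 2" x] that assms(3) by simp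
  moreover have "t \<in> {t / 2<..}" using assms(3) by simp
  ultimately show ?thesis
    using has_field_derivative_transform_within_open[OF _ open_greaterThan] by blast
qed

text \<open>The regularity gain rests on this: an integrand that agrees almost everywhere with a
  continuous one may be exchanged for it, after which K is differentiable in the classical
  sense.\<close>

lemma primitive_of_cong_AE:
  assumes "primitive_of k K" "AE r in lborel. 0 < r \<longrightarrow> k r = k' r"
  shows "primitive_of k' K"
proof -
  have "AE r in lebesgue. 0 < r \<longrightarrow> k r = k' r" using assms(2) by (rule AE_completion)
  then obtain N where N: "N \<in> null_sets lebesgue" "{r. \<not> (0 < r \<longrightarrow> k r = k' r)} \<subseteq> N"
    by (auto simp: eventually_ae_filter)
  have eq: "k r = k' r" if "0 < r" "r \<notin> N" for r using N(2) that by auto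
  have "integral {s..t} k' = integral {s..t} k" if "0 < s" for s t
    by (rule integral_spike[of N]) (use N(1) eq that in \<open>auto simp: negligible_iff_null_sets\<close>)
  then show ?thesis using assms(1) by (simp add: primitive_of_def)
qed

text \<open>As k is only locally integrable, K need not be differentiable, and the layer formula
  replaces the product rule. It produces K minus its value at \<alpha>/2; the constant drops out
  because \<psi>' has integral 0.\<close>

lemma integral_by_parts_primitive:
  assumes [measurable]: "k \<in> borel_measurable borel"
    and k: "\<And>\<alpha> \<beta>. 0 < \<alpha> \<Longrightarrow> set_integrable lborel {\<alpha>..\<beta>} k" and K: "primitive_of k K"
    and \<psi>: "smooth_supp {\<alpha>..\<beta>} \<psi>" and "0 < \<alpha>"
  shows "(LBINT t. k t * \<psi> t) = - (LBINT t. deriv \<psi> t * K t)"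
proof -
  note \<psi>' = smooth_supp_deriv[OF \<psi> closed_atLeastAtMost]
  have K': "deriv \<psi> t * (LBINT x. k x * indicator {\<alpha> / 2<..t} x) = deriv \<psi> t * K t - K (\<alpha> / 2) * deriv \<psi> t" for t
  proof (cases "t \<in> {\<alpha>..\<beta>}")
    case True
    have "(LBINT x. k x * indicator {\<alpha> / 2<..t} x) = (LBINT x:{\<alpha> / 2..t}. k x)"
      unfolding set_lebesgue_integral_def
      by (intro integral_cong_AE, measurable)
        (use AE_lborel_singleton[of "\<alpha> / 2"] in \<open>auto elim!: eventually_mono split: split_indicator\<close>)
    also have "\<dots> = integral {\<alpha> / 2..t} k"
      by (rule set_borel_integral_eq_integral(2)[OF k]) (use \<open>0 < \<alpha>\<close> in auto)
    also have "\<dots> = K t - K (\<alpha> / 2)"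
      using primitive_ofD[OF K, of "\<alpha> / 2" t] True \<open>0 < \<alpha>\<close> by auto
    finally have I: "(LBINT x. k x * indicator {\<alpha> / 2<..t} x) = K t - K (\<alpha> / 2)" .
    show ?thesis unfolding I by (simp add: algebra_simps)
  next
    case False
    then show ?thesis using smooth_supp_zero[OF \<psi>', of t] by simp
  qed
  have "continuous_on {\<alpha>..\<beta>} K"
    by (rule continuous_on_subset[OF primitive_of_continuous[OF k K]]) (use \<open>0 < \<alpha>\<close> in auto)
  then have "integrable lborel (\<lambda>t. indicator {\<alpha>..\<beta>} t *\<^sub>R (deriv \<psi> t * K t))"
    by (intro borel_integrable_compact continuous_on_mult smooth_supp_continuous[OF \<psi>']) auto
  also have "(\<lambda>t. indicator {\<alpha>..\<beta>} t *\<^sub>R (deriv \<psi> t * K t)) = (\<lambda>t. deriv \<psi> t * K t)"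
    using smooth_supp_zero[OF \<psi>'] by (auto simp: fun_eq_iff split: split_indicator)
  finally have int: "integrable lborel (\<lambda>t. deriv \<psi> t * K t)" .
  have "set_integrable lborel {\<alpha> / 2<..\<beta>} k"
    by (rule set_integrable_subset[OF k[of "\<alpha> / 2" \<beta>]]) (use \<open>0 < \<alpha>\<close> in auto)
  then have "integrable lborel (\<lambda>x. k x * indicator {\<alpha> / 2<..\<beta>} x)"
    by (simp add: set_integrable_def mult.commute)
  then have "(LBINT t. k t * \<psi> t) =
      - (LBINT t. deriv \<psi> t * (LBINT x. k x * indicator {\<alpha> / 2<..t} x))"
    using integral_layer[OF sigma_finite_lborel, of "\<lambda>x. x" k \<alpha> \<beta> \<psi> "\<alpha> / 2"] \<psi> \<open>0 < \<alpha>\<close> by auto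
  also have "\<dots> = - (LBINT t. deriv \<psi> t * K t - K (\<alpha> / 2) * deriv \<psi> t)"
    by (simp only: K')
  also have "\<dots> = - (LBINT t. deriv \<psi> t * K t)"
    using int smooth_supp_integrable[OF \<psi>' compact_Icc] integral_smooth_supp_tail(2)[OF \<psi>] by simp
  finally show ?thesis .
qed

lemma set_integrable_continuous_pos:
  fixes f :: "real \<Rightarrow> real"
  shows "continuous_on {0<..} f \<Longrightarrow> 0 < \<alpha> \<Longrightarrow> set_integrable lborel {\<alpha>..\<beta>} f"
  by (rule borel_integrable_atLeastAtMost', rule continuous_on_subset) auto

lemma set_integrable_restrict_pos:
  fixes f :: "real \<Rightarrow> real"
  assumes "continuous_on {0<..} f" "0 < \<alpha>"
  shows "set_integrable lborel {\<alpha>..\<beta>} (\<lambda>r. if 0 < r then f r else 0)"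
  using set_integrable_continuous_pos[OF assms, of \<beta>] assms(2)
  by (subst set_integrable_cong[where f'=f]) auto

lemma borel_measurable_restrict_pos:
  fixes f :: "real \<Rightarrow> real"
  assumes "continuous_on {0<..} f"
  shows "(\<lambda>r. if 0 < r then f r else 0) \<in> borel_measurable borel"
proof -
  have "(\<lambda>r. indicator {0<..} r *\<^sub>R f r) \<in> borel_measurable borel"
    by (rule borel_measurable_continuous_on_indicator[OF _ assms]) auto
  also have "(\<lambda>r. indicator {0<..} r *\<^sub>R f r) = (\<lambda>r. if 0 < r then f r else 0)"
    by (auto split: split_indicator)
  finally show ?thesis .
qed

text \<open>The distributional form of \<open>(r\<^sup>m w')' = k\<close>: the test function \<open>\<psi>\<close> enters through \<open>\<eta> = r\<^sup>m \<psi>'\<close>, and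
  the constraint \<open>\<integral> \<eta> r\<^sup>-\<^sup>m = 0\<close> that this puts on \<open>\<eta>\<close> only costs a multiple of \<open>\<integral> r\<^sup>-\<^sup>m\<close>.\<close>

lemma weak_second_order_ode:
  assumes [measurable]: "w \<in> borel_measurable borel" "k \<in> borel_measurable borel"
    and w: "\<And>\<alpha> \<beta>. 0 < \<alpha> \<Longrightarrow> set_integrable lborel {\<alpha>..\<beta>} w"
    and k: "\<And>\<alpha> \<beta>. 0 < \<alpha> \<Longrightarrow> set_integrable lborel {\<alpha>..\<beta>} k"
    and eq: "\<And>\<alpha> \<beta> \<eta> \<psi>. 0 < \<alpha> \<Longrightarrow> smooth_supp {\<alpha>..\<beta>} \<eta> \<Longrightarrow> smooth_supp {\<alpha>..\<beta>} \<psi> \<Longrightarrow>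
      deriv \<psi> = (\<lambda>r. \<eta> r * r powr - m) \<Longrightarrow> (LBINT r. w r * deriv \<eta> r) = (LBINT r. k r * \<psi> r)"
  obtains K W where "primitive_of k K" "primitive_of (\<lambda>r. r powr - m * K r) W" "AE r in lborel. 0 < r \<longrightarrow> w r = W r"
proof -
  obtain K where K: "primitive_of k K" using primitive_exists[OF k] by blast
  define j where "j r = (if 0 < r then r powr - m * K r else 0)" for r
  define p where "p r = (if 0 < r then r powr - m else 0)" for r :: real
  have contj: "continuous_on {0<..} (\<lambda>r. r powr - m * K r)" and contp: "continuous_on {0<..} (\<lambda>r::real. r powr - m)"
    by (auto intro!: continuous_intros primitive_of_continuous[OF k K])
  have [measurable]: "j \<in> borel_measurable borel" "p \<in> borel_measurable borel"
    unfolding j_def p_def using contj contp by (auto intro!: borel_measurable_restrict_pos)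
  have j: "set_integrable lborel {\<alpha>..\<beta>} j" and p: "set_integrable lborel {\<alpha>..\<beta>} p" if "0 < \<alpha>" for \<alpha> \<beta>
    unfolding j_def p_def by (intro set_integrable_restrict_pos contj contp that)+
  obtain Z where Z: "primitive_of j Z" using primitive_exists[OF j] by blast
  obtain G where G: "primitive_of p G" using primitive_exists[OF p] by blast
  have contZ: "continuous_on {0<..} Z" and contG: "continuous_on {0<..} G"
    using primitive_of_continuous[OF j Z] primitive_of_continuous[OF p G] by blast+
  obtain \<eta>1 where \<eta>1: "smooth_supp {1..2::real} \<eta>1" "(LBINT t. \<eta>1 t) = 1"
    by (rule real_bump[of 1 2]) (simp, blast)
  \<comment> \<open>The weight r^m is chosen so that \<eta>0 violates the constraint \<integral>
    \<eta> r^(-m) = 0 by exactly 1; subtracting c \<eta>0 then repairs any \<eta>.\<close>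
  define \<eta>0 where "\<eta>0 r = \<eta>1 r * r powr m" for r
  have \<eta>0: "smooth_supp {1..2::real} \<eta>0" unfolding \<eta>0_def by (rule smooth_supp_mult_powr[OF \<eta>1(1)]) simp
  have int_p: "(LBINT r. p r * \<eta> r) = (LBINT r. \<eta> r * r powr - m)" if "smooth_supp {\<alpha>..\<beta>} \<eta>" "0 < \<alpha>" for \<eta> \<alpha> \<beta>
    using smooth_supp_zero[OF that(1)] that(2) by (intro Bochner_Integration.integral_cong) (auto simp: p_def)
  have \<eta>0_1: "(LBINT r. \<eta>0 r * r powr - m) = 1"
  proof -
    have "\<eta>0 r * r powr - m = \<eta>1 r" for r
    proof (cases "r \<in> {1..2}")
      case True
      then show ?thesis by (simp add: \<eta>0_def mult.assoc powr_add[symmetric])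
    next
      case False
      then show ?thesis using smooth_supp_zero[OF \<eta>1(1) False] by (simp add: \<eta>0_def)
    qed
    then show ?thesis using \<eta>1(2) by presburger
  qed
  \<comment> \<open>\<open>Z'\<close> and \<open>G'\<close> are not derivatives but the restrictions
    of Z and G to positive arguments, which makes them Borel on the whole line.\<close>
  define Z' where "Z' r = (if 0 < r then Z r else 0)" for r
  define G' where "G' r = (if 0 < r then G r else 0)" for r
  have [measurable]: "Z' \<in> borel_measurable borel" "G' \<in> borel_measurable borel"
    unfolding Z'_def G'_def using contZ contG by (auto intro!: borel_measurable_restrict_pos)
  have sZ: "set_integrable lborel {\<alpha>..\<beta>} Z'" and sG: "set_integrable lborel {\<alpha>..\<beta>} G'" if "0 < \<alpha>" for \<alpha> \<beta>
    unfolding Z'_def G'_def by (intro set_integrable_restrict_pos contZ contG that)+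
  \<comment> \<open>The Lagrange multiplier of the constraint: testing with \<eta> - c \<eta>0 shows
    that w - Z' applied to \<eta>' gives c \<mu>, and c equals minus G' applied to \<eta>'. Hence w
    - Z' + \<mu> G' annihilates all derivatives.\<close>
  define \<mu> where "\<mu> = (LBINT r. w r * deriv \<eta>0 r) - (LBINT r. Z' r * deriv \<eta>0 r)"
  have main: "(LBINT r. (w r - Z' r + \<mu> * G' r) * deriv \<eta> r) = 0"
    if \<alpha>: "0 < \<alpha>" and \<eta>: "smooth_supp {\<alpha>..\<beta>} \<eta>" for \<alpha> \<beta> \<eta>
  proof -
    define \<alpha>' \<beta>' where "\<alpha>' = min \<alpha> 1" and "\<beta>' = max \<beta> 2"
    have \<alpha>': "0 < \<alpha>'" using \<alpha> by (simp add: \<alpha>'_def)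
    have s: "smooth_supp {\<alpha>'..\<beta>'} \<eta>" "smooth_supp {\<alpha>'..\<beta>'} \<eta>0"
      by (rule smooth_supp_mono[OF \<eta>] smooth_supp_mono[OF \<eta>0]; auto simp: \<alpha>'_def \<beta>'_def)+
    note s' = smooth_supp_deriv[OF s(1) closed_atLeastAtMost] smooth_supp_deriv[OF s(2) closed_atLeastAtMost]
    define c where "c = (LBINT r. \<eta> r * r powr - m)"
    define \<eta>c where "\<eta>c r = \<eta> r - c * \<eta>0 r" for r
    have \<eta>c: "smooth_supp {\<alpha>'..\<beta>'} \<eta>c" unfolding \<eta>c_def by (rule smooth_supp_lincomb[OF s])
    note ip = smooth_supp_integrable[OF smooth_supp_mult_powr[OF s(1) \<alpha>'] compact_Icc, of "- m"]
      smooth_supp_integrable[OF smooth_supp_mult_powr[OF s(2) \<alpha>'] compact_Icc, of "- m"]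
    have "(LBINT r. \<eta>c r * r powr - m) = 0"
      using ip \<eta>0_1 by (simp add: \<eta>c_def left_diff_distrib mult.assoc c_def)
    then obtain \<psi> where \<psi>: "smooth_supp {\<alpha>'..\<beta>'} \<psi>" "deriv \<psi> = (\<lambda>r. \<eta>c r * r powr - m)"
      using smooth_supp_antideriv[OF smooth_supp_mult_powr[OF \<eta>c \<alpha>']] by blast
    have d\<eta>c: "deriv \<eta>c r = deriv \<eta> r - c * deriv \<eta>0 r" for r
      unfolding \<eta>c_def
      by (intro DERIV_imp_deriv DERIV_diff DERIV_cmult smooth_supp_has_deriv[OF s(1)] smooth_supp_has_deriv[OF s(2)])
    have restrict: "(LBINT t. deriv \<phi> t * Y t) = (LBINT t. (if 0 < t then Y t else 0) * deriv \<phi> t)"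
      if "smooth_supp {\<alpha>'..\<beta>'} \<phi>" for \<phi> Y
      using smooth_supp_zero[OF smooth_supp_deriv[OF that closed_atLeastAtMost]] \<alpha>'
      by (intro Bochner_Integration.integral_cong) auto
    have "(LBINT r. w r * deriv \<eta>c r) = (LBINT r. k r * \<psi> r)"
      by (rule eq[OF \<alpha>' \<eta>c \<psi>])
    also have "\<dots> = - (LBINT r. deriv \<psi> r * K r)"
      by (rule integral_by_parts_primitive[OF _ k K \<psi>(1) \<alpha>']) auto
    also have "(LBINT r. deriv \<psi> r * K r) = (LBINT r. j r * \<eta>c r)"
      using smooth_supp_zero[OF \<eta>c] \<alpha>'
      by (intro Bochner_Integration.integral_cong) (auto simp: j_def \<psi>(2))
    also have "\<dots> = - (LBINT r. Z' r * deriv \<eta>c r)"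
      using integral_by_parts_primitive[OF _ j Z \<eta>c \<alpha>'] restrict[OF \<eta>c, of Z] by (simp add: Z'_def)
    finally have 1: "(LBINT r. w r * deriv \<eta>c r) = (LBINT r. Z' r * deriv \<eta>c r)" by simp
    note i = integrable_mult_smooth_supp[OF w[OF \<alpha>'] s'(1) compact_Icc assms(1)]
      integrable_mult_smooth_supp[OF w[OF \<alpha>'] s'(2) compact_Icc assms(1)]
      integrable_mult_smooth_supp[OF sZ[OF \<alpha>'] s'(1) compact_Icc \<open>Z' \<in> _\<close>]
      integrable_mult_smooth_supp[OF sZ[OF \<alpha>'] s'(2) compact_Icc \<open>Z' \<in> _\<close>]
      integrable_mult_smooth_supp[OF sG[OF \<alpha>'] s'(1) compact_Icc \<open>G' \<in> _\<close>]
    have "(LBINT r. w r * deriv \<eta> r - c * (w r * deriv \<eta>0 r)) = (LBINT r. Z' r * deriv \<eta> r - c * (Z' r * deriv \<eta>0 r))"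
      using 1 by (simp add: d\<eta>c algebra_simps)
    then have 2: "(LBINT r. w r * deriv \<eta> r) - (LBINT r. Z' r * deriv \<eta> r) = c * \<mu>"
      using i by (simp add: \<mu>_def algebra_simps)
    have "c = (LBINT r. p r * \<eta> r)" unfolding c_def by (rule int_p[OF s(1) \<alpha>', symmetric])
    also have "\<dots> = - (LBINT r. G' r * deriv \<eta> r)"
      using integral_by_parts_primitive[OF _ p G s(1) \<alpha>'] restrict[OF s(1), of G] by (simp add: G'_def)
    finally have 3: "(LBINT r. G' r * deriv \<eta> r) = - c" by simp
    have "(LBINT r. (w r - Z' r + \<mu> * G' r) * deriv \<eta> r) =
        (LBINT r. w r * deriv \<eta> r - Z' r * deriv \<eta> r + \<mu> * (G' r * deriv \<eta> r))"
      by (simp add: algebra_simps)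
    also have "\<dots> = 0" using i 2 3 by simp
    finally show ?thesis .
  qed
  have "\<exists>c. AE t in lborel. 0 < t \<longrightarrow> w t - Z' t + \<mu> * G' t = c"
  proof (rule du_Bois_Reymond)
    show "set_integrable lborel {\<alpha>..\<beta>} (\<lambda>t. w t - Z' t + \<mu> * G' t)" if "0 < \<alpha>" for \<alpha> \<beta>
      by (intro set_integral_add set_integral_diff set_integrable_mult_right w sZ sG that)
  qed (use main in auto)
  then obtain c where c: "AE t in lborel. 0 < t \<longrightarrow> w t - Z' t + \<mu> * G' t = c" by blast
  show ?thesis
  proof
    \<comment> \<open>The multiplier is absorbed into the free constant of K, since c + Z - \<mu> G
      is a primitive of r^(-m) (K - \<mu>).\<close>
    show "primitive_of k (\<lambda>r. K r - \<mu>)" using K by (simp add: primitive_of_def)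
    show "primitive_of (\<lambda>r. r powr - m * (K r - \<mu>)) (\<lambda>r. c + Z r - \<mu> * G r)"
      unfolding primitive_of_def
    proof (intro allI impI)
      fix s t :: real assume st: "0 < s" "s \<le> t"
      have "integral {s..t} (\<lambda>r. r powr - m * (K r - \<mu>)) = integral {s..t} (\<lambda>r. j r - \<mu> * p r)"
        using st by (intro Henstock_Kurzweil_Integration.integral_cong) (auto simp: j_def p_def algebra_simps)
      also have "\<dots> = integral {s..t} j - \<mu> * integral {s..t} p"
        using set_borel_integral_eq_integral(1)[OF j[OF st(1)]] set_borel_integral_eq_integral(1)[OF p[OF st(1)]]
        by (subst Henstock_Kurzweil_Integration.integral_diff) (auto intro!: integrable_on_mult_right)
      also have "\<dots> = (Z t - Z s) - \<mu> * (G t - G s)"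
        using Z G st by (simp add: primitive_of_def)
      finally show "c + Z t - \<mu> * G t - (c + Z s - \<mu> * G s) = integral {s..t} (\<lambda>r. r powr - m * (K r - \<mu>))"
        by (simp add: algebra_simps)
    qed
    show "AE r in lborel. 0 < r \<longrightarrow> w r = c + Z r - \<mu> * G r"
      using c by eventually_elim (auto simp: Z'_def G'_def)
  qed
qed

section \<open>Weak gradients and polar coordinates\<close>

lemma locally_integrable_measurable:
  fixes g :: "'a::euclidean_space \<Rightarrow> 'b::euclidean_space"
  assumes "locally_integrable g"
  shows "g \<in> borel_measurable lebesgue"
proof (rule borel_measurable_LIMSEQ_metric)
  show "(\<lambda>x. indicator (cball 0 (real n)) x *\<^sub>R g x) \<in> borel_measurable lebesgue" for n
    using assms unfolding locally_integrable_def set_integrable_def by (auto intro: borel_measurable_integrable)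
  fix x :: 'a
  have "eventually (\<lambda>n. indicator (cball 0 (real n)) x *\<^sub>R g x = g x) sequentially"
    using eventually_ge_at_top[of "nat \<lceil>norm x\<rceil>"]
    by eventually_elim (auto simp: indicator_def nat_le_iff ceiling_le_iff)
  then show "(\<lambda>n. indicator (cball 0 (real n)) x *\<^sub>R g x) \<longlonglongrightarrow> g x"
    by (rule tendsto_eventually)
qed

lemma locally_integrable_continuous:
  fixes g :: "'a::euclidean_space \<Rightarrow> 'b::euclidean_space"
  assumes "continuous_on UNIV g"
  shows "locally_integrable g"
  unfolding locally_integrable_def set_integrable_def
proof (intro allI impI)
  fix K :: "'a set" assume "compact K"
  then have "integrable lborel (\<lambda>x. indicator K x *\<^sub>R g x)"
    using assms by (intro borel_integrable_compact) (auto intro: continuous_on_subset)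
  then show "integrable lebesgue (\<lambda>x. indicator K x *\<^sub>R g x)"
    by (subst integrable_completion) auto
qed

text \<open>The product v \<phi> has compact support, so its derivative in direction e integrates to
  0; the product rule splits that into the two sides of the defining identity.\<close>

lemma is_weak_grad_C1:
  fixes v :: "'a::euclidean_space \<Rightarrow> real"
  assumes D: "\<And>x. (v has_derivative (\<lambda>h. g x \<bullet> h)) (at x)" and g: "continuous_on UNIV g"
  shows "is_weak_grad v g"
  unfolding is_weak_grad_def
proof (intro conjI allI impI ballI)
  have v: "continuous_on UNIV v"
    using D by (meson continuous_at_imp_continuous_on has_derivative_continuous)
  show "locally_integrable v" "locally_integrable g"
    using v g by (auto intro: locally_integrable_continuous)
  fix \<phi> :: "'a \<Rightarrow> real" and e :: 'a assume \<phi>: "test_function \<phi>" and e: "e \<in> Basis"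
  obtain R where R: "R > 0" "smooth_supp (cball 0 R) \<phi>" using test_function_smooth_supp[OF \<phi>] .
  note C = smooth_supp_Ck[OF R(2), of "Suc 0"]
  note D\<phi> = Ck_Suc_D(1)[OF C] 
  have c: "continuous_on UNIV (\<lambda>x. frechet_derivative \<phi> (at x) e)" "continuous_on UNIV \<phi>"
    using Ck_Suc_D(2)[OF C e] smooth_supp_continuous[OF R(2)] by auto
  have z: "frechet_derivative \<phi> (at x) e = 0" if "x \<notin> cball 0 R" for x
    using has_derivative_outside_support[OF D\<phi> closed_cball smooth_supp_zero[OF R(2)] that] by simp
  have "(LBINT x. v x * frechet_derivative \<phi> (at x) e + (g x \<bullet> e) * \<phi> x) = 0"
    by (rule integral_directional_derivative_zero[where D="\<lambda>x h. v x * frechet_derivative \<phi> (at x) h + (g x \<bullet> h) * \<phi> x"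
          and F="\<lambda>x. v x * \<phi> x" and R=R])
      (use smooth_supp_zero[OF R(2)] in \<open>auto intro!: has_derivative_mult D D\<phi> continuous_intros c v g\<close>)
  moreover have "integrable lborel (\<lambda>x. v x * frechet_derivative \<phi> (at x) e)" "integrable lborel (\<lambda>x. (g x \<bullet> e) * \<phi> x)"
    by (rule integrable_lborel_compact_support[where K="cball 0 R"];
      use z smooth_supp_zero[OF R(2)] in \<open>auto intro!: continuous_intros c v g\<close>)+
  ultimately have "(LBINT x. v x * frechet_derivative \<phi> (at x) e) = - (LBINT x. (g x \<bullet> e) * \<phi> x)"
    by simp
  moreover have "(\<lambda>x. v x * frechet_derivative \<phi> (at x) e) \<in> borel_measurable lborel"
    "(\<lambda>x. (g x \<bullet> e) * \<phi> x) \<in> borel_measurable lborel"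
    by (simp; intro borel_measurable_continuous_onI continuous_intros c v g)+
  ultimately show "(LINT x|lebesgue. v x * frechet_derivative \<phi> (at x) e) = - (LINT x|lebesgue. (g x \<bullet> e) * \<phi> x)"
    by (simp add: integral_completion)
qed

lemma is_weak_grad_weak_grad: "weakly_differentiable u \<Longrightarrow> is_weak_grad u (weak_grad u)"
  using someI_ex[of "is_weak_grad u"] by (simp add: weakly_differentiable_def weak_grad_def)

text \<open>Subtracting the two integration-by-parts identities leaves the fundamental lemma, one
  component at a time. An open set U is allowed because the candidate gradient of a radial function
  is continuous only away from the origin; each component of g is first replaced by a Borel
  representative.\<close>

lemma is_weak_grad_AE_unique:
  fixes u :: "'a::euclidean_space \<Rightarrow> real"
  assumes u: "is_weak_grad u g" and "open U" and [measurable]: "G \<in> borel_measurable borel"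
    and G: "\<And>K e. compact K \<Longrightarrow> K \<subseteq> U \<Longrightarrow> e \<in> Basis \<Longrightarrow> set_integrable lborel K (\<lambda>x. G x \<bullet> e)"
    and eq: "\<And>K \<phi> e. compact K \<Longrightarrow> K \<subseteq> U \<Longrightarrow> smooth_supp K \<phi> \<Longrightarrow> e \<in> Basis \<Longrightarrow>
      (LINT x|lebesgue. u x * frechet_derivative \<phi> (at x) e) = - (LBINT x. (G x \<bullet> e) * \<phi> x)"
  shows "AE x in lebesgue. x \<in> U \<longrightarrow> g x = G x"
proof -
  have g: "locally_integrable g" using u by (simp add: is_weak_grad_def)
  have [measurable]: "g \<in> borel_measurable lebesgue" by (rule locally_integrable_measurable[OF g])
  have "AE x in lebesgue. x \<in> U \<longrightarrow> (g x - G x) \<bullet> e = 0" if e: "e \<in> Basis" for e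
  proof -
    have "(\<lambda>x. g x \<bullet> e) \<in> borel_measurable lebesgue" by measurable
    then obtain h where [measurable]: "h \<in> borel_measurable borel" and h: "AE x in lborel. g x \<bullet> e = h x"
      using completion_ex_borel_measurable_real[of "\<lambda>x. g x \<bullet> e" lborel] by auto
    have h': "AE x in lebesgue. g x \<bullet> e = h x" by (rule AE_completion[OF h])
    have [measurable]: "h \<in> borel_measurable lebesgue" "(\<lambda>x. G x \<bullet> e) \<in> borel_measurable lebesgue"
      by (auto intro: measurable_completion)
    have sh: "set_integrable lborel K h" if "compact K" for K
    proof -
      have [measurable]: "K \<in> sets borel" using that by (simp add: borel_compact)
      have "set_integrable lebesgue K g" using g that by (simp add: locally_integrable_def)
      then have "integrable lebesgue (\<lambda>x. (indicator K x *\<^sub>R g x) \<bullet> e)"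
        unfolding set_integrable_def by (rule integrable_inner_left)
      moreover have "AE x in lebesgue. (indicator K x *\<^sub>R g x) \<bullet> e = indicator K x *\<^sub>R h x"
        using h' by eventually_elim auto
      ultimately have "integrable lebesgue (\<lambda>x. indicator K x *\<^sub>R h x)"
        by (elim integrable_cong_AE_imp) (auto intro!: measurable_completion)
      then show ?thesis unfolding set_integrable_def by (subst (asm) integrable_completion) auto
    qed
    have "AE x in lborel. x \<in> U \<longrightarrow> h x - G x \<bullet> e = 0"
    proof (rule fundamental_lemma[OF \<open>open U\<close>])
      show "(\<lambda>x. h x - G x \<bullet> e) \<in> borel_measurable borel" by measurable
      fix K assume K: "compact K" "K \<subseteq> U"
      show "set_integrable lborel K (\<lambda>x. h x - G x \<bullet> e)"
        by (intro set_integral_diff sh G K e)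
      fix \<phi> assume \<phi>: "smooth_supp K \<phi>"
      note [measurable] = smooth_supp_borel[OF \<phi>]
      have "(LBINT x. (G x \<bullet> e) * \<phi> x) = - (LINT x|lebesgue. u x * frechet_derivative \<phi> (at x) e)"
        using eq[OF K \<phi> e] by simp
      also have "\<dots> = (LINT x|lebesgue. (g x \<bullet> e) * \<phi> x)"
        using u e smooth_supp_test_function[OF \<phi> K(1)] by (simp add: is_weak_grad_def)
      also have "\<dots> = (LINT x|lebesgue. h x * \<phi> x)"
      proof (rule integral_cong_AE)
        show "(\<lambda>x. h x * \<phi> x) \<in> borel_measurable lebesgue" by (rule measurable_completion) measurable
        have [measurable]: "\<phi> \<in> borel_measurable lebesgue" by (rule measurable_completion) measurable
        show "(\<lambda>x. (g x \<bullet> e) * \<phi> x) \<in> borel_measurable lebesgue" by measurable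
      qed (use h' in auto)
      also have "\<dots> = (LBINT x. h x * \<phi> x)" by (rule integral_completion) measurable
      finally have "(LBINT x. (G x \<bullet> e) * \<phi> x) = (LBINT x. h x * \<phi> x)" .
      then show "(LBINT x. (h x - G x \<bullet> e) * \<phi> x) = 0"
        using integrable_mult_smooth_supp[OF sh[OF K(1)] \<phi> K(1)] integrable_mult_smooth_supp[OF G[OF K e] \<phi> K(1)]
        by (simp add: left_diff_distrib)
    qed
    then have "AE x in lebesgue. x \<in> U \<longrightarrow> h x - G x \<bullet> e = 0" by (rule AE_completion)
    with h' show ?thesis by eventually_elim (auto simp: inner_diff_left)
  qed
  then have "AE x in lebesgue. \<forall>e\<in>Basis. x \<in> U \<longrightarrow> (g x - G x) \<bullet> e = 0"
    by (intro AE_finite_allI) auto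
  then show ?thesis
    by eventually_elim (auto simp: inner_diff_left intro: euclidean_eqI)
qed

section \<open>Polar coordinates and radial null sets\<close>

text \<open>The surface area of the unit sphere in dimension N.\<close>

definition sph :: "nat \<Rightarrow> real" where
  "sph N = real N * unit_ball_vol (real N)"

lemma sph_pos: "N > 0 \<Longrightarrow> sph N > 0"
  by (simp add: sph_def)

definition radial_density :: "nat \<Rightarrow> real \<Rightarrow> real" where
  "radial_density N r = indicator {0<..} r * (sph N * r powr (real N - 1))"

lemma radial_density_nonneg: "radial_density N r \<ge> 0"
  by (simp add: radial_density_def sph_def)

lemma radial_density_borel [measurable]: "radial_density N \<in> borel_measurable borel"
  unfolding radial_density_def by measurable

text \<open>Both measures are compared on the half-lines up to r: the left side is the volume of a
  ball of radius r, the right side the integral of its derivative. All polar coordinate formulas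
  below are the change of variables along \<open>norm\<close>.\<close>

lemma distr_norm_lborel:
  "distr (lborel :: 'a::euclidean_space measure) borel norm =
    density lborel (\<lambda>r. ennreal (radial_density DIM('a) r))" (is "?P = ?Q")
proof (rule measure_eqI_generator_eq[where E="range atMost" and \<Omega>=UNIV and A="\<lambda>n::nat. {..real n}"])
  let ?N = "DIM('a)"
  show "Int_stable (range (atMost :: real \<Rightarrow> _))"
    by (auto simp: Int_stable_def)
  have P: "emeasure ?P {..r} = ennreal (unit_ball_vol (real ?N) * r ^ ?N)" if "r \<ge> 0" for r
  proof -
    have "emeasure ?P {..r} = emeasure lborel (cball (0::'a) r)"
      by (subst emeasure_distr) (auto intro!: arg_cong[where f="emeasure lborel"])
    then show ?thesis using that by (simp add: emeasure_cball)
  qed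
  show "emeasure ?P X = emeasure ?Q X" if "X \<in> range atMost" for X
  proof -
    obtain r where X: "X = {..r}" using \<open>X \<in> range atMost\<close> by auto
    show ?thesis
    proof (cases "r \<ge> 0")
      case True
      have "emeasure ?Q {..r} = (\<integral>\<^sup>+t. ennreal (radial_density ?N t) * indicator {..r} t \<partial>lborel)"
        by (subst emeasure_density) auto
      also have "\<dots> = (\<integral>\<^sup>+t. ennreal (sph ?N * t ^ (?N - 1)) * indicator {0..r} t \<partial>lborel)"
      proof (rule nn_integral_cong_AE)
        show "AE t in lborel. ennreal (radial_density ?N t) * indicator {..r} t =
            ennreal (sph ?N * t ^ (?N - 1)) * indicator {0..r} t"
          using AE_lborel_singleton[of "0::real"]
        proof eventually_elim
          case (elim t)
          have "t powr (real ?N - 1) = t ^ (?N - 1)" if "t > 0"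
            using that DIM_positive[where 'a='a] by (simp add: powr_realpow[symmetric] of_nat_diff)
          with elim show ?case by (auto simp: radial_density_def split: split_indicator)
        qed
      qed
      also have "\<dots> = ennreal (unit_ball_vol (real ?N) * r ^ ?N - unit_ball_vol (real ?N) * 0 ^ ?N)"
        by (rule nn_integral_FTC_Icc)
          (use True in \<open>auto intro!: derivative_eq_intros mult_nonneg_nonneg simp: sph_def\<close>)
      finally show ?thesis using P[OF True] X zero_power[OF DIM_positive[where 'a='a], where 'a=real] by simp
    next
      case False
      have "norm -` {..r} = ({} :: 'a set)"
        using False by (auto dest: order_trans[OF norm_ge_zero])
      then have "emeasure ?P {..r} = 0" by (simp add: emeasure_distr)
      moreover have "ennreal (radial_density ?N t) * indicator {..r} t = 0" for t
        using False by (auto simp: radial_density_def split: split_indicator)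
      then have "emeasure ?Q {..r} = 0" by (subst emeasure_density) (simp_all only: nn_integral_0_iff_AE, simp_all)
      ultimately show ?thesis using X by simp
    qed
  qed
  show "sets ?P = sigma_sets UNIV (range atMost)" "sets ?Q = sigma_sets UNIV (range atMost)"
    by (simp_all add: borel_eq_atMost)
  show "(\<Union>n::nat. {..real n}) = UNIV"
    using real_arch_simple by auto
  show "emeasure ?P {..real n} \<noteq> \<infinity>" for n using P[of "real n"] by simp
qed auto

lemma integral_radial:
  fixes F :: "real \<Rightarrow> real"
  assumes [measurable]: "F \<in> borel_measurable borel"
  shows "(LBINT x. F (norm (x::'a::euclidean_space))) = (LBINT r. radial_density DIM('a) r * F r)"
    and "integrable lborel (\<lambda>x::'a. F (norm x)) \<longleftrightarrow> integrable lborel (\<lambda>r. radial_density DIM('a) r * F r)"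
proof -
  have "(LBINT x. F (norm (x::'a))) = integral\<^sup>L (distr (lborel::'a measure) borel norm) F"
    by (subst integral_distr) auto
  then show "(LBINT x. F (norm (x::'a))) = (LBINT r. radial_density DIM('a) r * F r)"
    unfolding distr_norm_lborel by (subst (asm) integral_density) (auto simp: radial_density_nonneg)
  have "integrable lborel (\<lambda>x::'a. F (norm x)) \<longleftrightarrow> integrable (distr (lborel::'a measure) borel norm) F"
    by (subst integrable_distr_eq) auto
  then show "integrable lborel (\<lambda>x::'a. F (norm x)) \<longleftrightarrow> integrable lborel (\<lambda>r. radial_density DIM('a) r * F r)"
    unfolding distr_norm_lborel by (subst (asm) integrable_density) (auto simp: radial_density_nonneg)
qed

text \<open>The density of the distribution of the norm is strictly positive on the positive axis,
  so null sets transfer in both directions.\<close>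

lemma AE_radial_iff:
  fixes B :: "real set"
  assumes [measurable]: "B \<in> sets borel"
  shows "(AE x in lborel. norm (x::'a::euclidean_space) \<notin> B) \<longleftrightarrow> (AE r in lborel. 0 < r \<longrightarrow> r \<notin> B)"
proof -
  have "(AE x in lborel. norm (x::'a) \<notin> B) \<longleftrightarrow> (AE r in distr (lborel::'a measure) borel norm. r \<notin> B)"
    by (subst AE_distr_iff) auto
  also have "\<dots> \<longleftrightarrow> (AE r in lborel. 0 < r \<longrightarrow> r \<notin> B)"
    unfolding distr_norm_lborel
    by (subst AE_density) (auto simp: radial_density_def sph_pos intro!: arg_cong2[where f=eventually] split: split_indicator)
  finally show ?thesis .
qed

lemma AE_radial:
  assumes "AE r in lborel. 0 < r \<longrightarrow> P r"
  shows "AE x in lborel. P (norm (x::'a::euclidean_space)) \<or> x = 0"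
proof -
  obtain M where M: "M \<in> null_sets lborel" "{r. \<not> (0 < r \<longrightarrow> P r)} \<subseteq> M"
    using assms by (auto simp: eventually_ae_filter)
  have "AE r in lborel. 0 < r \<longrightarrow> r \<notin> M" using AE_not_in[OF M(1)] by eventually_elim auto
  then have "AE x in lborel. norm (x::'a) \<notin> M"
    using M(1) by (subst AE_radial_iff) auto
  moreover have "P r" if "0 < r" "r \<notin> M" for r using M(2) that by auto
  ultimately show ?thesis by (auto elim!: eventually_mono)
qed

text \<open>A Lebesgue measurable radial set has a Lebesgue measurable profile: the radial hull of a compact
  subset is again compact and stays inside the set, so the set is squeezed between radial Borel sets.\<close>

lemma radial_profile_measurable:
  fixes A :: "real set"
  assumes A: "{x::'a::euclidean_space. norm x \<in> A} \<in> sets lebesgue"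
  shows "A \<inter> {0<..} \<in> sets lebesgue"
proof -
  have hull: "\<exists>A1 T. A1 \<subseteq> A \<and> A1 \<in> sets borel \<and> T \<in> null_sets lebesgue \<and> {x::'a. norm x \<in> A - A1} \<subseteq> T"
    if "{x::'a. norm x \<in> A} \<in> sets lebesgue" for A :: "real set"
  proof -
    obtain C T where C: "fsigma C" "T \<in> null_sets lebesgue" "C \<union> T = {x::'a. norm x \<in> A}"
      using lebesgue_set_almost_fsigma[OF \<open>{x::'a. norm x \<in> A} \<in> _\<close>] by metis
    obtain F :: "nat \<Rightarrow> 'a set" where F: "range F \<subseteq> Collect compact" "C = \<Union>(F ` UNIV)"
      using C(1) by (auto simp: fsigma_Union_compact)
    have "compact (norm ` F n)" for n
      using F(1) by (intro compact_continuous_image continuous_intros) auto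
    then have "(\<Union>n. norm ` F n) \<in> sets borel"
      by (intro sets.countable_UN) (auto intro: borel_compact)
    moreover have "(\<Union>n. norm ` F n) \<subseteq> A" using F(2) C(3) by auto
    moreover have "{x::'a. norm x \<in> A - (\<Union>n. norm ` F n)} \<subseteq> T" using F(2) C(3) by auto
    ultimately show ?thesis using C(2) by blast
  qed
  have A': "{x::'a. norm x \<in> - A} \<in> sets lebesgue"
  proof -
    have "{x::'a. norm x \<in> - A} = space lebesgue - {x. norm x \<in> A}" by auto
    then show ?thesis using A by (metis sets.compl_sets)
  qed
  obtain A1 T1 where 1: "A1 \<subseteq> A" "A1 \<in> sets borel" "T1 \<in> null_sets lebesgue" "{x::'a. norm x \<in> A - A1} \<subseteq> T1"
    using hull[OF A] by blast
  obtain A2 T2 where 2: "A2 \<subseteq> - A" "A2 \<in> sets borel" "T2 \<in> null_sets lebesgue" "{x::'a. norm x \<in> - A - A2} \<subseteq> T2"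
    using hull[OF A'] by blast
  \<comment> \<open>The radii decided by neither inner Borel approximation; the points with such
    norms lie in the union of the two null sets, so B is null among positive radii.\<close>
  define B where "B = - (A1 \<union> A2)"
  have B[measurable]: "B \<in> sets borel" using 1 2 by (auto simp: B_def)
  have "AE x in lebesgue. norm (x::'a) \<notin> B"
    using AE_not_in[OF 1(3)] AE_not_in[OF 2(3)]
    by eventually_elim (use 1(4) 2(4) in \<open>auto simp: B_def\<close>)
  then have "AE x in lborel. norm (x::'a) \<notin> B" by (simp add: AE_completion_iff)
  then have "AE r in lborel. 0 < r \<longrightarrow> r \<notin> B" using AE_radial_iff[OF B] by blast
  then have "AE r in lborel. r \<notin> B \<inter> {0<..}" by eventually_elim auto
  then have null: "B \<inter> {0<..} \<in> null_sets lborel" using B by (subst (asm) AE_iff_null_sets[symmetric]) auto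
  have "(A - A1) \<inter> {0<..} \<in> null_sets lebesgue"
    by (rule null_sets_completion_subset[OF _ null_sets_completionI[OF null]]) (use 2(1) in \<open>auto simp: B_def\<close>)
  moreover have "A1 \<inter> {0<..} \<in> sets lebesgue" using 1(2) by auto
  moreover have "A \<inter> {0<..} = A1 \<inter> {0<..} \<union> (A - A1) \<inter> {0<..}" using 1(1) by auto
  ultimately show ?thesis by (auto simp: null_sets_def)
qed

text \<open>\<open>radially_symmetric\<close> supplies an arbitrary, possibly non-measurable
  profile. Its superlevel sets on the positive axis are Lebesgue measurable because those of u are,
  so it has a Borel version.\<close>

lemma radially_symmetric_borel_profile:
  fixes u :: "'a::euclidean_space \<Rightarrow> real"
  assumes u: "u \<in> borel_measurable lebesgue" and "radially_symmetric u"
  obtains w where "w \<in> borel_measurable borel" "AE x in lebesgue. u x = w (norm x)"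
proof -
  obtain w where w: "AE x in lebesgue. u x = w (norm x)"
    using assms(2) by (auto simp: radially_symmetric_def)
  have m: "(\<lambda>x::'a. w (norm x)) \<in> borel_measurable lebesgue" by (rule borel_measurable_AE[OF u w])
  define w0 where "w0 t = (if t > 0 then w t else 0)" for t
  have "w0 \<in> borel_measurable lebesgue"
    unfolding borel_measurable_iff_greater
  proof
    fix c
    have "{x::'a. norm x \<in> {t. c < w t}} = {x \<in> space lebesgue. c < w (norm x)}" by auto
    also have "\<dots> \<in> sets lebesgue" using m unfolding borel_measurable_iff_greater by blast
    finally have "{t. c < w t} \<inter> {0<..} \<in> sets lebesgue" by (rule radial_profile_measurable)
    moreover have "{t \<in> space lebesgue. c < w0 t} = {t. c < w t} \<inter> {0<..} \<union> (if c < 0 then {..0} else {})"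
      by (auto simp: w0_def split: if_splits)
    ultimately show "{t \<in> space lebesgue. c < w0 t} \<in> sets lebesgue" by auto
  qed
  then obtain w' where w': "w' \<in> borel_measurable borel" "AE t in lborel. w0 t = w' t"
    using completion_ex_borel_measurable_real[of w0 lborel] by auto
  have "AE x in lborel. w (norm (x::'a)) = w' (norm x) \<or> x = 0"
    by (rule AE_radial) (use w'(2) in \<open>auto simp: w0_def elim!: eventually_mono\<close>)
  then have "AE x in lebesgue. w (norm (x::'a)) = w' (norm x) \<or> x = 0" by (rule AE_completion)
  moreover have "AE x in lebesgue. x \<noteq> (0::'a)" by (rule AE_completion[OF AE_lborel_singleton])
  ultimately have "AE x in lebesgue. u x = w' (norm x)"
    using w by eventually_elim auto
  with w'(1) that show ?thesis by blast
qed

section \<open>Radial test functions and the potential\<close>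

lemma h_mass_nonneg: "h_mass p u \<rho> \<ge> 0"
  unfolding h_mass_def set_lebesgue_integral_def by (intro Bochner_Integration.integral_nonneg) auto

lemma h_mass_nonpos: "\<rho> \<le> 0 \<Longrightarrow> h_mass p u \<rho> = 0"
  by (simp add: h_mass_def set_lebesgue_integral_def ball_empty)

lemma h_mass_mono:
  fixes u :: "'a::euclidean_space \<Rightarrow> real"
  assumes "\<forall>\<rho>>0. set_integrable lebesgue (ball 0 \<rho>) (\<lambda>y. \<bar>u y\<bar> powr p)"
  shows "mono (h_mass p u)"
proof
  fix s t :: real assume "s \<le> t"
  show "h_mass p u s \<le> h_mass p u t"
  proof (cases "s \<le> 0")
    case True
    then show ?thesis using h_mass_nonneg[of p u t] by (simp add: h_mass_nonpos)
  next
    case False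
    show ?thesis unfolding h_mass_def set_lebesgue_integral_def
    proof (rule integral_mono)
      show "integrable lebesgue (\<lambda>x. indicator (ball 0 s) x *\<^sub>R \<bar>u x\<bar> powr p)"
        "integrable lebesgue (\<lambda>x. indicator (ball 0 t) x *\<^sub>R \<bar>u x\<bar> powr p)"
        using assms False \<open>s \<le> t\<close> unfolding set_integrable_def by auto
    qed (use \<open>s \<le> t\<close> in \<open>auto split: split_indicator\<close>)
  qed
qed

lemma h_mass_borel:
  fixes u :: "'a::euclidean_space \<Rightarrow> real"
  assumes "\<forall>\<rho>>0. set_integrable lebesgue (ball 0 \<rho>) (\<lambda>y. \<bar>u y\<bar> powr p)"
  shows "h_mass p u \<in> borel_measurable borel"
  using h_mass_mono[OF assms] by (rule borel_measurable_mono)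

lemma integrable_powr_tail:
  fixes \<alpha> b :: real
  assumes "0 < \<alpha>" "1 < b"
  shows "integrable lborel (\<lambda>\<rho>. indicator {\<alpha>..} \<rho> * \<rho> powr (- b))"
    and "(LBINT \<rho>. indicator {\<alpha>..} \<rho> * \<rho> powr (- b)) = \<alpha> powr (1 - b) / (b - 1)"
proof -
  have h: "((\<lambda>x. x powr (- b)) has_integral (- (\<alpha> powr (- b + 1)) / (- b + 1))) {\<alpha>..}"
    using has_integral_powr_to_inf[of "- b" \<alpha>] assms by simp
  then have "(\<lambda>x. x powr (- b)) absolutely_integrable_on {\<alpha>..}"
    by (intro nonnegative_absolutely_integrable_1) auto
  then have "integrable lebesgue (\<lambda>\<rho>. indicator {\<alpha>..} \<rho> * \<rho> powr (- b))"
    by (simp add: set_integrable_def)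
  then show i: "integrable lborel (\<lambda>\<rho>. indicator {\<alpha>..} \<rho> * \<rho> powr (- b))"
    by (subst (asm) integrable_completion) auto
  have "set_integrable lborel {\<alpha>..} (\<lambda>\<rho>. \<rho> powr (- b))"
    using i by (simp add: set_integrable_def)
  from set_borel_integral_eq_integral(2)[OF this]
  have "(LBINT \<rho>. indicator {\<alpha>..} \<rho> * \<rho> powr (- b)) = - (\<alpha> powr (- b + 1)) / (- b + 1)"
    using integral_unique[OF h] by (simp add: set_lebesgue_integral_def)
  also have "\<dots> = \<alpha> powr (1 - b) / (b - 1)"
    using assms by (simp add: field_simps)
  finally show "(LBINT \<rho>. indicator {\<alpha>..} \<rho> * \<rho> powr (- b)) = \<alpha> powr (1 - b) / (b - 1)" .
qed

lemma annulus_compact: "compact (cball 0 \<beta> - ball (0::'a::euclidean_space) \<alpha>)"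
  by (intro compact_diff) auto

lemma Ck_radial_mult_powr:
  assumes "smooth_supp {\<alpha>..\<beta>} \<theta>" "0 < \<alpha>"
  shows "Ck k (\<lambda>x::'a::euclidean_space. \<theta> (norm x) * norm x powr s)"
proof -
  note s = smooth_supp_mult_powr[OF assms, of s]
  show ?thesis
    by (rule Ck_radial[OF smooth_supp_Ck[OF s] assms(2)]) (use smooth_supp_zero[OF s] in auto)
qed

lemma radial_test_derivative:
  fixes x :: "'a::euclidean_space"
  assumes \<psi>: "smooth_supp {\<alpha>..\<beta>} \<psi>" and "0 < \<alpha>"
  shows "((\<lambda>x. \<psi> (norm x)) has_derivative (\<lambda>h. ((deriv \<psi> (norm x) * norm x powr (- 1)) *\<^sub>R x) \<bullet> h)) (at x)"
    and "continuous_on UNIV (\<lambda>x::'a. (deriv \<psi> (norm x) * norm x powr (- 1)) *\<^sub>R x)"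
proof -
  have D: "((\<lambda>x. \<psi> (norm x)) has_derivative (\<lambda>h. deriv \<psi> (norm x) * (x \<bullet> h) / norm x)) (at x)"
    by (rule has_derivative_radial_vanishing[OF smooth_supp_has_deriv[OF \<psi>] \<open>0 < \<alpha>\<close>])
      (use smooth_supp_zero[OF \<psi>] in auto)
  have eq: "deriv \<psi> (norm x) * (x \<bullet> h) / norm x = ((deriv \<psi> (norm x) * norm x powr (- 1)) *\<^sub>R x) \<bullet> h" for h
    by (simp add: powr_minus_divide)
  show "((\<lambda>x. \<psi> (norm x)) has_derivative (\<lambda>h. ((deriv \<psi> (norm x) * norm x powr (- 1)) *\<^sub>R x) \<bullet> h)) (at x)"
    using D unfolding eq .
  show "continuous_on UNIV (\<lambda>x::'a. (deriv \<psi> (norm x) * norm x powr (- 1)) *\<^sub>R x)"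
    by (intro continuous_intros Ck_imp_continuous[OF Ck_radial_mult_powr[OF smooth_supp_deriv[OF \<psi> closed_atLeastAtMost] \<open>0 < \<alpha>\<close>]])
qed

text \<open>\<open>weak_grad\<close> is a choice among weak gradients, so the explicit gradient can
  be identified with it only almost everywhere, through uniqueness.\<close>

lemma radial_test_weak_grad:
  assumes \<psi>: "smooth_supp {\<alpha>..\<beta>} \<psi>" and "0 < \<alpha>"
  shows "is_weak_grad (\<lambda>x::'a::euclidean_space. \<psi> (norm x)) (\<lambda>x. (deriv \<psi> (norm x) * norm x powr (- 1)) *\<^sub>R x)"
    and "AE x in lebesgue. weak_grad (\<lambda>x::'a. \<psi> (norm x)) x = (deriv \<psi> (norm x) * norm x powr (- 1)) *\<^sub>R x"
proof -
  let ?G = "\<lambda>x::'a. (deriv \<psi> (norm x) * norm x powr (- 1)) *\<^sub>R x" and ?v = "\<lambda>x::'a. \<psi> (norm x)"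
  note D = radial_test_derivative[OF assms]
  show G: "is_weak_grad ?v ?G" by (rule is_weak_grad_C1[OF D])
  have [measurable]: "?G \<in> borel_measurable borel" by (rule borel_measurable_continuous_onI[OF D(2)])
  have "is_weak_grad ?v (weak_grad ?v)"
    using G by (intro is_weak_grad_weak_grad) (auto simp: weakly_differentiable_def)
  then have "AE x in lebesgue. x \<in> UNIV \<longrightarrow> weak_grad ?v x = ?G x"
  proof (rule is_weak_grad_AE_unique[OF _ open_UNIV])
    fix K :: "'a set" and e :: 'a assume K: "compact K" and e: "e \<in> Basis"
    show "set_integrable lborel K (\<lambda>x. ?G x \<bullet> e)"
      unfolding set_integrable_def
      by (intro borel_integrable_compact K continuous_on_inner continuous_on_const continuous_on_subset[OF D(2)]) auto
    fix \<phi> assume \<phi>: "smooth_supp K \<phi>"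
    note [measurable] = smooth_supp_borel[OF \<phi>]
    have "(LINT x|lebesgue. ?v x * frechet_derivative \<phi> (at x) e) = - (LINT x|lebesgue. (?G x \<bullet> e) * \<phi> x)"
      using G e smooth_supp_test_function[OF \<phi> K] unfolding is_weak_grad_def by blast
    moreover have "(\<lambda>x. (?G x \<bullet> e) * \<phi> x) \<in> borel_measurable lborel" by measurable
    ultimately show "(LINT x|lebesgue. ?v x * frechet_derivative \<phi> (at x) e) = - (LBINT x. (?G x \<bullet> e) * \<phi> x)"
      by (simp only: integral_completion)
  qed measurable
  then show "AE x in lebesgue. weak_grad ?v x = ?G x" by simp
qed

text \<open>For the Coulomb term: the mass of such a function vanishes for radii below \<alpha> and
  never exceeds its value at \<beta> + 1, so the integrand is dominated by a multiple of \<rho>^(-b)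
  on [\<alpha>, \<infinity>), where b > 1.\<close>

lemma radial_test_E_rad:
  assumes \<psi>: "smooth_supp {\<alpha>..\<beta>} \<psi>" and "0 < \<alpha>" "1 < p" "1 \<le> q" "1 < b"
  shows "(\<lambda>x::'a::euclidean_space. \<psi> (norm x)) \<in> E_rad p q b"
proof -
  let ?G = "\<lambda>x::'a. (deriv \<psi> (norm x) * norm x powr (- 1)) *\<^sub>R x" and ?v = "\<lambda>x::'a. \<psi> (norm x)"
  note D = radial_test_derivative[OF \<psi> \<open>0 < \<alpha>\<close>] and wg = radial_test_weak_grad[OF \<psi> \<open>0 < \<alpha>\<close>, where 'a='a]
  have wd: "weakly_differentiable ?v" using wg(1) by (auto simp: weakly_differentiable_def)
  have z: "?G x = 0" if "x \<notin> cball 0 \<beta>" for x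
    using smooth_supp_zero[OF smooth_supp_deriv[OF \<psi> closed_atLeastAtMost], of "norm x"] that by auto
  have [measurable]: "weak_grad ?v \<in> borel_measurable lebesgue"
    using is_weak_grad_weak_grad[OF wd] by (intro locally_integrable_measurable) (simp add: is_weak_grad_def)
  have "integrable lborel (\<lambda>x. (norm (?G x))\<^sup>2)"
  proof (rule integrable_lborel_compact_support[OF _ compact_cball[of 0 \<beta>]])
    show "continuous_on UNIV (\<lambda>x. (norm (?G x))\<^sup>2)" by (intro continuous_on_power continuous_on_norm D(2))
    show "(norm (?G x))\<^sup>2 = 0" if "x \<notin> cball 0 \<beta>" for x using z[OF that] by (simp only:) simp
  qed
  then have "integrable lebesgue (\<lambda>x. (norm (?G x))\<^sup>2)"
    using borel_measurable_continuous_onI[OF D(2)] by (subst integrable_completion) auto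
  moreover have "AE x in lebesgue. (norm (weak_grad ?v x))\<^sup>2 = (norm (?G x))\<^sup>2"
    using wg(2) by eventually_elim (simp only:)
  ultimately have 1: "integrable lebesgue (\<lambda>x. (norm (weak_grad ?v x))\<^sup>2)"
    by (subst integrable_cong_AE) (auto intro!: borel_measurable_integrable)
  have cont: "continuous_on UNIV (\<lambda>x::'a. \<bar>\<psi> (norm x)\<bar> powr p)"
    using continuous_on_compose2[OF smooth_supp_continuous[OF \<psi>, of UNIV], of UNIV "norm :: 'a \<Rightarrow> real"] \<open>1 < p\<close>
    by (intro continuous_on_powr' continuous_intros) (auto intro: continuous_intros)
  have 2: "\<forall>\<rho>>0. set_integrable lebesgue (ball 0 \<rho>) (\<lambda>y::'a. \<bar>\<psi> (norm y)\<bar> powr p)"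
  proof (intro allI impI)
    fix \<rho> :: real
    have "set_integrable lebesgue (cball 0 \<rho>) (\<lambda>y::'a. \<bar>\<psi> (norm y)\<bar> powr p)"
      using locally_integrable_continuous[OF cont] by (simp add: locally_integrable_def)
    then show "set_integrable lebesgue (ball 0 \<rho>) (\<lambda>y::'a. \<bar>\<psi> (norm y)\<bar> powr p)"
      by (rule set_integrable_subset) auto
  qed
  let ?h = "h_mass p ?v"
  have [measurable]: "?h \<in> borel_measurable borel" by (rule h_mass_borel[OF 2])
  have h0: "?h \<rho> = 0" if "\<rho> < \<alpha>" for \<rho>
  proof -
    have "indicator (ball 0 \<rho>) y *\<^sub>R \<bar>\<psi> (norm y)\<bar> powr p = 0" for y :: 'a
      using smooth_supp_zero[OF \<psi>, of "norm y"] that by (auto split: split_indicator)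
    then show ?thesis by (simp only: h_mass_def set_lebesgue_integral_def) simp
  qed
  have hH: "?h \<rho> \<le> ?h (\<beta> + 1)" for \<rho>
  proof (cases "\<rho> \<le> \<beta> + 1")
    case False
    have "indicator (ball 0 \<rho>) y *\<^sub>R \<bar>\<psi> (norm y)\<bar> powr p = indicator (ball 0 (\<beta> + 1)) y *\<^sub>R \<bar>\<psi> (norm y)\<bar> powr p" for y :: 'a
      using smooth_supp_zero[OF \<psi>, of "norm y"] False by (auto split: split_indicator)
    then show ?thesis by (simp only: h_mass_def set_lebesgue_integral_def)
  qed (use h_mass_mono[OF 2] in \<open>auto simp: mono_def\<close>)
  have "integrable lborel (\<lambda>\<rho>. indicator {0<..} \<rho> * (\<rho> powr - b * ?h \<rho> powr q))"
  proof (rule Bochner_Integration.integrable_bound)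
    show "integrable lborel (\<lambda>\<rho>. ?h (\<beta> + 1) powr q * (indicator {\<alpha>..} \<rho> * \<rho> powr - b))"
      by (intro integrable_mult_right integrable_powr_tail) (use assms in auto)
    show "AE \<rho> in lborel. norm (indicator {0<..} \<rho> * (\<rho> powr - b * ?h \<rho> powr q))
        \<le> norm (?h (\<beta> + 1) powr q * (indicator {\<alpha>..} \<rho> * \<rho> powr - b))"
    proof (rule AE_I2)
      fix \<rho>
      show "norm (indicator {0<..} \<rho> * (\<rho> powr - b * ?h \<rho> powr q))
          \<le> norm (?h (\<beta> + 1) powr q * (indicator {\<alpha>..} \<rho> * \<rho> powr - b))"
        using h0[of \<rho>] powr_mono2[OF _ h_mass_nonneg hH, of q \<rho>] \<open>1 \<le> q\<close>
        by (cases "\<rho> < \<alpha>") (auto simp: abs_mult mult.commute split: split_indicator intro!: mult_left_mono)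
    qed
  qed measurable
  then have 3: "set_integrable lebesgue {0<..} (\<lambda>\<rho>. \<rho> powr - b * ?h \<rho> powr q)"
    unfolding set_integrable_def by (subst integrable_completion) auto
  show ?thesis
    unfolding E_rad_def E_space_def radially_symmetric_def using wd 1 2 3 by auto
qed

text \<open>Since h^(q-1) \<le> 1 + h^q, the integrand is dominated by \<rho>^(-b), integrable away
  from 0, plus the Coulomb integrand.\<close>

lemma E_space_Phi_integrable:
  fixes u :: "'a::euclidean_space \<Rightarrow> real"
  assumes "u \<in> E_space p q b" "1 \<le> q" "1 < b" "0 < r"
  shows "set_integrable lborel {r<..} (\<lambda>\<rho>. \<rho> powr (- b) * pow0 (h_mass p u \<rho>) (q - 1))"
proof -
  have loc: "\<forall>\<rho>>0. set_integrable lebesgue (ball 0 \<rho>) (\<lambda>y. \<bar>u y\<bar> powr p)"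
    and c: "set_integrable lebesgue {0<..} (\<lambda>\<rho>. \<rho> powr (- b) * h_mass p u \<rho> powr q)"
    using assms(1) by (auto simp: E_space_def)
  note [measurable] = h_mass_borel[OF loc]
  have c: "integrable lborel (\<lambda>\<rho>. indicator {0<..} \<rho> * (\<rho> powr (- b) * h_mass p u \<rho> powr q))"
    using c unfolding set_integrable_def by (subst (asm) integrable_completion) auto
  show ?thesis unfolding set_integrable_def
  proof (rule Bochner_Integration.integrable_bound)
    show "integrable lborel (\<lambda>\<rho>. indicator {r..} \<rho> * \<rho> powr (- b) + indicator {0<..} \<rho> * (\<rho> powr (- b) * h_mass p u \<rho> powr q))"
      by (intro Bochner_Integration.integrable_add c integrable_powr_tail assms)
    show "AE \<rho> in lborel. norm (indicator {r<..} \<rho> *\<^sub>R (\<rho> powr - b * pow0 (h_mass p u \<rho>) (q - 1)))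
        \<le> norm (indicator {r..} \<rho> * \<rho> powr - b + indicator {0<..} \<rho> * (\<rho> powr - b * h_mass p u \<rho> powr q))"
    proof (rule AE_I2)
      fix \<rho>
      have "pow0 (h_mass p u \<rho>) (q - 1) \<le> 1 + h_mass p u \<rho> powr q" and n: "pow0 (h_mass p u \<rho>) (q - 1) \<ge> 0"
      proof -
        let ?h = "h_mass p u \<rho>"
        consider "q = 1" | "q \<noteq> 1" "?h \<le> 1" | "q \<noteq> 1" "?h > 1" by linarith
        then show "pow0 ?h (q - 1) \<le> 1 + ?h powr q"
        proof cases
          case 2
          have "?h powr (q - 1) \<le> 1 powr (q - 1)"
            using 2 assms(2) h_mass_nonneg by (intro powr_mono2) auto
          then show ?thesis using 2 by (simp add: pow0_def add_increasing2)
        next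
          case 3
          have "?h powr (q - 1) \<le> ?h powr q" using 3 by (intro powr_mono) auto
          moreover have "pow0 ?h (q - 1) = ?h powr (q - 1)" using 3 by (simp add: pow0_def)
          ultimately show ?thesis by linarith
        qed (auto simp: pow0_def)
        show "pow0 ?h (q - 1) \<ge> 0" by (simp add: pow0_def)
      qed
      then have "\<rho> powr - b * pow0 (h_mass p u \<rho>) (q - 1) \<le> \<rho> powr - b * (1 + h_mass p u \<rho> powr q)"
        by (intro mult_left_mono) auto
      with n show "norm (indicator {r<..} \<rho> *\<^sub>R (\<rho> powr - b * pow0 (h_mass p u \<rho>) (q - 1)))
        \<le> norm (indicator {r..} \<rho> * \<rho> powr - b + indicator {0<..} \<rho> * (\<rho> powr - b * h_mass p u \<rho> powr q))"
        using assms(4) by (auto simp: algebra_simps split: split_indicator)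
    qed
  qed (simp add: pow0_def)
qed

lemma Phi_primitive:
  fixes u :: "'a::euclidean_space \<Rightarrow> real"
  assumes "u \<in> E_space p q b" "1 \<le> q" "1 < b"
  shows "primitive_of (\<lambda>\<rho>. - a * (\<rho> powr (- b) * pow0 (h_mass p u \<rho>) (q - 1))) (Phi a p q b u)"
    and "0 < r \<Longrightarrow> Phi a p q b u r = a * (LBINT \<rho>:{r<..}. \<rho> powr (- b) * pow0 (h_mass p u \<rho>) (q - 1))"
proof -
  let ?\<kappa> = "\<lambda>\<rho>. \<rho> powr (- b) * pow0 (h_mass p u \<rho>) (q - 1)"
  have loc: "\<forall>\<rho>>0. set_integrable lebesgue (ball 0 \<rho>) (\<lambda>y. \<bar>u y\<bar> powr p)"
    using assms(1) by (auto simp: E_space_def)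
  note [measurable] = h_mass_borel[OF loc]
  have m[measurable]: "?\<kappa> \<in> borel_measurable borel" by (simp add: pow0_def)
  show P: "Phi a p q b u r = a * (LBINT \<rho>:{r<..}. ?\<kappa> \<rho>)" for r
    unfolding Phi_def set_lebesgue_integral_def by (subst integral_completion) auto
  show "primitive_of (\<lambda>\<rho>. - a * ?\<kappa> \<rho>) (Phi a p q b u)"
    unfolding primitive_of_def
  proof (intro allI impI)
    fix s t :: real assume st: "0 < s" "s \<le> t"
    note int_s = E_space_Phi_integrable[OF assms st(1)]
    have it: "set_integrable lborel {t<..} ?\<kappa>" and ist: "set_integrable lborel {s<..t} ?\<kappa>"
      by (rule set_integrable_subset[OF int_s]; use st in auto)+
    have "(LBINT \<rho>:{s<..}. ?\<kappa> \<rho>) = (LBINT \<rho>:{s<..t}. ?\<kappa> \<rho>) + (LBINT \<rho>:{t<..}. ?\<kappa> \<rho>)"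
      using set_integral_Un[OF _ ist it] st by (simp add: ivl_disj_un ivl_disj_int)
    also have "(LBINT \<rho>:{s<..t}. ?\<kappa> \<rho>) = integral {s<..t} ?\<kappa>"
      by (rule set_borel_integral_eq_integral(2)[OF ist])
    also have "\<dots> = integral {s..t} ?\<kappa>"
      by (rule integral_subset_negligible) (use st in \<open>auto intro: negligible_subset[OF negligible_sing[of s]]\<close>)
    finally show "Phi a p q b u t - Phi a p q b u s = integral {s..t} (\<lambda>\<rho>. - a * ?\<kappa> \<rho>)"
      using P by (simp only: integral_mult_right) (simp add: algebra_simps)
  qed
qed

section \<open>Regularity of the radial profile\<close>

lemma integrable_mult_continuous_lebesgue:
  fixes Y :: "'a::euclidean_space \<Rightarrow> real"
  assumes "set_integrable lebesgue K Y" "compact K" "continuous_on UNIV \<phi>" "\<And>x. x \<notin> K \<Longrightarrow> \<phi> x = 0"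
    and [measurable]: "Y \<in> borel_measurable lebesgue"
  shows "integrable lebesgue (\<lambda>x. Y x * \<phi> x)"
proof -
  have [measurable]: "\<phi> \<in> borel_measurable lebesgue"
    by (rule measurable_completion) (use borel_measurable_continuous_onI[OF assms(3)] in simp)
  have "compact (\<phi> ` K)" by (intro compact_continuous_image continuous_on_subset[OF assms(3)] assms(2)) auto
  then obtain M where M: "\<And>x. x \<in> K \<Longrightarrow> \<bar>\<phi> x\<bar> \<le> M"
    using compact_imp_bounded[of "\<phi> ` K"] by (auto simp: bounded_iff)
  have "integrable lebesgue (\<lambda>x. M * (indicator K x *\<^sub>R Y x))"
    using assms(1) by (auto simp: set_integrable_def)
  then show ?thesis
  proof (rule Bochner_Integration.integrable_bound)
    show "AE x in lebesgue. norm (Y x * \<phi> x) \<le> norm (M * (indicator K x *\<^sub>R Y x))"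
    proof (rule AE_I2)
      fix x
      show "norm (Y x * \<phi> x) \<le> norm (M * (indicator K x *\<^sub>R Y x))"
        using M[of x] assms(4)[of x]
        by (cases "x \<in> K") (auto simp: abs_mult mult.commute[of _ "\<bar>Y x\<bar>"] intro!: mult_left_mono)
    qed
  qed measurable
qed

text \<open>w and j are Borel representatives. The weight in j is the radial derivative times
  |x|^(1-N), so that the polar Jacobian cancels: integrating j over a shell amounts to integrating
  the derivative of the profile in r, up to the factor \<open>sph\<close>.\<close>

locale radial_solution =
  fixes a p q b :: real and f :: "real \<Rightarrow> real" and u :: "'a::euclidean_space \<Rightarrow> real"
    and w :: "real \<Rightarrow> real" and j :: "'a \<Rightarrow> real"
  assumes p: "1 < p" and q: "1 \<le> q" and b: "1 < b" and f: "continuous_on UNIV f"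
    and sol: "weak_radial_solution a p q b f u"
    and w_borel [measurable]: "w \<in> borel_measurable borel"
    and u_eq: "AE x in lebesgue. u x = w (norm x)"
    and j_borel [measurable]: "j \<in> borel_measurable borel"
    and j_eq: "AE x in lebesgue. j x = (weak_grad u x \<bullet> x) * norm x powr (- real DIM('a))"
begin

abbreviation "g \<equiv> weak_grad u"

lemma u_E: "u \<in> E_space p q b"
  using sol by (auto simp: weak_radial_solution_def E_rad_def)

lemma wg: "is_weak_grad u g"
  using u_E by (intro is_weak_grad_weak_grad) (simp add: E_space_def)

lemma locally_integrable_u: "locally_integrable u" and locally_integrable_g: "locally_integrable g"
  using wg by (auto simp: is_weak_grad_def)

lemma u_measurable [measurable]: "u \<in> borel_measurable lebesgue"
  and g_measurable [measurable]: "g \<in> borel_measurable lebesgue"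
  by (rule locally_integrable_measurable; rule locally_integrable_u locally_integrable_g)+

lemma N_ge_1: "real DIM('a) \<ge> 1" using DIM_positive[where 'a='a] by (simp add: Suc_le_eq)

lemma sph_positive: "sph DIM('a) > 0" by (rule sph_pos) simp

lemma j_integrable:
  assumes "0 < \<delta>"
  shows "integrable lborel (\<lambda>x. j x * indicator {\<delta><..R} (norm x))"
proof -
  have "integrable lebesgue (\<lambda>x. \<delta> powr (1 - real DIM('a)) * norm (indicator (cball 0 R) x *\<^sub>R g x))"
    using locally_integrable_g
    by (intro integrable_mult_right integrable_norm) (auto simp: locally_integrable_def set_integrable_def)
  then have "integrable lebesgue (\<lambda>x. j x * indicator {\<delta><..R} (norm x))"
  proof (rule Bochner_Integration.integrable_bound)
    show "(\<lambda>x. j x * indicator {\<delta><..R} (norm x)) \<in> borel_measurable lebesgue"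
      by (rule measurable_completion) measurable
    show "AE x in lebesgue. norm (j x * indicator {\<delta><..R} (norm x))
        \<le> norm (\<delta> powr (1 - real DIM('a)) * norm (indicator (cball 0 R) x *\<^sub>R g x))"
      using j_eq
    proof eventually_elim
      case (elim x)
      show ?case
      proof (cases "\<delta> < norm x \<and> norm x \<le> R")
        case True
        have "\<bar>j x\<bar> \<le> (norm (g x) * norm x) * norm x powr (- real DIM('a))"
          unfolding elim abs_mult using Cauchy_Schwarz_ineq2[of "g x" x] by (auto intro: mult_right_mono)
        also have "\<dots> = norm (g x) * norm x powr (1 - real DIM('a))"
          using True assms by (simp add: powr_diff powr_minus field_simps)
        also have "\<dots> \<le> norm (g x) * \<delta> powr (1 - real DIM('a))"
          using True assms N_ge_1 by (intro mult_left_mono powr_mono2') auto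
        finally show ?thesis using True by (simp add: mult.commute abs_mult)
      qed (auto simp: indicator_def)
    qed
  qed
  then show ?thesis by (subst (asm) integrable_completion) auto
qed

lemma w_integrable:
  assumes "0 < \<alpha>"
  shows "set_integrable lborel {\<alpha>..\<beta>} w"
proof -
  have "integrable lebesgue (\<lambda>x. indicator (cball 0 \<beta>) x *\<^sub>R u x)"
    using locally_integrable_u by (auto simp: locally_integrable_def set_integrable_def)
  then have "integrable lebesgue (\<lambda>x::'a. indicator {\<alpha>..\<beta>} (norm x) * w (norm x))"
  proof (rule Bochner_Integration.integrable_bound)
    show "(\<lambda>x::'a. indicator {\<alpha>..\<beta>} (norm x) * w (norm x)) \<in> borel_measurable lebesgue"
      by (rule measurable_completion) measurable
    show "AE x in lebesgue. norm (indicator {\<alpha>..\<beta>} (norm x) * w (norm x)) \<le> norm (indicator (cball 0 \<beta>) x *\<^sub>R u x)"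
      using u_eq by eventually_elim (auto split: split_indicator)
  qed
  then have "integrable lborel (\<lambda>x::'a. indicator {\<alpha>..\<beta>} (norm x) * w (norm x))"
    by (subst (asm) integrable_completion) auto
  then have "integrable lborel (\<lambda>r. radial_density DIM('a) r * (indicator {\<alpha>..\<beta>} r * w r))"
    by (subst (asm) integral_radial(2)[of "\<lambda>r. indicator {\<alpha>..\<beta>} r * w r"]) auto
  then have "integrable lborel (\<lambda>r. inverse (sph DIM('a) * \<alpha> powr (real DIM('a) - 1)) * (radial_density DIM('a) r * (indicator {\<alpha>..\<beta>} r * w r)))"
    by (rule integrable_mult_right)
  then show ?thesis unfolding set_integrable_def
  proof (rule Bochner_Integration.integrable_bound)
    have pos: "sph DIM('a) * \<alpha> powr (real DIM('a) - 1) > 0" using assms sph_positive by simp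
    show "AE r in lborel. norm (indicator {\<alpha>..\<beta>} r *\<^sub>R w r)
       \<le> norm (inverse (sph DIM('a) * \<alpha> powr (real DIM('a) - 1)) * (radial_density DIM('a) r * (indicator {\<alpha>..\<beta>} r * w r)))"
    proof (rule AE_I2)
      fix r
      have "1 \<le> inverse (sph DIM('a) * \<alpha> powr (real DIM('a) - 1)) * (sph DIM('a) * r powr (real DIM('a) - 1))" if "\<alpha> \<le> r"
        using pos sph_positive that assms N_ge_1 by (auto simp: field_simps intro!: powr_mono2)
      from mult_right_mono[OF this, of "\<bar>w r\<bar>"]
      show "norm (indicator {\<alpha>..\<beta>} r *\<^sub>R w r)
       \<le> norm (inverse (sph DIM('a) * \<alpha> powr (real DIM('a) - 1)) * (radial_density DIM('a) r * (indicator {\<alpha>..\<beta>} r * w r)))"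
        using assms sph_positive
        by (auto simp: radial_density_def abs_mult mult.assoc split: split_indicator)
    qed
  qed simp
qed

text \<open>The weak gradient is tested with the field \<theta>(|x|) x, one coordinate function
  \<theta>(|x|) (x \<bullet> e) per basis vector. Its divergence is r \<theta>' + N \<theta>, and
  the choice \<theta> = \<eta> r^(-N) makes this r^(1-N) \<eta>', which cancels the
  Jacobian.\<close>

lemma radial_identity:
  assumes \<eta>: "smooth_supp {\<alpha>..\<beta>} \<eta>" and "0 < \<alpha>"
  shows "sph DIM('a) * (LBINT r. w r * deriv \<eta> r) = - (LBINT x. j x * \<eta> (norm x))"
proof -
  define \<theta> where "\<theta> r = \<eta> r * r powr (- real DIM('a))" for r
  have \<theta>: "smooth_supp {\<alpha>..\<beta>} \<theta>" unfolding \<theta>_def by (rule smooth_supp_mult_powr[OF \<eta> \<open>0 < \<alpha>\<close>])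
  note \<eta>' = smooth_supp_deriv[OF \<eta> closed_atLeastAtMost] and \<theta>' = smooth_supp_deriv[OF \<theta> closed_atLeastAtMost]
  note [measurable] = smooth_supp_borel[OF \<eta>] smooth_supp_borel[OF \<eta>'] smooth_supp_borel[OF \<theta>] smooth_supp_borel[OF \<theta>']
  note D = radial_test_derivative[OF \<theta> \<open>0 < \<alpha>\<close>]
  define G where "G x = (deriv \<theta> (norm x) * norm x powr (- 1)) *\<^sub>R x" for x :: 'a
  define K where "K = cball 0 \<beta> - ball (0::'a) \<alpha>"
  have K: "compact K" unfolding K_def by (rule annulus_compact)
  have Kn: "x \<in> K \<longleftrightarrow> norm x \<in> {\<alpha>..\<beta>}" for x by (auto simp: K_def)
  have contG: "continuous_on UNIV G" unfolding G_def by (rule D(2))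
  have cont\<theta>: "continuous_on UNIV (\<lambda>x::'a. \<theta> (norm x))"
    by (rule Ck_imp_continuous[where k=0], rule Ck_radial[OF smooth_supp_Ck[OF \<theta>] \<open>0 < \<alpha>\<close>])
      (use smooth_supp_zero[OF \<theta>] in auto)
  have su: "set_integrable lebesgue K u" and sg: "set_integrable lebesgue K g"
    using locally_integrable_u locally_integrable_g K by (auto simp: locally_integrable_def)
  define \<phi> where "\<phi> e x = \<theta> (norm x) * (x \<bullet> e)" for e x :: 'a
  define d where "d e x = (G x \<bullet> e) * (x \<bullet> e) + \<theta> (norm x)" for e x :: 'a
  have contd: "continuous_on UNIV (d e)" for e
    unfolding d_def by (intro continuous_intros contG cont\<theta>)
  have cont\<phi>: "continuous_on UNIV (\<phi> e)" for e
    unfolding \<phi>_def by (intro continuous_intros cont\<theta>)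
  have zero: "\<theta> (norm x) = 0" "G x = 0" if "x \<notin> K" for x
    using smooth_supp_zero[OF \<theta>, of "norm x"] smooth_supp_zero[OF \<theta>', of "norm x"] that by (auto simp: Kn G_def)
  have \<phi>: "smooth_supp K (\<phi> e)" for e
  proof (rule smooth_suppI)
    have "Ck k (\<lambda>x::'a. \<theta> (norm x))" for k
      by (rule Ck_radial[OF smooth_supp_Ck[OF \<theta>] \<open>0 < \<alpha>\<close>]) (use smooth_supp_zero[OF \<theta>] in auto)
    then show "Ck k (\<phi> e)" for k unfolding \<phi>_def by (intro Ck_mult Ck_inner)
  qed (simp add: \<phi>_def zero)
  have fd: "frechet_derivative (\<phi> e) (at x) e = d e x" if "e \<in> Basis" for e x
  proof -
    have "(\<phi> e has_derivative (\<lambda>h. \<theta> (norm x) * (h \<bullet> e) + (G x \<bullet> h) * (x \<bullet> e))) (at x)"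
      unfolding \<phi>_def G_def
      by (rule has_derivative_mult[OF D(1)]) (auto intro!: derivative_eq_intros)
    from frechet_derivative_at[OF this, symmetric] show ?thesis using that by (simp add: d_def inner_same_Basis)
  qed
  have iu: "integrable lebesgue (\<lambda>x. u x * d e x)" for e
    by (rule integrable_mult_continuous_lebesgue[OF su K contd]) (simp_all add: d_def zero)
  have ig: "integrable lebesgue (\<lambda>x. (g x \<bullet> e) * \<phi> e x)" for e
  proof (rule integrable_mult_continuous_lebesgue[OF _ K cont\<phi>])
    have "integrable lebesgue (\<lambda>x. (indicator K x *\<^sub>R g x) \<bullet> e)"
      using sg unfolding set_integrable_def by (rule integrable_inner_left)
    then show "set_integrable lebesgue K (\<lambda>x. g x \<bullet> e)" by (simp add: set_integrable_def)
  qed (simp_all add: \<phi>_def zero)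
  have "(LINT x|lebesgue. u x * d e x) = - (LINT x|lebesgue. (g x \<bullet> e) * \<phi> e x)" if "e \<in> Basis" for e
  proof -
    have "(LINT x|lebesgue. u x * frechet_derivative (\<phi> e) (at x) e) = - (LINT x|lebesgue. (g x \<bullet> e) * \<phi> e x)"
      using wg smooth_supp_test_function[OF \<phi> K] that unfolding is_weak_grad_def by blast
    then show ?thesis by (simp add: fd[OF that])
  qed
  then have "(\<Sum>e\<in>Basis. LINT x|lebesgue. u x * d e x) = - (\<Sum>e\<in>Basis. LINT x|lebesgue. (g x \<bullet> e) * \<phi> e x)"
    by (simp add: sum_negf)
  then have "(LINT x|lebesgue. (\<Sum>e\<in>Basis. u x * d e x)) = - (LINT x|lebesgue. (\<Sum>e\<in>Basis. (g x \<bullet> e) * \<phi> e x))"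
    using iu ig by (simp add: Bochner_Integration.integral_sum)
  moreover have "(\<Sum>e\<in>Basis. u x * d e x) = u x * (deriv \<theta> (norm x) * norm x + real DIM('a) * \<theta> (norm x))" for x
  proof -
    have "(\<Sum>e\<in>Basis. d e x) = G x \<bullet> x + real DIM('a) * \<theta> (norm x)"
      by (simp add: d_def sum.distrib euclidean_inner[of "G x" x])
    also have "G x \<bullet> x = deriv \<theta> (norm x) * norm x"
      by (cases "x = 0") (simp_all add: G_def powr_minus dot_square_norm power2_eq_square)
    finally show ?thesis by (simp add: sum_distrib_left[symmetric])
  qed
  moreover have "(\<Sum>e\<in>Basis. (g x \<bullet> e) * \<phi> e x) = (g x \<bullet> x) * \<theta> (norm x)" for x
    by (simp add: \<phi>_def euclidean_inner[of "g x" x] sum_distrib_left sum_distrib_right mult_ac)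
  ultimately have main: "(LINT x|lebesgue. u x * (deriv \<theta> (norm x) * norm x + real DIM('a) * \<theta> (norm x))) =
    - (LINT x|lebesgue. (g x \<bullet> x) * \<theta> (norm x))" by simp
  have d\<theta>: "r powr (real DIM('a) - 1) * (deriv \<theta> r * r + real DIM('a) * \<theta> r) = deriv \<eta> r" if "r > 0" for r
  proof -
    have "(\<theta> has_real_derivative deriv \<eta> r * r powr (- real DIM('a)) + (- real DIM('a) * r powr (- real DIM('a) - 1)) * \<eta> r) (at r)"
      unfolding \<theta>_def
      by (rule DERIV_mult[OF smooth_supp_has_deriv[OF \<eta>]]) (use that in \<open>auto intro!: derivative_eq_intros\<close>)
    then have dd: "deriv \<theta> r = deriv \<eta> r * r powr (- real DIM('a)) + (- real DIM('a) * r powr (- real DIM('a) - 1)) * \<eta> r" by (rule DERIV_imp_deriv)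
    have "r powr (real DIM('a) - 1) * (deriv \<theta> r * r + real DIM('a) * \<theta> r) =
      deriv \<eta> r * (r powr (real DIM('a) - 1) * r powr (- real DIM('a)) * r) + real DIM('a) * \<eta> r * r powr (real DIM('a) - 1) * (r powr (- real DIM('a)) - r powr (- real DIM('a) - 1) * r)"
      unfolding dd unfolding \<theta>_def by (simp add: algebra_simps)
    also have "r powr (real DIM('a) - 1) * r powr (- real DIM('a)) * r = 1"
      using that by (simp add: powr_diff powr_minus)
    also have "r powr (- real DIM('a)) - r powr (- real DIM('a) - 1) * r = 0"
      using that by (simp add: powr_diff)
    finally show ?thesis by simp
  qed
  have "(LINT x|lebesgue. u x * (deriv \<theta> (norm x) * norm x + real DIM('a) * \<theta> (norm x))) =
    (LINT x|lebesgue. w (norm (x::'a)) * (deriv \<theta> (norm x) * norm x + real DIM('a) * \<theta> (norm x)))"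
  proof (rule integral_cong_AE)
    have m: "(\<lambda>x::'a. deriv \<theta> (norm x) * norm x + real DIM('a) * \<theta> (norm x)) \<in> borel_measurable lebesgue"
      by (rule measurable_completion) measurable
    show "(\<lambda>x. u x * (deriv \<theta> (norm x) * norm x + real DIM('a) * \<theta> (norm x))) \<in> borel_measurable lebesgue"
      by (intro borel_measurable_times u_measurable m)
    show "(\<lambda>x::'a. w (norm x) * (deriv \<theta> (norm x) * norm x + real DIM('a) * \<theta> (norm x))) \<in> borel_measurable lebesgue"
      by (rule measurable_completion) measurable
  qed (use u_eq in \<open>auto elim!: eventually_mono\<close>)
  also have "\<dots> = (LBINT x. w (norm (x::'a)) * (deriv \<theta> (norm x) * norm x + real DIM('a) * \<theta> (norm x)))"
    by (rule integral_completion) measurable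
  also have "\<dots> = (LBINT r. radial_density DIM('a) r * (w r * (deriv \<theta> r * r + real DIM('a) * \<theta> r)))"
    by (rule integral_radial(1)) measurable
  also have "\<dots> = (LBINT r. sph DIM('a) * (w r * deriv \<eta> r))"
  proof (rule Bochner_Integration.integral_cong[OF refl])
    fix r show "radial_density DIM('a) r * (w r * (deriv \<theta> r * r + real DIM('a) * \<theta> r)) = sph DIM('a) * (w r * deriv \<eta> r)"
      using d\<theta>[of r] smooth_supp_zero[OF \<eta>', of r] \<open>0 < \<alpha>\<close>
      by (cases "r > 0") (auto simp: radial_density_def mult_ac)
  qed
  finally have 1: "(LINT x|lebesgue. u x * (deriv \<theta> (norm x) * norm x + real DIM('a) * \<theta> (norm x))) =
    sph DIM('a) * (LBINT r. w r * deriv \<eta> r)" by simp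
  have "(LINT x|lebesgue. (g x \<bullet> x) * \<theta> (norm x)) = (LINT x|lebesgue. j x * \<eta> (norm x))"
  proof (rule integral_cong_AE)
    have m: "(\<lambda>x::'a. \<theta> (norm x)) \<in> borel_measurable lebesgue" "(\<lambda>x::'a. x) \<in> borel_measurable lebesgue"
      by (rule measurable_completion, measurable)+
    show "(\<lambda>x. (g x \<bullet> x) * \<theta> (norm x)) \<in> borel_measurable lebesgue"
      by (intro borel_measurable_times borel_measurable_inner g_measurable m)
    show "(\<lambda>x. j x * \<eta> (norm x)) \<in> borel_measurable lebesgue"
      by (rule measurable_completion) measurable
  qed (use j_eq in \<open>auto elim!: eventually_mono simp: \<theta>_def\<close>)
  also have "\<dots> = (LBINT x. j x * \<eta> (norm x))" by (rule integral_completion) measurable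
  finally show ?thesis using main 1 by simp
qed

text \<open>The layer formula turns the radial identity into the statement that \<open>sph\<close>
  times w minus the integral of j over the shell from \<delta> to t has zero distributional
  derivative. So w is a constant plus a function bounded by the integral of |j| over the
  shell.\<close>

lemma w_locally_bounded:
  assumes "0 < \<delta>"
  shows "\<exists>B. AE r in lborel. \<delta> < r \<and> r \<le> R \<longrightarrow> \<bar>w r\<bar> \<le> B"
proof -
  define m where "m t = (LBINT x. j x * indicator {\<delta><..t} (norm x))" for t
  have [measurable]: "m \<in> borel_measurable borel"
  proof -
    have [measurable]: "Measurable.pred (borel \<Otimes>\<^sub>M lborel) (\<lambda>x::real \<times> 'a. norm (snd x) \<in> {\<delta><..fst x})"
      unfolding greaterThanAtMost_iff by measurable
    show ?thesis
      unfolding m_def indicator_def by (rule lborel.borel_measurable_lebesgue_integral) measurable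
  qed
  have m_bound: "\<bar>m t\<bar> \<le> (LBINT x. \<bar>j x * indicator {\<delta><..T} (norm x)\<bar>)" if "t \<le> T" for t T
  proof -
    have "\<bar>m t\<bar> \<le> (LBINT x. \<bar>j x * indicator {\<delta><..t} (norm x)\<bar>)"
      unfolding m_def by (rule integral_abs_bound)
    also have "\<dots> \<le> (LBINT x. \<bar>j x * indicator {\<delta><..T} (norm x)\<bar>)"
      using j_integrable[OF assms] that
      by (intro integral_mono) (auto split: split_indicator)
    finally show ?thesis .
  qed
  have sm: "set_integrable lborel {\<alpha>..\<beta>} m" for \<alpha> \<beta>
    unfolding set_integrable_def
  proof (rule Bochner_Integration.integrable_bound)
    show "integrable lborel (\<lambda>t. (LBINT x. \<bar>j x * indicator {\<delta><..\<beta>} (norm x)\<bar>) * indicator {\<alpha>..\<beta>} t)"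
      by (intro integrable_mult_right integrable_real_indicator) (auto simp: emeasure_lborel_Icc_eq)
    show "AE t in lborel. norm (indicator {\<alpha>..\<beta>} t *\<^sub>R m t)
        \<le> norm ((LBINT x. \<bar>j x * indicator {\<delta><..\<beta>} (norm x)\<bar>) * indicator {\<alpha>..\<beta>} t)"
      using m_bound by (intro AE_I2) (auto split: split_indicator)
  qed measurable
  have "\<exists>c. AE t in lborel. \<delta> < t \<longrightarrow> sph DIM('a) * w t - m t = c"
  proof (rule du_Bois_Reymond)
    show "set_integrable lborel {\<alpha>..\<beta>} (\<lambda>t. sph DIM('a) * w t - m t)" if "\<delta> < \<alpha>" for \<alpha> \<beta>
      using that assms by (intro set_integral_diff set_integrable_mult_right w_integrable sm) auto
    fix \<eta> \<alpha> \<beta> assume "\<delta> < \<alpha>" and \<eta>: "smooth_supp {\<alpha>..\<beta>} \<eta>"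
    note \<eta>' = smooth_supp_deriv[OF \<eta> closed_atLeastAtMost]
    have "0 < \<alpha>" using \<open>\<delta> < \<alpha>\<close> assms by simp
    have "(LBINT x. j x * \<eta> (norm x)) = - (LBINT t. deriv \<eta> t * m t)"
      unfolding m_def
      by (rule integral_layer[OF sigma_finite_lborel _ _ \<eta> \<open>\<delta> < \<alpha>\<close> j_integrable[OF assms]]) auto
    then have "sph DIM('a) * (LBINT r. w r * deriv \<eta> r) = (LBINT t. m t * deriv \<eta> t)"
      using radial_identity[OF \<eta> \<open>0 < \<alpha>\<close>] by (simp add: mult.commute)
    then show "(LBINT t. (sph DIM('a) * w t - m t) * deriv \<eta> t) = 0"
      using integrable_mult_smooth_supp[OF w_integrable[OF \<open>0 < \<alpha>\<close>] \<eta>' compact_Icc w_borel]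
        integrable_mult_smooth_supp[OF sm \<eta>' compact_Icc \<open>m \<in> _\<close>]
      by (simp add: left_diff_distrib mult.assoc)
  qed measurable
  then obtain c where c: "AE t in lborel. \<delta> < t \<longrightarrow> sph DIM('a) * w t - m t = c" by blast
  show ?thesis
  proof (intro exI)
    show "AE r in lborel. \<delta> < r \<and> r \<le> R \<longrightarrow>
      \<bar>w r\<bar> \<le> (\<bar>c\<bar> + (LBINT x. \<bar>j x * indicator {\<delta><..R} (norm x)\<bar>)) / sph DIM('a)"
      using c
    proof eventually_elim
      case (elim t)
      show ?case
      proof
        assume t: "\<delta> < t \<and> t \<le> R"
        then have "w t = (c + m t) / sph DIM('a)" using elim sph_positive by (simp add: field_simps)
        moreover have "\<bar>c + m t\<bar> \<le> \<bar>c\<bar> + (LBINT x. \<bar>j x * indicator {\<delta><..R} (norm x)\<bar>)"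
          using m_bound[of t R] t by linarith
        ultimately show "\<bar>w t\<bar> \<le> (\<bar>c\<bar> + (LBINT x. \<bar>j x * indicator {\<delta><..R} (norm x)\<bar>)) / sph DIM('a)"
          using sph_positive by (simp add: abs_divide divide_right_mono)
      qed
    qed
  qed
qed

end

lemma set_integrable_bounded_AE:
  fixes F :: "real \<Rightarrow> real"
  assumes "F \<in> borel_measurable borel" "AE r in lborel. r \<in> {\<alpha>..\<beta>} \<longrightarrow> \<bar>F r\<bar> \<le> M"
  shows "set_integrable lborel {\<alpha>..\<beta>} F"
  unfolding set_integrable_def
proof (rule Bochner_Integration.integrable_bound)
  show "integrable lborel (\<lambda>r. M * indicator {\<alpha>..\<beta>} r)"
    by (intro integrable_mult_right integrable_real_indicator) (auto simp: emeasure_lborel_Icc_eq)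
  show "AE r in lborel. norm (indicator {\<alpha>..\<beta>} r *\<^sub>R F r) \<le> norm (M * indicator {\<alpha>..\<beta>} r)"
    using assms(2) by eventually_elim (auto split: split_indicator)
qed (use assms(1) in auto)

lemma continuous_on_compact_bound:
  fixes F :: "'a::topological_space \<Rightarrow> real"
  assumes "continuous_on S F" "compact S"
  obtains M where "M \<ge> 0" "\<And>x. x \<in> S \<Longrightarrow> \<bar>F x\<bar> \<le> M"
proof -
  obtain M where "\<forall>x\<in>S. \<bar>F x\<bar> \<le> M"
    using compact_imp_bounded[OF compact_continuous_image[OF assms]] by (auto simp: bounded_iff)
  then show ?thesis by (intro that[of "max M 0"]) auto
qed

lemma abs_powr_tendsto_0: "0 < s \<Longrightarrow> ((\<lambda>t::real. \<bar>t\<bar> powr s) \<longlongrightarrow> 0) (at 0)"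
  by (rule tendsto_eq_rhs[where x="\<bar>0\<bar> powr s"], intro tendsto_powr' tendsto_intros) auto

lemma abs_powr_mult_self: "\<bar>\<bar>t::real\<bar> powr (p - 2) * t\<bar> = \<bar>t\<bar> powr (p - 1)"
  by (cases "t = 0") (auto simp: abs_mult powr_diff field_simps power2_eq_square)

context radial_solution
begin

lemma Phi_continuous: "continuous_on {0<..} (Phi a p q b u)"
proof (rule primitive_of_continuous[OF _ Phi_primitive(1)[OF u_E q b]])
  fix \<alpha> \<beta> :: real assume "0 < \<alpha>"
  then have "set_integrable lborel {\<alpha> / 2<..} (\<lambda>\<rho>. \<rho> powr (- b) * pow0 (h_mass p u \<rho>) (q - 1))"
    by (intro E_space_Phi_integrable[OF u_E q b]) simp
  then have "set_integrable lborel {\<alpha> / 2<..} (\<lambda>\<rho>. - a * (\<rho> powr (- b) * pow0 (h_mass p u \<rho>) (q - 1)))"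
    by (intro set_integrable_mult_right)
  then show "set_integrable lborel {\<alpha>..\<beta>} (\<lambda>\<rho>. - a * (\<rho> powr (- b) * pow0 (h_mass p u \<rho>) (q - 1)))"
    by (rule set_integrable_subset) (use \<open>0 < \<alpha>\<close> in auto)
qed

text \<open>\<open>Phi\<close> is known to be continuous only for r > 0; cutting it off gives Borel
  measurability on the whole line.\<close>

definition "Phi0 r = (if 0 < r then Phi a p q b u r else 0)"
definition "k2 r = r powr (real DIM('a) - 1) * (Phi0 r * \<bar>w r\<bar> powr (p - 2) * w r)"
definition "k3 r = r powr (real DIM('a) - 1) * f (w r)"

lemma Phi0_borel [measurable]: "Phi0 \<in> borel_measurable borel"
  unfolding Phi0_def using Phi_continuous by (rule borel_measurable_restrict_pos)

lemma f_borel [measurable]: "f \<in> borel_measurable borel"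
  using f by (rule borel_measurable_continuous_onI)

lemma k2_borel [measurable]: "k2 \<in> borel_measurable borel" and k3_borel [measurable]: "k3 \<in> borel_measurable borel"
  unfolding k2_def k3_def by measurable

lemma k_integrable:
  assumes "0 < \<alpha>"
  shows "set_integrable lborel {\<alpha>..\<beta>} k2" and "set_integrable lborel {\<alpha>..\<beta>} k3"
proof -
  obtain B0 where B0: "AE r in lborel. \<alpha> / 2 < r \<and> r \<le> \<beta> \<longrightarrow> \<bar>w r\<bar> \<le> B0"
    using w_locally_bounded[of "\<alpha> / 2" \<beta>] assms by auto
  define B where "B = max B0 0"
  have B: "AE r in lborel. r \<in> {\<alpha>..\<beta>} \<longrightarrow> \<bar>w r\<bar> \<le> B" "B \<ge> 0"
    using B0 assms by (auto simp: B_def elim!: eventually_mono)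
  have c\<Phi>: "continuous_on {\<alpha>..\<beta>} (Phi a p q b u)"
    by (rule continuous_on_subset[OF Phi_continuous]) (use assms in auto)
  have cf: "continuous_on {- B..B} f" by (rule continuous_on_subset[OF f]) simp
  obtain M\<Phi> where M\<Phi>: "M\<Phi> \<ge> 0" "\<And>r. r \<in> {\<alpha>..\<beta>} \<Longrightarrow> \<bar>Phi a p q b u r\<bar> \<le> M\<Phi>"
    using continuous_on_compact_bound[OF c\<Phi> compact_Icc] by blast
  obtain Mf where Mf: "Mf \<ge> 0" "\<And>t. t \<in> {-B..B} \<Longrightarrow> \<bar>f t\<bar> \<le> Mf"
    using continuous_on_compact_bound[OF cf compact_Icc] by blast
  have pw: "\<bar>r powr (real DIM('a) - 1)\<bar> \<le> \<beta> powr (real DIM('a) - 1)" if "r \<in> {\<alpha>..\<beta>}" for r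
    using that assms N_ge_1 by (auto intro!: powr_mono2)
  show "set_integrable lborel {\<alpha>..\<beta>} k2"
  proof (rule set_integrable_bounded_AE[OF k2_borel])
    show "AE r in lborel. r \<in> {\<alpha>..\<beta>} \<longrightarrow> \<bar>k2 r\<bar> \<le> \<beta> powr (real DIM('a) - 1) * (M\<Phi> * B powr (p - 1))"
      using B(1)
    proof eventually_elim
      case (elim r)
      show ?case
      proof
        assume r: "r \<in> {\<alpha>..\<beta>}"
        have "\<bar>Phi0 r\<bar> \<le> M\<Phi>" using M\<Phi>(2)[OF r] r assms by (auto simp: Phi0_def)
        moreover have "\<bar>\<bar>w r\<bar> powr (p - 2) * w r\<bar> \<le> B powr (p - 1)"
          unfolding abs_powr_mult_self using elim r p by (intro powr_mono2) auto
        ultimately have "\<bar>Phi0 r * (\<bar>w r\<bar> powr (p - 2) * w r)\<bar> \<le> M\<Phi> * B powr (p - 1)"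
          unfolding abs_mult[of "Phi0 r"] using M\<Phi>(1) by (intro mult_mono) auto
        then show "\<bar>k2 r\<bar> \<le> \<beta> powr (real DIM('a) - 1) * (M\<Phi> * B powr (p - 1))"
          unfolding k2_def abs_mult[of "r powr _"] using pw[OF r]
          by (intro mult_mono) (auto simp: mult.assoc)
      qed
    qed
  qed
  show "set_integrable lborel {\<alpha>..\<beta>} k3"
  proof (rule set_integrable_bounded_AE[OF k3_borel])
    show "AE r in lborel. r \<in> {\<alpha>..\<beta>} \<longrightarrow> \<bar>k3 r\<bar> \<le> \<beta> powr (real DIM('a) - 1) * Mf"
      using B(1)
    proof eventually_elim
      case (elim r)
      show ?case
      proof
        assume r: "r \<in> {\<alpha>..\<beta>}"
        have "w r \<in> {- B..B}" using elim r by (auto simp: abs_le_iff)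
        then have "\<bar>f (w r)\<bar> \<le> Mf" by (rule Mf(2))
        then show "\<bar>k3 r\<bar> \<le> \<beta> powr (real DIM('a) - 1) * Mf"
          unfolding k3_def abs_mult[of "r powr _"] using pw[OF r] by (intro mult_mono) auto
      qed
    qed
  qed
qed

text \<open>The equation is tested with \<psi>(|x|). As \<psi>' = \<eta> r^(1-N), the gradient term
  is j \<eta>(|x|), which \<open>radial_identity\<close> rewrites through w and \<eta>'; the form
  matches the hypothesis of \<open>weak_second_order_ode\<close> with m = N - 1.\<close>

lemma radial_weak_equation:
  assumes "0 < \<alpha>" and \<eta>: "smooth_supp {\<alpha>..\<beta>} \<eta>" and \<psi>: "smooth_supp {\<alpha>..\<beta>} \<psi>"
    and d\<psi>: "deriv \<psi> = (\<lambda>r. \<eta> r * r powr - (real DIM('a) - 1))"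
  shows "(LBINT r. w r * deriv \<eta> r) = (LBINT r. (k2 r - k3 r) * \<psi> r)"
proof -
  let ?v = "\<lambda>x::'a. \<psi> (norm x)"
  note [measurable] = smooth_supp_borel[OF \<eta>] smooth_supp_borel[OF \<psi>]
  have v: "?v \<in> E_rad p q b" by (rule radial_test_E_rad[OF \<psi> \<open>0 < \<alpha>\<close> p q b])
  note vg = radial_test_weak_grad(2)[OF \<psi> \<open>0 < \<alpha>\<close>, where 'a='a]
  have eq: "(LINT x|lebesgue. g x \<bullet> weak_grad ?v x) +
        (LINT x|lebesgue. Phi a p q b u (norm x) * \<bar>u x\<bar> powr (p - 2) * u x * ?v x) =
        (LINT x|lebesgue. f (u x) * ?v x)"
    using sol v by (auto simp: weak_radial_solution_def)
  have vm: "weak_grad ?v \<in> borel_measurable lebesgue"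
    using v by (intro locally_integrable_measurable)
      (auto simp: E_rad_def E_space_def dest!: is_weak_grad_weak_grad simp: is_weak_grad_def)
  have "(LINT x|lebesgue. g x \<bullet> weak_grad ?v x) = (LINT x|lebesgue. j x * \<eta> (norm x))"
  proof (rule integral_cong_AE)
    show "(\<lambda>x. g x \<bullet> weak_grad ?v x) \<in> borel_measurable lebesgue"
      by (intro borel_measurable_inner g_measurable vm)
    show "(\<lambda>x. j x * \<eta> (norm x)) \<in> borel_measurable lebesgue"
      by (rule measurable_completion) measurable
    show "AE x in lebesgue. g x \<bullet> weak_grad ?v x = j x * \<eta> (norm x)"
      using vg j_eq
    proof eventually_elim
      case (elim x)
      show ?case
      proof (cases "x = 0")
        case False
        have "norm x powr - (real DIM('a) - 1) * norm x powr - 1 = norm x powr - real DIM('a)"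
          unfolding powr_add[symmetric] by simp
        then show ?thesis using elim by (simp add: d\<psi> mult_ac)
      qed (use elim in simp)
    qed
  qed
  also have "\<dots> = (LBINT x. j x * \<eta> (norm x))" by (rule integral_completion) measurable
  finally have T1: "(LINT x|lebesgue. g x \<bullet> weak_grad ?v x) = - (sph DIM('a) * (LBINT r. w r * deriv \<eta> r))"
    using radial_identity[OF \<eta> \<open>0 < \<alpha>\<close>] by simp
  \<comment> \<open>A common reduction to the half-line for the potential and the reaction term: F
    may depend on both the radius and the value of u.\<close>
  have red: "(LINT x|lebesgue. F (norm x) (u x) * ?v x) = sph DIM('a) * (LBINT r. r powr (real DIM('a) - 1) * F r (w r) * \<psi> r)"
    if [measurable]: "(\<lambda>(r, t). F r t) \<in> borel_measurable (borel \<Otimes>\<^sub>M borel)" for F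
  proof -
    have [measurable]: "(\<lambda>x. F (norm (x::'a)) (w (norm x)) * ?v x) \<in> borel_measurable borel"
      "(\<lambda>r. F r (w r) * \<psi> r) \<in> borel_measurable borel" by measurable
    have m: "(\<lambda>x. F (norm x) (u x)) \<in> borel_measurable lebesgue"
    proof -
      have "(\<lambda>x. (norm x, u x)) \<in> lebesgue \<rightarrow>\<^sub>M borel \<Otimes>\<^sub>M borel"
        by (intro measurable_Pair u_measurable measurable_completion) simp
      from measurable_compose[OF this that] show ?thesis by simp
    qed
    have "(LINT x|lebesgue. F (norm x) (u x) * ?v x) = (LINT x|lebesgue. F (norm x) (w (norm x)) * ?v x)"
    proof (rule integral_cong_AE)
      show "(\<lambda>x. F (norm x) (u x) * ?v x) \<in> borel_measurable lebesgue"
        by (intro borel_measurable_times m measurable_completion) simp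
      show "(\<lambda>x. F (norm x) (w (norm x)) * ?v x) \<in> borel_measurable lebesgue"
        by (rule measurable_completion) simp
    qed (use u_eq in \<open>auto elim!: eventually_mono\<close>)
    also have "\<dots> = (LBINT x. F (norm x) (w (norm x)) * ?v x)" by (rule integral_completion) simp
    also have "\<dots> = (LBINT r. radial_density DIM('a) r * (F r (w r) * \<psi> r))"
      by (rule integral_radial(1)) measurable
    also have "\<dots> = (LBINT r. sph DIM('a) * (r powr (real DIM('a) - 1) * F r (w r) * \<psi> r))"
    proof (rule Bochner_Integration.integral_cong[OF refl])
      fix r show "radial_density DIM('a) r * (F r (w r) * \<psi> r) = sph DIM('a) * (r powr (real DIM('a) - 1) * F r (w r) * \<psi> r)"
        using smooth_supp_zero[OF \<psi>, of r] \<open>0 < \<alpha>\<close> by (cases "r > 0") (auto simp: radial_density_def)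
    qed
    finally show ?thesis by simp
  qed
  have "(LINT x|lebesgue. Phi a p q b u (norm x) * \<bar>u x\<bar> powr (p - 2) * u x * ?v x) =
      (LINT x|lebesgue. (Phi0 (norm x) * \<bar>u x\<bar> powr (p - 2) * u x) * ?v x)"
  proof (rule Bochner_Integration.integral_cong[OF refl])
    fix x :: 'a
    show "Phi a p q b u (norm x) * \<bar>u x\<bar> powr (p - 2) * u x * ?v x = (Phi0 (norm x) * \<bar>u x\<bar> powr (p - 2) * u x) * ?v x"
      using smooth_supp_zero[OF \<psi>, of 0] \<open>0 < \<alpha>\<close> by (cases "x = 0") (auto simp: Phi0_def)
  qed
  also have "\<dots> = sph DIM('a) * (LBINT r. k2 r * \<psi> r)"
    using red[of "\<lambda>r t. Phi0 r * \<bar>t\<bar> powr (p - 2) * t"] by (simp add: k2_def)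
  finally have T2: "(LINT x|lebesgue. Phi a p q b u (norm x) * \<bar>u x\<bar> powr (p - 2) * u x * ?v x) =
      sph DIM('a) * (LBINT r. k2 r * \<psi> r)" .
  have T3: "(LINT x|lebesgue. f (u x) * ?v x) = sph DIM('a) * (LBINT r. k3 r * \<psi> r)"
    using red[of "\<lambda>r t. f t"] by (simp add: k3_def)
  have "sph DIM('a) * (LBINT r. w r * deriv \<eta> r) =
      sph DIM('a) * ((LBINT r. k2 r * \<psi> r) - (LBINT r. k3 r * \<psi> r))"
    using eq T1 T2 T3 by (simp add: algebra_simps)
  then have "(LBINT r. w r * deriv \<eta> r) = (LBINT r. k2 r * \<psi> r) - (LBINT r. k3 r * \<psi> r)"
    using sph_positive by simp
  then show ?thesis
    using integrable_mult_smooth_supp[OF k_integrable(1)[OF \<open>0 < \<alpha>\<close>] \<psi> compact_Icc k2_borel]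
      integrable_mult_smooth_supp[OF k_integrable(2)[OF \<open>0 < \<alpha>\<close>] \<psi> compact_Icc k3_borel]
    by (simp add: left_diff_distrib)
qed

lemma profile_ode:
  obtains W K where "AE x in lebesgue. u x = W (norm x)"
    "\<And>r. r > 0 \<Longrightarrow> (W has_real_derivative r powr - (real DIM('a) - 1) * K r) (at r)"
    "\<And>r. r > 0 \<Longrightarrow> (K has_real_derivative
      r powr (real DIM('a) - 1) * (Phi a p q b u r * \<bar>W r\<bar> powr (p - 2) * W r - f (W r))) (at r)"
proof -
  have k: "set_integrable lborel {\<alpha>..\<beta>} (\<lambda>r. k2 r - k3 r)" if "0 < \<alpha>" for \<alpha> \<beta>
    by (intro set_integral_diff k_integrable that)
  obtain K W where K: "primitive_of (\<lambda>r. k2 r - k3 r) K"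
    and W: "primitive_of (\<lambda>r. r powr - (real DIM('a) - 1) * K r) W" and w: "AE r in lborel. 0 < r \<longrightarrow> w r = W r"
  proof (rule weak_second_order_ode[OF w_borel _ w_integrable k])
    show "(\<lambda>r. k2 r - k3 r) \<in> borel_measurable borel" by measurable
    show "(LBINT r. w r * deriv \<eta> r) = (LBINT r. (k2 r - k3 r) * \<psi> r)"
      if "0 < \<alpha>" "smooth_supp {\<alpha>..\<beta>} \<eta>" "smooth_supp {\<alpha>..\<beta>} \<psi>"
        "deriv \<psi> = (\<lambda>r. \<eta> r * r powr - (real DIM('a) - 1))" for \<alpha> \<beta> \<eta> \<psi>
      using that by (rule radial_weak_equation)
  qed
  have contK: "continuous_on {0<..} K" by (rule primitive_of_continuous[OF k K])
  have contP: "continuous_on {0<..} (\<lambda>r. r powr - (real DIM('a) - 1) * K r)"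
    by (intro continuous_intros contK) auto
  have W': "(W has_real_derivative r powr - (real DIM('a) - 1) * K r) (at r)" if "r > 0" for r
    by (rule primitive_of_has_derivative[OF contP W that])
  have contW: "continuous_on {0<..} W"
    using W' by (intro continuous_at_imp_continuous_on ballI DERIV_isCont) auto
  let ?k = "\<lambda>r. r powr (real DIM('a) - 1) * (Phi a p q b u r * (\<bar>W r\<bar> powr (p - 2) * W r) - f (W r))"
  \<comment> \<open>For p < 2 the factor |t|^(p-2) is singular at 0; rewriting the product as sgn t
    |t|^(p-1) shows continuity, since p > 1.\<close>
  have contabs: "continuous_on UNIV (\<lambda>t::real. \<bar>t\<bar> powr (p - 2) * t)"
  proof -
    have "(\<lambda>t::real. \<bar>t\<bar> powr (p - 2) * t) = (\<lambda>t. sgn t * \<bar>t\<bar> powr (p - 1))"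
      by (auto simp: fun_eq_iff sgn_if powr_diff power2_eq_square)
    moreover have "isCont (\<lambda>t. sgn t * \<bar>t\<bar> powr (p - 1)) t" for t :: real
    proof (cases "t = 0")
      case True
      have "((\<lambda>t::real. \<bar>t\<bar> powr (p - 1)) \<longlongrightarrow> 0) (at 0)" using p by (intro abs_powr_tendsto_0) simp
      then have "((\<lambda>t::real. sgn t * \<bar>t\<bar> powr (p - 1)) \<longlongrightarrow> 0) (at 0)"
        by (rule Lim_null_comparison[rotated]) (auto simp: sgn_if abs_mult)
      then show ?thesis using True by (simp add: isCont_def)
    next
      case False
      then show ?thesis by (intro continuous_intros) auto
    qed
    ultimately show ?thesis by (simp add: continuous_on_eq_continuous_at)
  qed
  have contk: "continuous_on {0<..} ?k"
    by (intro continuous_intros Phi_continuous contW continuous_on_compose2[OF contabs contW] continuous_on_compose2[OF f contW]) auto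
  \<comment> \<open>Here w is exchanged for its continuous version W in the right-hand side, which
    makes the integrand continuous and K continuously differentiable.\<close>
  have "primitive_of ?k K"
    by (rule primitive_of_cong_AE[OF K]) (use w in \<open>auto simp: k2_def k3_def Phi0_def algebra_simps elim!: eventually_mono\<close>)
  then have K': "(K has_real_derivative ?k r) (at r)" if "r > 0" for r
    by (rule primitive_of_has_derivative[OF contk _ that])
  have "AE x in lborel. w (norm (x::'a)) = W (norm x) \<or> x = 0" by (rule AE_radial[OF w])
  then have "AE x in lebesgue. w (norm (x::'a)) = W (norm x) \<or> x = 0" by (rule AE_completion)
  moreover have "AE x in lebesgue. x \<noteq> (0::'a)" by (rule AE_completion[OF AE_lborel_singleton])
  ultimately have "AE x in lebesgue. u x = W (norm x)"
    using u_eq by eventually_elim auto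
  with W' K' that[of W K] show ?thesis by (simp add: mult.assoc)
qed

end

lemma continuous_on_UNIV_vanishing:
  fixes A :: "'a::euclidean_space \<Rightarrow> 'b::real_normed_vector"
  assumes "continuous_on (- {0}) A" "\<delta> > 0" "\<And>x. x \<in> ball 0 \<delta> \<Longrightarrow> A x = 0"
  shows "continuous_on UNIV A"
proof -
  have "continuous_on (ball 0 \<delta>) A"
    using assms(3) by (subst continuous_on_cong[OF refl, of _ _ "\<lambda>_. 0"]) auto
  then have "continuous_on (- {0} \<union> ball 0 \<delta>) A"
    by (intro continuous_on_open_Un assms) auto
  moreover have "- {0} \<union> ball 0 \<delta> = (UNIV :: 'a set)" using assms(2) by auto
  ultimately show ?thesis by simp
qed

text \<open>The origin is removed because W may blow up there. Test functions supported in its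
  complement vanish on a ball around 0, so V \<phi> extends smoothly enough by 0, and the removed
  point is a null set.\<close>

lemma radial_C1_weak_grad:
  fixes u :: "'a::euclidean_space \<Rightarrow> real"
  assumes wg: "is_weak_grad u g" and u: "AE x in lebesgue. u x = W (norm x)"
    and W: "\<And>r. r > 0 \<Longrightarrow> (W has_real_derivative W' r) (at r)" and W': "continuous_on {0<..} W'"
  shows "AE x in lebesgue. g x = (W' (norm x) / norm x) *\<^sub>R x"
proof -
  define V where "V x = W (norm x)" for x :: 'a
  define G where "G x = ((if 0 < norm x then W' (norm x) else 0) / norm x) *\<^sub>R x" for x :: 'a
  have um: "u \<in> borel_measurable lebesgue"
    using wg by (intro locally_integrable_measurable) (simp add: is_weak_grad_def)
  have contW: "continuous_on {0<..} W"
    using W by (intro continuous_at_imp_continuous_on ballI DERIV_isCont) auto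
  have contV: "continuous_on (- {0}) V"
    unfolding V_def by (intro continuous_on_compose2[OF contW] continuous_intros) auto
  have contW'n: "continuous_on (- {0}) (\<lambda>x::'a. W' (norm x))"
    by (intro continuous_on_compose2[OF W'] continuous_intros) auto
  have contG: "continuous_on (- {0}) G"
  proof -
    have "continuous_on (- {0}) (\<lambda>x::'a. (W' (norm x) / norm x) *\<^sub>R x)"
      by (intro continuous_intros contW'n) auto
    then show ?thesis by (subst continuous_on_cong[OF refl]) (auto simp: G_def)
  qed
  have [measurable]: "(\<lambda>r. if 0 < r then W' r else 0) \<in> borel_measurable borel"
    by (rule borel_measurable_restrict_pos[OF W'])
  have Gm: "G \<in> borel_measurable borel"
  proof -
    have "(\<lambda>x::'a. (\<lambda>r. if 0 < r then W' r else 0) (norm x)) \<in> borel_measurable borel"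
      by (rule measurable_compose[where f=norm and N=borel]) auto
    then show ?thesis unfolding G_def by measurable
  qed
  have DV: "(V has_derivative (\<lambda>h. G x \<bullet> h)) (at x)" if "x \<noteq> 0" for x
  proof -
    have e: "W' (norm x) * (x \<bullet> h) / norm x = G x \<bullet> h" for h using that by (simp add: G_def)
    show ?thesis using has_derivative_radial[OF W, of x] that unfolding V_def e by simp
  qed
  have "AE x in lebesgue. x \<in> - {0} \<longrightarrow> g x = G x"
  proof (rule is_weak_grad_AE_unique[OF wg _ Gm])
    show "open (- {0::'a})" by auto
    fix K :: "'a set" and e :: 'a assume K: "compact K" "K \<subseteq> - {0}" and e: "e \<in> Basis"
    show "set_integrable lborel K (\<lambda>x. G x \<bullet> e)"
      unfolding set_integrable_def
      by (intro borel_integrable_compact K continuous_on_inner continuous_on_const continuous_on_subset[OF contG])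
    fix \<phi> assume \<phi>: "smooth_supp K \<phi>"
    have "open (- K)" "0 \<in> - K" using K by (auto simp: compact_imp_closed)
    then obtain \<delta> where \<delta>: "\<delta> > 0" "ball 0 \<delta> \<subseteq> - K" using openE by blast
    note C = smooth_supp_Ck[OF \<phi>, of "Suc 0"]
    note D\<phi> = Ck_Suc_D(1)[OF C]
    have cont: "continuous_on UNIV (\<lambda>x. frechet_derivative \<phi> (at x) e)" "continuous_on UNIV \<phi>"
      using Ck_Suc_D(2)[OF C e] smooth_supp_continuous[OF \<phi>] by auto
    have zD: "frechet_derivative \<phi> (at x) = (\<lambda>h. 0)" if "x \<notin> K" for x
      by (rule has_derivative_outside_support[OF D\<phi> compact_imp_closed[OF K(1)] smooth_supp_zero[OF \<phi>] that])
    have z: "\<phi> x = 0" if "x \<notin> K" for x using smooth_supp_zero[OF \<phi> that] .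
    have DF: "((\<lambda>x. V x * \<phi> x) has_derivative (\<lambda>h. V x * frechet_derivative \<phi> (at x) h + (G x \<bullet> h) * \<phi> x)) (at x)" for x
    proof (cases "x = 0")
      case True
      have "((\<lambda>x. 0) has_derivative (\<lambda>h. V x * frechet_derivative \<phi> (at x) h + (G x \<bullet> h) * \<phi> x)) (at x)"
        using True zD[of 0] z[of 0] \<open>0 \<in> - K\<close> by simp
      then show ?thesis
        by (rule has_derivative_transform_within_open[where s="ball 0 \<delta>"]) (use True \<delta> z in auto)
    qed (intro has_derivative_mult DV D\<phi>)
    have c1: "continuous_on UNIV (\<lambda>x. V x * frechet_derivative \<phi> (at x) e)"
    proof (rule continuous_on_UNIV_vanishing[OF _ \<delta>(1)])
      show "continuous_on (- {0}) (\<lambda>x. V x * frechet_derivative \<phi> (at x) e)"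
        by (intro continuous_on_mult contV continuous_on_subset[OF cont(1)] subset_UNIV)
      show "V x * frechet_derivative \<phi> (at x) e = 0" if "x \<in> ball 0 \<delta>" for x
        using zD[of x] \<delta>(2) that by auto
    qed
    have c2: "continuous_on UNIV (\<lambda>x. (G x \<bullet> e) * \<phi> x)"
    proof (rule continuous_on_UNIV_vanishing[OF _ \<delta>(1)])
      show "continuous_on (- {0}) (\<lambda>x. (G x \<bullet> e) * \<phi> x)"
        by (intro continuous_on_mult continuous_on_inner continuous_on_const contG continuous_on_subset[OF cont(2)] subset_UNIV)
      show "(G x \<bullet> e) * \<phi> x = 0" if "x \<in> ball 0 \<delta>" for x
        using z[of x] \<delta>(2) that by auto
    qed
    obtain R where "\<forall>x\<in>K. norm x \<le> R"
      using compact_imp_bounded[OF K(1)] unfolding bounded_iff by blast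
    then have R: "V x * \<phi> x = 0" if "x \<notin> cball 0 R" for x
      using z[of x] that by auto
    have "(LBINT x. V x * frechet_derivative \<phi> (at x) e + (G x \<bullet> e) * \<phi> x) = 0"
      by (rule integral_directional_derivative_zero[where D="\<lambda>x h. V x * frechet_derivative \<phi> (at x) h + (G x \<bullet> h) * \<phi> x"
          and F="\<lambda>x. V x * \<phi> x" and R=R])
        (intro DF continuous_on_add c1 c2 R)+
    moreover have "integrable lborel (\<lambda>x. V x * frechet_derivative \<phi> (at x) e)"
      by (rule integrable_lborel_compact_support[OF c1 K(1)]) (simp add: zD)
    moreover have "integrable lborel (\<lambda>x. (G x \<bullet> e) * \<phi> x)"
      by (rule integrable_lborel_compact_support[OF c2 K(1)]) (simp add: z)
    ultimately have "(LBINT x. V x * frechet_derivative \<phi> (at x) e) = - (LBINT x. (G x \<bullet> e) * \<phi> x)"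
      by simp
    moreover have m: "(\<lambda>x. V x * frechet_derivative \<phi> (at x) e) \<in> borel_measurable lborel"
      using borel_measurable_continuous_onI[OF c1] by simp
    moreover have "(LINT x|lebesgue. u x * frechet_derivative \<phi> (at x) e) = (LINT x|lebesgue. V x * frechet_derivative \<phi> (at x) e)"
    proof (rule integral_cong_AE)
      have "(\<lambda>x. frechet_derivative \<phi> (at x) e) \<in> borel_measurable lebesgue"
        by (rule measurable_completion) (use borel_measurable_continuous_onI[OF cont(1)] in simp)
      then show "(\<lambda>x. u x * frechet_derivative \<phi> (at x) e) \<in> borel_measurable lebesgue"
        by (intro borel_measurable_times um)
      show "(\<lambda>x. V x * frechet_derivative \<phi> (at x) e) \<in> borel_measurable lebesgue" by (rule measurable_completion[OF m])
    qed (use u in \<open>auto simp: V_def elim!: eventually_mono\<close>)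
    ultimately show "(LINT x|lebesgue. u x * frechet_derivative \<phi> (at x) e) = - (LBINT x. (G x \<bullet> e) * \<phi> x)"
      by (simp add: integral_completion)
  qed
  moreover have "AE x in lebesgue. x \<noteq> (0::'a)" by (rule AE_completion[OF AE_lborel_singleton])
  ultimately show ?thesis by eventually_elim (auto simp: G_def)
qed

lemma radial_solution_regular:
  fixes u :: "'a::euclidean_space \<Rightarrow> real"
  assumes "1 < p" "1 \<le> q" "1 < b" "continuous_on UNIV f" and sol: "weak_radial_solution a p q b f u"
  obtains W K where "AE x in lebesgue. u x = W (norm x)"
    "\<And>r. r > 0 \<Longrightarrow> (W has_real_derivative r powr - (real DIM('a) - 1) * K r) (at r)"
    "\<And>r. r > 0 \<Longrightarrow> (K has_real_derivative
      r powr (real DIM('a) - 1) * (Phi a p q b u r * \<bar>W r\<bar> powr (p - 2) * W r - f (W r))) (at r)"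
    "AE x in lebesgue. weak_grad u x = (norm x powr - (real DIM('a) - 1) * K (norm x) / norm x) *\<^sub>R x"
proof -
  have u: "u \<in> E_rad p q b" using sol by (simp add: weak_radial_solution_def)
  then have wg: "is_weak_grad u (weak_grad u)"
    by (intro is_weak_grad_weak_grad) (simp add: E_rad_def E_space_def)
  then have m: "u \<in> borel_measurable lebesgue" "weak_grad u \<in> borel_measurable lebesgue"
    by (auto simp: is_weak_grad_def intro: locally_integrable_measurable)
  obtain w where w: "w \<in> borel_measurable borel" "AE x in lebesgue. u x = w (norm x)"
    using radially_symmetric_borel_profile[OF m(1)] u by (auto simp: E_rad_def)
  have [measurable]: "(\<lambda>x::'a. x) \<in> borel_measurable lebesgue" "(\<lambda>x::'a. norm x powr - real DIM('a)) \<in> borel_measurable lebesgue"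
    by (rule measurable_completion, measurable)+
  have "(\<lambda>x. (weak_grad u x \<bullet> x) * norm x powr (- real DIM('a))) \<in> borel_measurable lebesgue"
    by (intro borel_measurable_times borel_measurable_inner m) measurable
  then obtain j where j: "j \<in> borel_measurable borel" "AE x in lborel. (weak_grad u x \<bullet> x) * norm x powr (- real DIM('a)) = j x"
    using completion_ex_borel_measurable_real[of _ lborel] by fastforce
  have "AE x in lebesgue. j x = (weak_grad u x \<bullet> x) * norm x powr (- real DIM('a))"
    using AE_completion[OF j(2)] by eventually_elim simp
  then interpret radial_solution a p q b f u w j
    by unfold_locales (use assms w j in auto)
  obtain W K where WK: "AE x in lebesgue. u x = W (norm x)"
    "\<And>r. r > 0 \<Longrightarrow> (W has_real_derivative r powr - (real DIM('a) - 1) * K r) (at r)"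
    "\<And>r. r > 0 \<Longrightarrow> (K has_real_derivative
      r powr (real DIM('a) - 1) * (Phi a p q b u r * \<bar>W r\<bar> powr (p - 2) * W r - f (W r))) (at r)"
    using profile_ode by blast
  have "continuous_on {0<..} K"
    using WK(3) by (intro continuous_at_imp_continuous_on ballI DERIV_isCont) auto
  then have "continuous_on {0<..} (\<lambda>r. r powr - (real DIM('a) - 1) * K r)"
    by (intro continuous_intros) auto
  from radial_C1_weak_grad[OF wg WK(1,2) this] WK that show ?thesis by blast
qed

section \<open>Integrability of the radial profile\<close>

text \<open>The comparison is made with gauge integrals: there the fundamental theorem applies to B'
  as it stands, so neither continuity nor Lebesgue integrability of B' has to be checked.\<close>

lemma integral_le_derivative_bound:
  fixes B :: "real \<Rightarrow> real"
  assumes "s \<le> t" and B: "\<And>r. r \<in> {s..t} \<Longrightarrow> (B has_real_derivative B' r) (at r)"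
    and F: "set_integrable lborel {s..t} F" and H: "set_integrable lborel {s..t} H"
    and le: "\<And>r. r \<in> {s..t} \<Longrightarrow> F r \<le> B' r + H r"
  shows "(LBINT r:{s..t}. F r) \<le> B t - B s + (LBINT r:{s..t}. H r)"
proof -
  have B': "(B' has_integral (B t - B s)) {s..t}"
    using B by (intro fundamental_theorem_of_calculus assms(1))
      (auto simp: has_real_derivative_iff_has_vector_derivative[symmetric] intro: DERIV_subset)
  note F' = set_borel_integral_eq_integral[OF F] and H' = set_borel_integral_eq_integral[OF H]
  have "integral {s..t} F \<le> B t - B s + integral {s..t} H"
    by (rule has_integral_le[OF integrable_integral[OF F'(1)] has_integral_add[OF B' integrable_integral[OF H'(1)]] le])
  then show ?thesis using F'(2) H'(2) by simp
qed

lemma abs_diff_le_integral: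
  fixes B :: "real \<Rightarrow> real"
  assumes "s \<le> t" and B: "\<And>r. r \<in> {s..t} \<Longrightarrow> (B has_real_derivative B' r) (at r)"
    and H: "set_integrable lborel {s..t} H" and le: "\<And>r. r \<in> {s..t} \<Longrightarrow> \<bar>B' r\<bar> \<le> H r"
  shows "\<bar>B t - B s\<bar> \<le> (LBINT r:{s..t}. H r)"
proof -
  have z: "set_integrable lborel {s..t} (\<lambda>r. 0::real)" by (simp add: set_integrable_def)
  have "0 \<le> B t - B s + (LBINT r:{s..t}. H r)"
    using integral_le_derivative_bound[OF assms(1) B z H] le by (force simp: abs_le_iff)
  moreover have "0 \<le> - B t - (- B s) + (LBINT r:{s..t}. H r)"
    using integral_le_derivative_bound[OF assms(1) DERIV_minus[OF B] z H] le by (force simp: abs_le_iff)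
  ultimately show ?thesis by (simp add: abs_le_iff)
qed

text \<open>On each interval of the exhaustion the integral of F is at most 2 M plus the integral of
  H, as B changes by at most 2 M; monotone convergence passes the bound to S.\<close>

lemma set_integrable_by_derivative_bound:
  fixes F B :: "real \<Rightarrow> real"
  assumes st: "decseq s" "incseq t" "\<And>n::nat. 0 < s n" "\<And>n. s n \<le> t n" and S: "S = (\<Union>n. {s n..t n})"
    and F: "continuous_on {0<..} F" "\<And>r. r \<in> S \<Longrightarrow> 0 \<le> F r"
    and B: "\<And>r. r > 0 \<Longrightarrow> (B has_real_derivative B' r) (at r)" "\<And>r. r \<in> S \<Longrightarrow> \<bar>B r\<bar> \<le> M"
    and H: "set_integrable lborel S H" "\<And>r. r \<in> S \<Longrightarrow> 0 \<le> H r"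
    and le: "\<And>r. r \<in> S \<Longrightarrow> F r \<le> B' r + H r"
  shows "set_integrable lborel S F"
proof -
  have meas: "S \<in> sets borel" unfolding S by auto
  have sub: "{s n..t n} \<subseteq> S" for n unfolding S by auto
  have sF: "set_integrable lborel {s n..t n} F" for n
    by (rule set_integrable_continuous_pos[OF F(1) st(3)])
  have sH: "set_integrable lborel {s n..t n} H" for n
    by (rule set_integrable_subset[OF H(1) _ sub]) simp
  define F0 where "F0 r = (if 0 < r then F r else 0)" for r
  have [measurable]: "F0 \<in> borel_measurable borel" unfolding F0_def by (rule borel_measurable_restrict_pos[OF F(1)])
  have SF0: "F0 r = F r" "r > 0" if "r \<in> S" for r
    using that st(3) by (auto simp: S F0_def intro: less_le_trans)
  have bound: "(LBINT r:{s n..t n}. F r) \<le> 2 * M + (LBINT r:S. H r)" for n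
  proof -
    have pos: "r > 0" if "r \<in> {s n..t n}" for r using that sub[of n] SF0(2) by auto
    have "(LBINT r:{s n..t n}. F r) \<le> B (t n) - B (s n) + (LBINT r:{s n..t n}. H r)"
      by (rule integral_le_derivative_bound[OF st(4) B(1) sF sH le]) (use pos sub[of n] in auto)
    moreover have "(LBINT r:{s n..t n}. H r) \<le> (LBINT r:S. H r)"
      unfolding set_lebesgue_integral_def
      using sH[of n] H sub[of n] by (intro integral_mono) (auto simp: set_integrable_def split: split_indicator)
    moreover have "\<bar>B (t n)\<bar> \<le> M" "\<bar>B (s n)\<bar> \<le> M" using B(2) sub[of n] st(4)[of n] by auto
    ultimately show ?thesis by linarith
  qed
  have lim: "(\<lambda>n. \<integral>\<^sup>+r. ennreal (F0 r * indicator {s n..t n} r) \<partial>lborel) \<longlonglongrightarrow> (\<integral>\<^sup>+r. ennreal (F0 r * indicator S r) \<partial>lborel)"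
  proof (rule nn_integral_LIMSEQ)
    show "incseq (\<lambda>n r. ennreal (F0 r * indicator {s n..t n} r))"
    proof (intro monoI le_funI)
      fix m n :: nat and r assume "m \<le> n"
      then have "s n \<le> s m" "t m \<le> t n" using st(1,2) by (auto simp: decseq_def incseq_def)
      moreover have "0 \<le> F0 r" if "r \<in> {s n..t n}" using sub[of n] that SF0[of r] F(2)[of r] by auto
      ultimately show "ennreal (F0 r * indicator {s m..t m} r) \<le> ennreal (F0 r * indicator {s n..t n} r)"
        by (intro ennreal_leI) (auto split: split_indicator)
    qed
    fix r show "(\<lambda>n. ennreal (F0 r * indicator {s n..t n} r)) \<longlonglongrightarrow> ennreal (F0 r * indicator S r)"
    proof (cases "r \<in> S")
      case True
      then obtain m where m: "r \<in> {s m..t m}" by (auto simp: S)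
      have "r \<in> {s n..t n}" if "n \<ge> m" for n
        using m that decseqD[OF st(1) that] incseqD[OF st(2) that] by auto
      then have "eventually (\<lambda>n. ennreal (F0 r * indicator {s n..t n} r) = ennreal (F0 r * indicator S r)) sequentially"
        using True by (auto intro!: eventually_sequentiallyI[of m])
      then show ?thesis by (rule tendsto_eventually)
    next
      case False
      then have "r \<notin> {s n..t n}" for n using sub[of n] by auto
      then show ?thesis using False by simp
    qed
  qed auto
  have le: "(\<integral>\<^sup>+r. ennreal (F0 r * indicator {s n..t n} r) \<partial>lborel) \<le> ennreal (2 * M + (LBINT r:S. H r))" for n
  proof -
    have eq: "F0 r * indicator {s n..t n} r = indicator {s n..t n} r *\<^sub>R F r" for r
      using sub[of n] SF0 by (auto split: split_indicator)
    have "(\<integral>\<^sup>+r. ennreal (F0 r * indicator {s n..t n} r) \<partial>lborel) = ennreal (LBINT r:{s n..t n}. F r)"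
      unfolding eq set_lebesgue_integral_def using sF[of n] sub[of n] F(2)
      by (intro nn_integral_eq_integral AE_I2) (auto simp: set_integrable_def split: split_indicator)
    then show ?thesis using bound[of n] by (simp add: ennreal_leI)
  qed
  have "(\<integral>\<^sup>+r. ennreal (F0 r * indicator S r) \<partial>lborel) \<le> ennreal (2 * M + (LBINT r:S. H r))"
    by (rule LIMSEQ_le_const2[OF lim]) (use le in auto)
  then have "(\<integral>\<^sup>+r. ennreal (F0 r * indicator S r) \<partial>lborel) < \<infinity>"
    by (rule le_less_trans) simp
  then have "integrable lborel (\<lambda>r. F0 r * indicator S r)"
    using meas SF0 F(2) by (intro integrableI_nonneg) (auto split: split_indicator)
  also have "(\<lambda>r. F0 r * indicator S r) = (\<lambda>r. indicator S r *\<^sub>R F r)"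
    using SF0 by (auto split: split_indicator)
  finally show ?thesis by (simp add: set_integrable_def)
qed

lemma set_integrable_by_derivative_bound_at_top:
  fixes F B :: "real \<Rightarrow> real"
  assumes "continuous_on {0<..} F" "\<And>r. 1 \<le> r \<Longrightarrow> 0 \<le> F r"
    and "\<And>r. r > 0 \<Longrightarrow> (B has_real_derivative B' r) (at r)" "\<And>r. 1 \<le> r \<Longrightarrow> \<bar>B r\<bar> \<le> M"
    and "\<And>r. 1 \<le> r \<Longrightarrow> F r \<le> B' r"
  shows "set_integrable lborel {1..} F"
proof (rule set_integrable_by_derivative_bound[where s="\<lambda>_. 1" and t="\<lambda>n. 1 + real n" and H="\<lambda>_. 0" and B=B and B'=B' and M=M])
  show "{1..} = (\<Union>n::nat. {1..1 + real n})"
  proof (intro equalityI subsetI)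
    fix x :: real assume x: "x \<in> {1..}"
    obtain n :: nat where "x \<le> real n" using real_arch_simple by blast
    then show "x \<in> (\<Union>n::nat. {1..1 + real n})" using x by (intro UN_I[of n]) auto
  qed auto
qed (use assms in \<open>auto simp: decseq_def incseq_def set_integrable_def\<close>)

lemma set_integrable_by_derivative_bound_at_0:
  fixes F B :: "real \<Rightarrow> real"
  assumes "continuous_on {0<..} F" "\<And>r. 0 < r \<Longrightarrow> r \<le> 1 \<Longrightarrow> 0 \<le> F r"
    and "\<And>r. r > 0 \<Longrightarrow> (B has_real_derivative B' r) (at r)" "\<And>r. 0 < r \<Longrightarrow> r \<le> 1 \<Longrightarrow> \<bar>B r\<bar> \<le> M"
    and "set_integrable lborel {0<..1} H" "\<And>r. 0 < r \<Longrightarrow> 0 \<le> H r"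
    and "\<And>r. 0 < r \<Longrightarrow> r \<le> 1 \<Longrightarrow> F r \<le> B' r + H r"
  shows "set_integrable lborel {0<..1} F"
proof (rule set_integrable_by_derivative_bound[where s="\<lambda>n. inverse (real (Suc n))" and t="\<lambda>_. 1" and H=H and B=B and B'=B' and M=M])
  show "{0<..1} = (\<Union>n::nat. {inverse (real (Suc n))..1})"
  proof (intro equalityI subsetI)
    fix x :: real assume x: "x \<in> {0<..1}"
    then obtain n :: nat where "inverse (real (Suc n)) < x" using reals_Archimedean by auto
    then show "x \<in> (\<Union>n::nat. {inverse (real (Suc n))..1})" using x by (intro UN_I[of n]) auto
  next
    fix x :: real assume "x \<in> (\<Union>n::nat. {inverse (real (Suc n))..1})"
    then obtain n :: nat where n: "inverse (real (Suc n)) \<le> x" "x \<le> 1" by auto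
    have "0 < inverse (real (Suc n))" by simp
    then have "0 < x" using n by linarith
    then show "x \<in> {0<..1}" using n by simp
  qed
  show "decseq (\<lambda>n. inverse (real (Suc n)))" by (auto simp: decseq_def field_simps)
  show "inverse (real (Suc n)) \<le> 1" for n by (simp add: field_simps)
qed (use assms in auto)

text \<open>At t = 0 the quotient has absolute value |h|^(\<kappa>-1), which tends to 0 since
  \<kappa> > 1. Written as |t|^(\<kappa>-2) t, the derivative takes the right value 0 there even for
  \<kappa> < 2.\<close>

lemma has_real_derivative_abs_powr:
  assumes "1 < \<kappa>"
  shows "((\<lambda>t::real. \<bar>t\<bar> powr \<kappa>) has_real_derivative \<kappa> * (\<bar>t\<bar> powr (\<kappa> - 2) * t)) (at t)"
proof -
  consider "t > 0" | "t < 0" | "t = 0" by linarith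
  then show ?thesis
  proof cases
    case 1
    have "((\<lambda>t. t powr \<kappa>) has_real_derivative \<kappa> * (\<bar>t\<bar> powr (\<kappa> - 2) * t)) (at t)"
      using 1 by (auto intro!: derivative_eq_intros simp: powr_diff power2_eq_square field_simps)
    then show ?thesis
      by (rule has_field_derivative_transform_within_open[where S="{0<..}"]) (use 1 in auto)
  next
    case 2
    have "((\<lambda>t. (- t) powr \<kappa>) has_real_derivative \<kappa> * (\<bar>t\<bar> powr (\<kappa> - 2) * t)) (at t)"
      using 2 by (auto intro!: derivative_eq_intros simp: powr_diff power2_eq_square field_simps)
    then show ?thesis
      by (rule has_field_derivative_transform_within_open[where S="{..<0}"]) (use 2 in auto)
  next
    case 3
    have "((\<lambda>h::real. \<bar>h\<bar> powr (\<kappa> - 1)) \<longlongrightarrow> 0) (at 0)" using assms by (intro abs_powr_tendsto_0) simp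
    then have "((\<lambda>h::real. \<bar>h\<bar> powr \<kappa> / h) \<longlongrightarrow> 0) (at 0)"
      by (rule Lim_null_comparison[rotated])
        (auto simp: eventually_at_filter powr_diff abs_divide)
    then show ?thesis using 3 by (simp add: DERIV_def)
  qed
qed

text \<open>Comparison with c / r, whose primitive c ln r is unbounded. It serves to show that an
  integrable quantity cannot stay away from 0 at logarithmic scale.\<close>

lemma not_integrable_inverse_at_top:
  fixes F :: "real \<Rightarrow> real"
  assumes "c > 0" "1 \<le> T" "\<And>r. T \<le> r \<Longrightarrow> c \<le> r * F r"
  shows "\<not> set_integrable lborel {1..} F"
proof
  assume F: "set_integrable lborel {1..} F"
  define I where "I = (LBINT r:{T..}. \<bar>F r\<bar>)"
  have FT: "set_integrable lborel {T..} (\<lambda>r. \<bar>F r\<bar>)"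
    using set_integrable_abs[OF set_integrable_subset[OF F, of "{T..}"]] assms(2) by auto
  have "c * (ln t - ln T) \<le> I" if t: "T \<le> t" for t
  proof -
    have cont: "continuous_on {0<..} (\<lambda>r. c / r)" by (intro continuous_intros) auto
    have sF: "set_integrable lborel {T..t} (\<lambda>r. \<bar>F r\<bar>)" by (rule set_integrable_subset[OF FT]) auto
    have z: "set_integrable lborel {T..t} (\<lambda>r. 0::real)" by (simp add: set_integrable_def)
    have "((\<lambda>r. - c * ln r) has_real_derivative - (c / r)) (at r)" if "r \<in> {T..t}" for r
      using that assms(2) by (auto intro!: derivative_eq_intros)
    moreover have "0 \<le> - (c / r) + \<bar>F r\<bar>" if "r \<in> {T..t}" for r
    proof -
      have "r > 0" "c \<le> r * F r" using that assms by auto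
      then have "c / r \<le> F r" by (simp add: field_simps)
      then show ?thesis by linarith
    qed
    ultimately have "(LBINT r:{T..t}. 0) \<le> (- c * ln t) - (- c * ln T) + (LBINT r:{T..t}. \<bar>F r\<bar>)"
      by (rule integral_le_derivative_bound[OF t _ z sF])
    then have "c * (ln t - ln T) \<le> (LBINT r:{T..t}. \<bar>F r\<bar>)"
      by (simp add: algebra_simps)
    also have "\<dots> \<le> I" unfolding I_def set_lebesgue_integral_def
      using sF FT by (intro integral_mono) (auto simp: set_integrable_def split: split_indicator)
    finally show ?thesis .
  qed
  \<comment> \<open>At this point c (ln t - ln T) equals |I| + 1, which contradicts the bound
    I.\<close>
  moreover have "T \<le> exp (ln T + (\<bar>I\<bar> + 1) / c)"
  proof -
    have "exp (ln T) \<le> exp (ln T + (\<bar>I\<bar> + 1) / c)" using assms(1) by simp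
    then show ?thesis using assms(2) by simp
  qed
  ultimately have "c * (ln (exp (ln T + (\<bar>I\<bar> + 1) / c)) - ln T) \<le> I" by blast
  then have "c * ((\<bar>I\<bar> + 1) / c) \<le> I" by simp
  then show False using assms(1) by simp
qed

lemma not_integrable_inverse_at_0:
  fixes F :: "real \<Rightarrow> real"
  assumes "c > 0" "0 < T" "T \<le> 1" "\<And>r. 0 < r \<Longrightarrow> r \<le> T \<Longrightarrow> c \<le> r * F r"
  shows "\<not> set_integrable lborel {0<..1} F"
proof
  assume F: "set_integrable lborel {0<..1} F"
  define I where "I = (LBINT r:{0<..T}. \<bar>F r\<bar>)"
  have FT: "set_integrable lborel {0<..T} (\<lambda>r. \<bar>F r\<bar>)"
    by (rule set_integrable_abs, rule set_integrable_subset[OF F]) (use assms(3) in auto)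
  have "c * (ln T - ln t) \<le> I" if t: "0 < t" "t \<le> T" for t
  proof -
    have sF: "set_integrable lborel {t..T} (\<lambda>r. \<bar>F r\<bar>)" by (rule set_integrable_subset[OF FT]) (use t in auto)
    have z: "set_integrable lborel {t..T} (\<lambda>r. 0::real)" by (simp add: set_integrable_def)
    have "((\<lambda>r. - c * ln r) has_real_derivative - (c / r)) (at r)" if "r \<in> {t..T}" for r
      using that t by (auto intro!: derivative_eq_intros)
    moreover have "0 \<le> - (c / r) + \<bar>F r\<bar>" if "r \<in> {t..T}" for r
    proof -
      have "r > 0" "c \<le> r * F r" using that assms t by auto
      then have "c / r \<le> F r" by (simp add: field_simps)
      then show ?thesis by linarith
    qed
    ultimately have "(LBINT r:{t..T}. 0) \<le> (- c * ln T) - (- c * ln t) + (LBINT r:{t..T}. \<bar>F r\<bar>)"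
      by (rule integral_le_derivative_bound[OF t(2) _ z sF])
    then have "c * (ln T - ln t) \<le> (LBINT r:{t..T}. \<bar>F r\<bar>)"
      by (simp add: algebra_simps)
    also have "\<dots> \<le> I" unfolding I_def set_lebesgue_integral_def
      using sF FT t by (intro integral_mono) (auto simp: set_integrable_def split: split_indicator)
    finally show ?thesis .
  qed
  moreover have "exp (ln T - (\<bar>I\<bar> + 1) / c) \<le> T"
  proof -
    have "exp (ln T - (\<bar>I\<bar> + 1) / c) \<le> exp (ln T)" using assms(1) by simp
    then show ?thesis using assms(2) by simp
  qed
  ultimately have "c * (ln T - ln (exp (ln T - (\<bar>I\<bar> + 1) / c))) \<le> I" using exp_gt_zero by blast
  then have "c * ((\<bar>I\<bar> + 1) / c) \<le> I" by simp
  then show False using assms(1) by simp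
qed

lemma set_integrable_bound_continuous:
  fixes F :: "real \<Rightarrow> real"
  assumes "continuous_on {0<..} F" "S \<in> sets borel" "S \<subseteq> {0<..}" "set_integrable lborel S H" "\<And>r. r \<in> S \<Longrightarrow> \<bar>F r\<bar> \<le> H r"
  shows "set_integrable lborel S F"
proof -
  have [measurable]: "(\<lambda>r. if 0 < r then F r else 0) \<in> borel_measurable borel" "S \<in> sets borel"
    by (rule borel_measurable_restrict_pos[OF assms(1)] assms(2))+
  have "integrable lborel (\<lambda>r. indicator S r *\<^sub>R (if 0 < r then F r else 0))"
    using assms(4) unfolding set_integrable_def
    by (rule Bochner_Integration.integrable_bound)
      (use assms(3,5) in \<open>auto split: split_indicator intro: order_trans[OF _ abs_ge_self]\<close>)
  also have "(\<lambda>r. indicator S r *\<^sub>R (if 0 < r then F r else 0)) = (\<lambda>r. indicator S r *\<^sub>R F r)"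
    using assms(3) by (auto simp: fun_eq_iff indicator_def subset_iff)
  finally show ?thesis by (simp add: set_integrable_def)
qed

lemma continuous_on_abs_powr:
  "0 < s \<Longrightarrow> continuous_on A W \<Longrightarrow> continuous_on A (\<lambda>r. \<bar>W r :: real\<bar> powr s)"
  by (intro continuous_on_powr' continuous_on_rabs continuous_on_const) auto

section \<open>Decay, growth and embeddings for profiles of finite Dirichlet energy\<close>

locale radial_profile =
  fixes W W1 :: "real \<Rightarrow> real" and n :: real
  assumes n: "2 \<le> n"
    and W: "\<And>r. r > 0 \<Longrightarrow> (W has_real_derivative W1 r) (at r)"
    and W1: "continuous_on {0<..} W1"
    and D: "set_integrable lborel {0<..} (\<lambda>r. r powr (n - 1) * (W1 r)\<^sup>2)"
begin

lemma W_continuous: "continuous_on {0<..} W"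
  using W by (intro continuous_at_imp_continuous_on ballI DERIV_isCont) auto

lemma power_continuous: "0 < s \<Longrightarrow> continuous_on {0<..} (\<lambda>r. r powr m * \<bar>W r\<bar> powr s)"
  by (intro continuous_intros continuous_on_abs_powr W_continuous) auto

lemma D_sub: "S \<in> sets borel \<Longrightarrow> S \<subseteq> {0<..} \<Longrightarrow> set_integrable lborel S (\<lambda>r. r powr (n - 1) * (W1 r)\<^sup>2)"
  by (rule set_integrable_subset[OF D]) auto

text \<open>The derivative of r^(-\<gamma>) h is the wanted integrand minus \<gamma> r^(-\<gamma>-1)
  h. The loss is at most \<gamma> Kh r^(\<nu>-\<gamma>-1), which is the derivative of the second
  term of B; since \<nu> < \<gamma>, B is bounded on [1, \<infinity>).\<close>

lemma weighted_mass_integrable: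
  assumes "0 < p" "0 < \<omega>" "0 < \<nu>" "\<nu> < \<gamma>"
    and h: "\<And>r. r > 0 \<Longrightarrow> (h has_real_derivative \<omega> * (r powr (n - 1) * \<bar>W r\<bar> powr p)) (at r)"
    and h_bound: "\<And>r. 1 \<le> r \<Longrightarrow> 0 \<le> h r" "\<And>r. 1 \<le> r \<Longrightarrow> h r \<le> Kh * r powr \<nu>"
  shows "set_integrable lborel {1..} (\<lambda>r. r powr (n - 1 - \<gamma>) * \<bar>W r\<bar> powr p)"
proof -
  define B where "B r = r powr (- \<gamma>) * h r - \<gamma> * Kh / (\<gamma> - \<nu>) * r powr (\<nu> - \<gamma>)" for r
  define B' where "B' r = (r powr (- \<gamma>) * (\<omega> * (r powr (n - 1) * \<bar>W r\<bar> powr p)) + (- \<gamma> * r powr (- \<gamma> - 1)) * h r)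
      + \<gamma> * Kh * r powr (\<nu> - \<gamma> - 1)" for r
  have Kh: "0 \<le> Kh" using h_bound(1)[of 1] h_bound(2)[of 1] by simp
  have "set_integrable lborel {1..} (\<lambda>r. \<omega> * (r powr (n - 1 - \<gamma>) * \<bar>W r\<bar> powr p))"
  proof (rule set_integrable_by_derivative_bound_at_top[where B=B and B'=B' and M="Kh + \<gamma> * Kh / (\<gamma> - \<nu>)"])
    show "continuous_on {0<..} (\<lambda>r. \<omega> * (r powr (n - 1 - \<gamma>) * \<bar>W r\<bar> powr p))"
      by (intro continuous_on_mult continuous_on_const power_continuous assms)
    show "(B has_real_derivative B' r) (at r)" if "r > 0" for r
      unfolding B_def B'_def
      by (rule derivative_eq_intros h that refl | use that assms in \<open>simp add: field_simps\<close>)+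
    fix r :: real assume r: "1 \<le> r"
    show "0 \<le> \<omega> * (r powr (n - 1 - \<gamma>) * \<bar>W r\<bar> powr p)" using assms(2) by simp
    have le1: "r powr (\<nu> - \<gamma>) \<le> 1"
      using powr_mono[of "\<nu> - \<gamma>" 0 r] r assms by simp
    have "r powr (- \<gamma>) * h r \<le> r powr (- \<gamma>) * (Kh * r powr \<nu>)"
      using h_bound[OF r] by (intro mult_left_mono) auto
    also have "\<dots> = Kh * r powr (\<nu> - \<gamma>)" using r by (simp add: powr_diff powr_minus field_simps)
    also have "\<dots> \<le> Kh" using mult_left_mono[OF le1 Kh] by simp
    finally have "r powr (- \<gamma>) * h r \<le> Kh" .
    moreover have "0 \<le> r powr (- \<gamma>) * h r" using h_bound[OF r] by simp
    moreover have "0 \<le> \<gamma> * Kh / (\<gamma> - \<nu>) * r powr (\<nu> - \<gamma>)" using Kh assms by simp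
    moreover have "\<gamma> * Kh / (\<gamma> - \<nu>) * r powr (\<nu> - \<gamma>) \<le> \<gamma> * Kh / (\<gamma> - \<nu>)"
      using mult_left_mono[OF le1, of "\<gamma> * Kh / (\<gamma> - \<nu>)"] Kh assms by simp
    ultimately show "\<bar>B r\<bar> \<le> Kh + \<gamma> * Kh / (\<gamma> - \<nu>)" using Kh unfolding B_def by (auto simp: abs_le_iff)
    have "\<gamma> * r powr (- \<gamma> - 1) * h r \<le> \<gamma> * r powr (- \<gamma> - 1) * (Kh * r powr \<nu>)"
      using h_bound[OF r] assms by (intro mult_left_mono) auto
    also have "\<dots> = \<gamma> * Kh * (r powr (- \<gamma> - 1) * r powr \<nu>)" by simp
    also have "r powr (- \<gamma> - 1) * r powr \<nu> = r powr (\<nu> - \<gamma> - 1)"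
      unfolding powr_add[symmetric] by (rule arg_cong[where f="\<lambda>x. r powr x"]) simp
    finally have le: "\<gamma> * r powr (- \<gamma> - 1) * h r \<le> \<gamma> * Kh * r powr (\<nu> - \<gamma> - 1)" .
    have eq: "r powr (n - 1 - \<gamma>) = r powr (- \<gamma>) * r powr (n - 1)"
      unfolding powr_add[symmetric] by (rule arg_cong[where f="\<lambda>x. r powr x"]) simp
    show "\<omega> * (r powr (n - 1 - \<gamma>) * \<bar>W r\<bar> powr p) \<le> B' r"
      using le unfolding B'_def eq by (simp add: algebra_simps)
  qed
  then have "set_integrable lborel {1..} (\<lambda>r. inverse \<omega> * (\<omega> * (r powr (n - 1 - \<gamma>) * \<bar>W r\<bar> powr p)))"
    by (rule set_integrable_mult_right)
  then show ?thesis using assms(2) by (simp add: mult.assoc[symmetric])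
qed

text \<open>The power p/2 + 1 makes the derivative of |W|^(p/2+1) a multiple of |W|^(p/2) |W'|, the
  geometric mean of the mass and energy integrands up to the factor r^(-(n-1-\<gamma>/2)).
  Integrating out to points where W is arbitrarily small gives the decay.\<close>

lemma decay_at_infinity:
  assumes "0 < p" "\<gamma> \<le> n"
    and mass: "set_integrable lborel {1..} (\<lambda>r. r powr (n - 1 - \<gamma>) * \<bar>W r\<bar> powr p)"
  obtains C where "C \<ge> 0" "\<And>R. 1 \<le> R \<Longrightarrow> \<bar>W R\<bar> powr (p / 2 + 1) \<le> C * R powr (- (n - 1 - \<gamma> / 2))"
proof -
  define H where "H r = r powr (n - 1 - \<gamma>) * \<bar>W r\<bar> powr p + r powr (n - 1) * (W1 r)\<^sup>2" for r
  define I where "I = (LBINT r:{1..}. H r)"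
  define \<kappa> where "\<kappa> = p / 2 + 1"
  define e where "e = n - 1 - \<gamma> / 2"
  have \<kappa>: "1 < \<kappa>" using assms by (simp add: \<kappa>_def)
  have e: "0 \<le> e" using assms n by (simp add: e_def)
  have H: "set_integrable lborel {1..} H" unfolding H_def by (intro set_integral_add mass D_sub) auto
  have Hn: "0 \<le> H r" for r by (simp add: H_def)
  have I: "0 \<le> I" unfolding I_def set_lebesgue_integral_def using Hn by (intro Bochner_Integration.integral_nonneg) auto
  have step: "\<bar>\<bar>W T\<bar> powr \<kappa> - \<bar>W R\<bar> powr \<kappa>\<bar> \<le> \<kappa> / 2 * R powr (- e) * I" if RT: "1 \<le> R" "R \<le> T" for R T
  proof -
    have sH: "set_integrable lborel {R..T} H" by (rule set_integrable_subset[OF H]) (use RT in auto)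
    have "\<bar>\<bar>W T\<bar> powr \<kappa> - \<bar>W R\<bar> powr \<kappa>\<bar> \<le> (LBINT r:{R..T}. \<kappa> / 2 * R powr (- e) * H r)"
    proof (rule abs_diff_le_integral[OF RT(2)])
      show "((\<lambda>r. \<bar>W r\<bar> powr \<kappa>) has_real_derivative \<kappa> * (\<bar>W r\<bar> powr (\<kappa> - 2) * W r) * W1 r) (at r)" if "r \<in> {R..T}" for r
        using DERIV_chain2[OF has_real_derivative_abs_powr[OF \<kappa>] W, of r] that RT by simp
      show "set_integrable lborel {R..T} (\<lambda>r. \<kappa> / 2 * R powr (- e) * H r)"
        by (rule set_integrable_mult_right[OF sH])
      fix r assume r: "r \<in> {R..T}"
      then have rpos: "0 < r" "R \<le> r" "0 < R" using RT by auto
      \<comment> \<open>X^2 and Y^2 are the two summands of H, and X Y carries the weight r^e;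
        Young's inequality bounds the product by H / 2.\<close>
      define X where "X = r powr ((n - 1 - \<gamma>) / 2) * \<bar>W r\<bar> powr (p / 2)"
      define Y where "Y = r powr ((n - 1) / 2) * \<bar>W1 r\<bar>"
      have "X\<^sup>2 + Y\<^sup>2 = H r"
        using rpos by (simp add: X_def Y_def H_def power_mult_distrib power2_eq_square[of "_ powr _"] powr_add[symmetric])
      moreover have "2 * (X * Y) \<le> X\<^sup>2 + Y\<^sup>2" using sum_squares_bound[of X Y] by simp
      ultimately have XY: "X * Y \<le> H r / 2" by simp
      have "X * Y = r powr e * (\<bar>W r\<bar> powr (p / 2) * \<bar>W1 r\<bar>)"
      proof -
        have "r powr e = r powr ((n - 1 - \<gamma>) / 2) * r powr ((n - 1) / 2)"
          unfolding powr_add[symmetric] by (rule arg_cong[where f="\<lambda>x. r powr x"]) (simp add: e_def field_simps)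
        then show ?thesis by (simp add: X_def Y_def)
      qed
      then have "\<bar>W r\<bar> powr (p / 2) * \<bar>W1 r\<bar> = r powr (- e) * (X * Y)"
        using rpos by (simp add: powr_minus field_simps)
      also have "\<dots> \<le> R powr (- e) * (H r / 2)"
        using rpos e XY by (intro mult_mono powr_mono2') (auto simp: X_def Y_def)
      finally have "\<bar>W r\<bar> powr (p / 2) * \<bar>W1 r\<bar> \<le> R powr (- e) * (H r / 2)" .
      then have "\<kappa> * (\<bar>W r\<bar> powr (p / 2) * \<bar>W1 r\<bar>) \<le> \<kappa> * (R powr (- e) * (H r / 2))"
        using \<kappa> by (intro mult_left_mono) auto
      moreover have "\<bar>\<kappa> * (\<bar>W r\<bar> powr (\<kappa> - 2) * W r) * W1 r\<bar> = \<kappa> * (\<bar>W r\<bar> powr (p / 2) * \<bar>W1 r\<bar>)"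
        using \<kappa> abs_powr_mult_self[of "W r" \<kappa>] by (simp only: abs_mult) (simp add: \<kappa>_def)
      ultimately show "\<bar>\<kappa> * (\<bar>W r\<bar> powr (\<kappa> - 2) * W r) * W1 r\<bar> \<le> \<kappa> / 2 * R powr (- e) * H r" by simp
    qed
    also have "\<dots> = \<kappa> / 2 * R powr (- e) * (LBINT r:{R..T}. H r)" by simp
    also have "\<dots> \<le> \<kappa> / 2 * R powr (- e) * I"
    proof (rule mult_left_mono)
      show "(LBINT r:{R..T}. H r) \<le> I" unfolding I_def set_lebesgue_integral_def
        using sH H RT Hn by (intro integral_mono) (auto simp: set_integrable_def split: split_indicator)
    qed (use \<kappa> in auto)
    finally show ?thesis .
  qed
  \<comment> \<open>As \<gamma> \<le> n, the weight r^(n-1-\<gamma>) is at least 1/r, so |W| staying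
    above \<epsilon> would make the weighted mass infinite.\<close>
  have small: "\<exists>T\<ge>R. \<bar>W T\<bar> < \<epsilon>" if "1 \<le> R" "0 < \<epsilon>" for R \<epsilon>
  proof (rule ccontr)
    assume "\<not> (\<exists>T\<ge>R. \<bar>W T\<bar> < \<epsilon>)"
    then have ge: "\<epsilon> \<le> \<bar>W T\<bar>" if "R \<le> T" for T using that by (meson not_less)
    have "\<epsilon> powr p \<le> r * (r powr (n - 1 - \<gamma>) * \<bar>W r\<bar> powr p)" if "R \<le> r" for r
    proof -
      have "1 * \<epsilon> powr p \<le> r powr (n - \<gamma>) * \<bar>W r\<bar> powr p"
        using that \<open>1 \<le> R\<close> \<open>0 < \<epsilon>\<close> assms(1,2) ge[OF that] powr_mono[of 0 "n - \<gamma>" r]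
        by (intro mult_mono powr_mono2) auto
      also have "r powr (n - \<gamma>) = r * r powr (n - 1 - \<gamma>)"
        using that \<open>1 \<le> R\<close> by (simp add: powr_diff)
      finally show ?thesis by (simp add: mult.assoc)
    qed
    then show False
      using not_integrable_inverse_at_top[of "\<epsilon> powr p" R "\<lambda>r. r powr (n - 1 - \<gamma>) * \<bar>W r\<bar> powr p"] that mass by auto
  qed
  show ?thesis
  proof (rule that[of "\<kappa> / 2 * I"])
    show "0 \<le> \<kappa> / 2 * I" using \<kappa> I by simp
    fix R :: real assume R: "1 \<le> R"
    have "\<bar>W R\<bar> powr \<kappa> \<le> \<kappa> / 2 * I * R powr (- e)"
    proof (rule field_le_epsilon)
      fix d :: real assume d: "0 < d"
      obtain T where T: "R \<le> T" "\<bar>W T\<bar> < d powr (1 / \<kappa>)" using small[OF R, of "d powr (1 / \<kappa>)"] d by auto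
      have "\<bar>W T\<bar> powr \<kappa> \<le> (d powr (1 / \<kappa>)) powr \<kappa>" using T \<kappa> by (intro powr_mono2) auto
      also have "\<dots> = d" using \<kappa> d by (simp add: powr_powr)
      finally have "\<bar>W T\<bar> powr \<kappa> \<le> d" .
      moreover have "\<kappa> / 2 * R powr (- e) * I = \<kappa> / 2 * I * R powr (- e)" by simp
      ultimately show "\<bar>W R\<bar> powr \<kappa> \<le> \<kappa> / 2 * I * R powr (- e) + d"
        using step[OF R T(1)] by linarith
    qed
    then show "\<bar>W R\<bar> powr (p / 2 + 1) \<le> \<kappa> / 2 * I * R powr (- (n - 1 - \<gamma> / 2))"
      by (simp add: \<kappa>_def e_def)
  qed
qed

text \<open>Split |W|^s = |W|^p |W|^(s-p): the decay rate bounds the second factor by a multiple of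
  r^(-\<gamma>), and what remains is the weighted mass.\<close>

lemma embedding_at_infinity:
  assumes "0 < p" "0 < \<omega>" "0 < \<nu>" "\<nu> < n"
    and h: "\<And>r. r > 0 \<Longrightarrow> (h has_real_derivative \<omega> * (r powr (n - 1) * \<bar>W r\<bar> powr p)) (at r)"
    and h_bound: "\<And>r. 1 \<le> r \<Longrightarrow> 0 \<le> h r" "\<And>r. 1 \<le> r \<Longrightarrow> h r \<le> Kh * r powr \<nu>"
    and s: "0 < s" "\<nu> * (s + 2) < 2 * (n - 1) * (s - p)"
  shows "set_integrable lborel {1..} (\<lambda>r. r powr (n - 1) * \<bar>W r\<bar> powr s)"
proof -
  \<comment> \<open>The largest \<gamma> for which (n-1-\<gamma>/2) (s-p) / (p/2+1) \<ge> \<gamma>.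
    The hypothesis on s says \<nu> < \<gamma>1, so a \<gamma> fits strictly between \<nu> and both n
    and \<gamma>1.\<close>
  define \<gamma>1 where "\<gamma>1 = 2 * (n - 1) * (s - p) / (s + 2)"
  have "\<nu> < \<gamma>1" using s by (simp add: \<gamma>1_def field_simps)
  define \<gamma> where "\<gamma> = (\<nu> + min n \<gamma>1) / 2"
  have \<gamma>: "\<nu> < \<gamma>" "\<gamma> < n" "\<gamma> < \<gamma>1" using assms(4) \<open>\<nu> < \<gamma>1\<close> by (auto simp: \<gamma>_def)
  have sp: "0 < s - p"
  proof -
    have "0 < \<nu> * (s + 2)" using assms by simp
    then have "0 < 2 * (n - 1) * (s - p)" using s by linarith
    then show ?thesis using n by (simp add: zero_less_mult_iff)
  qed
  have mass: "set_integrable lborel {1..} (\<lambda>r. r powr (n - 1 - \<gamma>) * \<bar>W r\<bar> powr p)"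
    by (rule weighted_mass_integrable[OF assms(1-3) \<gamma>(1) h h_bound])
  define \<kappa> where "\<kappa> = p / 2 + 1"
  define e where "e = n - 1 - \<gamma> / 2"
  obtain C where C: "C \<ge> 0" "\<And>R. 1 \<le> R \<Longrightarrow> \<bar>W R\<bar> powr \<kappa> \<le> C * R powr (- e)"
    using decay_at_infinity[OF assms(1) _ mass] \<gamma>(2) unfolding \<kappa>_def e_def by auto
  have \<kappa>: "0 < \<kappa>" using assms by (simp add: \<kappa>_def)
  have exponent: "\<gamma> \<le> e * ((s - p) / \<kappa>)"
  proof -
    have "\<gamma> * (s + 2) \<le> 2 * (n - 1) * (s - p)" using \<gamma>(3) s(1) by (simp add: \<gamma>1_def field_simps)
    moreover have "2 * (\<gamma> * \<kappa>) = \<gamma> * (p + 2)" by (simp add: \<kappa>_def algebra_simps)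
    moreover have "2 * (e * (s - p)) = (2 * (n - 1) - \<gamma>) * (s - p)"
      unfolding mult.assoc[symmetric] by (simp add: e_def algebra_simps)
    ultimately have "2 * (\<gamma> * \<kappa>) \<le> 2 * (e * (s - p))" by (simp add: algebra_simps)
    then have "\<gamma> * \<kappa> \<le> e * (s - p)" by simp
    then show ?thesis using \<kappa> by (simp add: field_simps)
  qed
  show ?thesis
  proof (rule set_integrable_bound_continuous[OF power_continuous[OF s(1)]])
    show "set_integrable lborel {1..} (\<lambda>r. C powr ((s - p) / \<kappa>) * (r powr (n - 1 - \<gamma>) * \<bar>W r\<bar> powr p))"
      by (rule set_integrable_mult_right[OF mass])
    fix r :: real assume "r \<in> {1..}"
    then have r: "1 \<le> r" by simp
    have "\<bar>W r\<bar> powr (s - p) = (\<bar>W r\<bar> powr \<kappa>) powr ((s - p) / \<kappa>)" using \<kappa> by (simp add: powr_powr)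
    also have "\<dots> \<le> (C * r powr (- e)) powr ((s - p) / \<kappa>)"
      using C(2)[OF r] sp \<kappa> by (intro powr_mono2) auto
    also have "\<dots> = C powr ((s - p) / \<kappa>) * r powr (- (e * ((s - p) / \<kappa>)))"
      using C(1) by (simp add: powr_mult powr_powr)
    also have "\<dots> \<le> C powr ((s - p) / \<kappa>) * r powr (- \<gamma>)"
      using exponent r by (intro mult_left_mono powr_mono) auto
    finally have "\<bar>W r\<bar> powr (s - p) \<le> C powr ((s - p) / \<kappa>) * r powr (- \<gamma>)" .
    then have "(r powr (n - 1) * \<bar>W r\<bar> powr p) * \<bar>W r\<bar> powr (s - p) \<le>
        (r powr (n - 1) * \<bar>W r\<bar> powr p) * (C powr ((s - p) / \<kappa>) * r powr (- \<gamma>))"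
      by (intro mult_left_mono) auto
    also have "\<dots> = C powr ((s - p) / \<kappa>) * ((r powr (n - 1) * r powr (- \<gamma>)) * \<bar>W r\<bar> powr p)" by simp
    also have "r powr (n - 1) * r powr (- \<gamma>) = r powr (n - 1 - \<gamma>)" unfolding powr_add[symmetric] by simp
    also have "(r powr (n - 1) * \<bar>W r\<bar> powr p) * \<bar>W r\<bar> powr (s - p) = r powr (n - 1) * \<bar>W r\<bar> powr s"
      unfolding mult.assoc powr_add[symmetric] by simp
    finally show "\<bar>r powr (n - 1) * \<bar>W r\<bar> powr s\<bar> \<le> C powr ((s - p) / \<kappa>) * (r powr (n - 1 - \<gamma>) * \<bar>W r\<bar> powr p)"
      by (simp add: abs_mult)
  qed auto
qed

text \<open>Young's inequality with a free weight, |W'| \<le> (\<mu>/2) t^(n-1) W'^2 + t^(1-n) / (2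
  \<mu>), integrated from r to 1. Keeping L abstract covers the logarithm for n = 2 and the power
  for n > 2; \<mu> may depend on r.\<close>

lemma growth_at_0:
  assumes r: "0 < r" "r \<le> 1" and "0 < \<mu>"
    and L: "\<And>t. 0 < t \<Longrightarrow> (L has_real_derivative t powr (- (n - 1))) (at t)"
  shows "\<bar>W r\<bar> \<le> \<bar>W 1\<bar> + \<mu> / 2 * (LBINT t:{0<..1}. t powr (n - 1) * (W1 t)\<^sup>2) + (L 1 - L r) / (2 * \<mu>)"
proof -
  define H where "H t = \<mu> / 2 * (t powr (n - 1) * (W1 t)\<^sup>2)" for t
  have H01: "set_integrable lborel {0<..1} H" unfolding H_def by (intro set_integrable_mult_right D_sub) auto
  have H: "set_integrable lborel {r..1} H" by (rule set_integrable_subset[OF H01]) (use r in auto)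
  have z: "set_integrable lborel {r..1} (\<lambda>t. 0::real)" by (simp add: set_integrable_def)
  have HI: "(LBINT t:{r..1}. H t) \<le> \<mu> / 2 * (LBINT t:{0<..1}. t powr (n - 1) * (W1 t)\<^sup>2)"
  proof -
    have "(LBINT t:{r..1}. H t) \<le> (LBINT t:{0<..1}. H t)"
      unfolding set_lebesgue_integral_def using H H01 r assms(3)
      by (intro integral_mono) (auto simp: set_integrable_def H_def split: split_indicator)
    then show ?thesis by (simp add: H_def)
  qed
  have young: "\<bar>W1 t\<bar> \<le> t powr (- (n - 1)) / (2 * \<mu>) + H t" if "0 < t" for t
  proof -
    define P where "P = t powr (n - 1)"
    have P: "0 < P" using that by (simp add: P_def)
    have "0 \<le> (\<mu> * P * \<bar>W1 t\<bar> - 1)\<^sup>2 / (2 * \<mu> * P)" using P assms(3) by simp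
    also have "\<dots> = \<mu> * P * (W1 t)\<^sup>2 / 2 - \<bar>W1 t\<bar> + 1 / (2 * \<mu> * P)"
      using P assms(3) by (simp add: power2_diff power_mult_distrib field_simps power2_eq_square)
    finally have "\<bar>W1 t\<bar> \<le> 1 / (2 * \<mu> * P) + \<mu> * P * (W1 t)\<^sup>2 / 2" by simp
    moreover have "t powr (- (n - 1)) / (2 * \<mu>) = 1 / (2 * \<mu> * P)"
      using that unfolding P_def powr_minus by (simp add: field_simps)
    ultimately show ?thesis by (simp add: H_def P_def)
  qed
  have "0 \<le> (L 1 / (2 * \<mu>) - W 1) - (L r / (2 * \<mu>) - W r) + (LBINT t:{r..1}. H t)"
  proof -
    have "(LBINT t:{r..1}. 0::real) \<le> (L 1 / (2 * \<mu>) - W 1) - (L r / (2 * \<mu>) - W r) + (LBINT t:{r..1}. H t)"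
    proof (rule integral_le_derivative_bound[OF r(2) _ z H])
      fix t assume t: "t \<in> {r..1}"
      show "((\<lambda>t. L t / (2 * \<mu>) - W t) has_real_derivative t powr (- (n - 1)) / (2 * \<mu>) - W1 t) (at t)"
        by (intro DERIV_diff DERIV_cdivide L W) (use t r in auto)
      show "0 \<le> t powr (- (n - 1)) / (2 * \<mu>) - W1 t + H t" using young[of t] t r by auto
    qed
    then show ?thesis by simp
  qed
  moreover have "0 \<le> (L 1 / (2 * \<mu>) + W 1) - (L r / (2 * \<mu>) + W r) + (LBINT t:{r..1}. H t)"
  proof -
    have "(LBINT t:{r..1}. 0::real) \<le> (L 1 / (2 * \<mu>) + W 1) - (L r / (2 * \<mu>) + W r) + (LBINT t:{r..1}. H t)"
    proof (rule integral_le_derivative_bound[OF r(2) _ z H])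
      fix t assume t: "t \<in> {r..1}"
      show "((\<lambda>t. L t / (2 * \<mu>) + W t) has_real_derivative t powr (- (n - 1)) / (2 * \<mu>) + W1 t) (at t)"
        by (intro DERIV_add DERIV_cdivide L W) (use t r in auto)
      show "0 \<le> t powr (- (n - 1)) / (2 * \<mu>) + W1 t + H t" using young[of t] t r by auto
    qed
    then show ?thesis by simp
  qed
  moreover have "(L 1 - L r) / (2 * \<mu>) = L 1 / (2 * \<mu>) - L r / (2 * \<mu>)" by (rule diff_divide_distrib)
  ultimately show ?thesis using HI by linarith
qed

text \<open>In dimension 2 the logarithmic bound handles every power s. Above it, the pointwise
  bound alone misses the critical exponent by a logarithm, so part of the power is spent on Hardy's
  inequality.\<close>

lemma embedding_at_0:
  assumes "0 < s" "2 < n \<Longrightarrow> s \<le> 2 * n / (n - 2)"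
  shows "set_integrable lborel {0<..1} (\<lambda>r. r powr (n - 1) * \<bar>W r\<bar> powr s)"
proof -
  define I where "I = (LBINT t:{0<..1}. t powr (n - 1) * (W1 t)\<^sup>2)"
  have I: "0 \<le> I" unfolding I_def set_lebesgue_integral_def by (intro Bochner_Integration.integral_nonneg) auto
  have const: "set_integrable lborel {0<..1::real} (\<lambda>r. c)" for c :: real
  proof -
    have "set_integrable lborel {0..1::real} (\<lambda>r. c)" by (rule borel_integrable_atLeastAtMost') (rule continuous_on_const)
    then show ?thesis by (rule set_integrable_subset) auto
  qed
  show ?thesis
  proof (cases "n = 2")
    case True
    define A where "A = \<bar>W 1\<bar> + I / 2"
    show ?thesis
    proof (rule set_integrable_bound_continuous[OF power_continuous[OF assms(1)] _ _ const])
      fix r :: real assume "r \<in> {0<..1}"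
      then have r: "0 < r" "r \<le> 1" by auto
      have L: "(ln has_real_derivative t powr (- (n - 1))) (at t)" if "0 < t" for t :: real
        using that True by (auto intro!: derivative_eq_intros simp: powr_minus divide_inverse)
      have "\<bar>W r\<bar> \<le> A - ln r / 2"
        using growth_at_0[OF r zero_less_one L] by (simp add: A_def I_def)
      \<comment> \<open>The exponent -1/s is chosen so that |W|^s is at most a constant over r,
        which the weight r^(n-1) = r compensates.\<close>
      also have "- ln r \<le> s * r powr (- 1 / s)"
      proof -
        have "ln (r powr (- 1 / s)) \<le> r powr (- 1 / s)" using r by (intro ln_bound) auto
        then have "- ln r / s \<le> r powr (- 1 / s)" using r by (simp add: ln_powr)
        then show ?thesis using assms(1) by (simp add: field_simps)
      qed
      then have "A - ln r / 2 \<le> A * r powr (- 1 / s) + s / 2 * r powr (- 1 / s)"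
      proof -
        have "1 \<le> r powr (- 1 / s)" using powr_mono'[of "- 1 / s" 0 r] r assms(1) by simp
        then have "A * 1 \<le> A * r powr (- 1 / s)" using I by (intro mult_left_mono) (auto simp: A_def)
        with \<open>- ln r \<le> s * r powr (- 1 / s)\<close> show ?thesis by simp
      qed
      finally have "\<bar>W r\<bar> \<le> (A + s / 2) * r powr (- 1 / s)" by (simp add: algebra_simps)
      then have "\<bar>W r\<bar> powr s \<le> ((A + s / 2) * r powr (- 1 / s)) powr s" using assms(1) by (intro powr_mono2) auto
      also have "\<dots> = (A + s / 2) powr s * r powr (- 1)"
        using assms(1) I by (subst powr_mult) (auto simp: powr_powr A_def)
      finally have "r * \<bar>W r\<bar> powr s \<le> r * ((A + s / 2) powr s * r powr (- 1))" using r by (intro mult_left_mono) auto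
      also have "\<dots> = (A + s / 2) powr s" using r by (simp add: powr_minus)
      finally show "\<bar>r powr (n - 1) * \<bar>W r\<bar> powr s\<bar> \<le> (A + s / 2) powr s" using r True by (simp add: abs_mult)
    qed auto
  next
    case False
    then have n2: "2 < n" using n by simp
    define m where "m = n - 2"
    have m: "0 < m" using n2 by (simp add: m_def)
    define C where "C = \<bar>W 1\<bar> + I / 2 + 1 / (2 * m)"
    have C: "0 \<le> C" using I m by (simp add: C_def)
    have bound: "\<bar>W r\<bar> \<le> C * r powr (- m / 2)" if r: "0 < r" "r \<le> 1" for r
    proof -
      \<comment> \<open>This weight balances the two contributions \<mu> I / 2 and r^(-m) / (2 m
        \<mu>), both of order r^(-m/2).\<close>
      define \<mu> where "\<mu> = r powr (- m / 2)"
      have \<mu>: "1 \<le> \<mu>" "0 < \<mu>" using powr_mono'[of "- m / 2" 0 r] r m by (auto simp: \<mu>_def)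
      have \<mu>2: "r powr (- m) = \<mu> * \<mu>" unfolding \<mu>_def powr_add[symmetric] by simp
      have L: "((\<lambda>t. - (t powr (- m)) / m) has_real_derivative t powr (- (n - 1))) (at t)" if "0 < t" for t
      proof -
        have d: "((\<lambda>t. t powr (- m)) has_real_derivative - m * t powr (- m - 1)) (at t)"
          using that by (auto intro!: derivative_eq_intros)
        have "- m - 1 = - (n - 1)" by (simp add: m_def)
        with DERIV_cdivide[OF DERIV_minus[OF d], of m] show ?thesis using m by simp
      qed
      have "\<bar>W r\<bar> \<le> \<bar>W 1\<bar> + \<mu> / 2 * I + (- (1 powr (- m)) / m - (- (r powr (- m)) / m)) / (2 * \<mu>)"
        using growth_at_0[OF r \<mu>(2) L] by (simp add: I_def)
      also have "(- (1 powr (- m)) / m - (- (r powr (- m)) / m)) / (2 * \<mu>) \<le> \<mu> / (2 * m)"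
        using m \<mu> unfolding \<mu>2 by (simp add: field_simps)
      also have "\<bar>W 1\<bar> + \<mu> / 2 * I + \<mu> / (2 * m) \<le> C * \<mu>"
        using mult_left_mono[OF \<mu>(1), of "\<bar>W 1\<bar>"] by (simp add: C_def algebra_simps)
      finally show ?thesis by (simp add: \<mu>_def)
    qed
    \<comment> \<open>Hardy's inequality: expanding r^(n-3) (W + (2/m) r W')^2 \<ge> 0 gives r^(n-3)
      W^2 \<le> B' + H with B = (2/m) r^m W^2 bounded by the pointwise estimate and H a multiple of
      the energy density.\<close>
    have hardy: "set_integrable lborel {0<..1} (\<lambda>r. r powr (n - 3) * (W r)\<^sup>2)"
    proof (rule set_integrable_by_derivative_bound_at_0[where B="\<lambda>r. 2 / m * (r powr m * (W r)\<^sup>2)"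
          and B'="\<lambda>r. 2 / m * (r powr m * (2 * W r * W1 r) + m * r powr (m - 1) * (W r)\<^sup>2)"
          and H="\<lambda>r. 4 / m\<^sup>2 * (r powr (n - 1) * (W1 r)\<^sup>2)" and M="2 / m * C\<^sup>2"])
      show "continuous_on {0<..} (\<lambda>r. r powr (n - 3) * (W r)\<^sup>2)" by (intro continuous_intros W_continuous) auto
      show "((\<lambda>r. 2 / m * (r powr m * (W r)\<^sup>2)) has_real_derivative
        2 / m * (r powr m * (2 * W r * W1 r) + m * r powr (m - 1) * (W r)\<^sup>2)) (at r)" if "0 < r" for r
        using that m by (auto intro!: derivative_eq_intros W)
      show "set_integrable lborel {0<..1} (\<lambda>r. 4 / m\<^sup>2 * (r powr (n - 1) * (W1 r)\<^sup>2))"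
        by (intro set_integrable_mult_right D_sub) auto
      fix r :: real assume r: "0 < r" "r \<le> 1"
      have "(W r)\<^sup>2 \<le> (C * r powr (- m / 2))\<^sup>2" using bound[OF r] by (metis abs_ge_zero power2_abs power_mono)
      also have "\<dots> = C\<^sup>2 * r powr (- m)"
        unfolding power_mult_distrib power2_eq_square[of "_ powr _"] powr_add[symmetric] by simp
      finally have "r powr m * (W r)\<^sup>2 \<le> r powr m * (C\<^sup>2 * r powr (- m))" by (intro mult_left_mono) auto
      also have "\<dots> = C\<^sup>2" using r by (simp add: powr_minus)
      finally show "\<bar>2 / m * (r powr m * (W r)\<^sup>2)\<bar> \<le> 2 / m * C\<^sup>2"
        using m by (simp add: abs_mult divide_right_mono)
      define Q where "Q = r powr (m - 1)"
      have Q: "r powr m = r * Q" "r powr (n - 3) = Q" "r powr (n - 1) = r * r * Q"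
      proof -
        show "r powr m = r * Q" using r by (simp add: Q_def powr_diff)
        show "r powr (n - 3) = Q" by (simp add: Q_def m_def)
        have "r powr (n - 1) = r powr (1 + (1 + (m - 1)))" by (simp add: m_def)
        also have "\<dots> = r * r * Q" unfolding powr_add Q_def using r by simp
        finally show "r powr (n - 1) = r * r * Q" .
      qed
      have "0 \<le> Q * (W r + 2 / m * (r * W1 r))\<^sup>2" by (simp add: Q_def)
      also have "\<dots> = 2 / m * (r * Q * (2 * W r * W1 r) + m * Q * (W r)\<^sup>2) + 4 / m\<^sup>2 * (r * r * Q * (W1 r)\<^sup>2) - Q * (W r)\<^sup>2"
        using m by (simp add: power2_sum power_mult_distrib power2_eq_square field_simps)
      finally show "r powr (n - 3) * (W r)\<^sup>2 \<le> 2 / m * (r powr m * (2 * W r * W1 r) + m * r powr (m - 1) * (W r)\<^sup>2)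
          + 4 / m\<^sup>2 * (r powr (n - 1) * (W1 r)\<^sup>2)"
        unfolding Q Q_def[symmetric] by simp
    qed auto
    show ?thesis
    proof (rule set_integrable_bound_continuous[OF power_continuous[OF assms(1)]])
      show "set_integrable lborel {0<..1} (\<lambda>r. 1 + C powr (4 / m) * (r powr (n - 3) * (W r)\<^sup>2))"
        by (intro set_integral_add const set_integrable_mult_right hardy)
      fix r :: real assume "r \<in> {0<..1}"
      then have r: "0 < r" "r \<le> 1" by auto
      \<comment> \<open>The critical exponent 2 n / (n-2) equals 2 + 4/m. Two powers of W go to
        Hardy's term, and the other 4/m are at most a constant times r^(-2), precisely the missing
        weight.\<close>
      have s2: "s \<le> 2 + 4 / m" using assms(2)[OF n2] m by (simp add: m_def field_simps)
      have "\<bar>W r\<bar> powr s \<le> 1 + \<bar>W r\<bar> powr (2 + 4 / m)"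
      proof (cases "\<bar>W r\<bar> \<le> 1")
        case True
        then have "\<bar>W r\<bar> powr s \<le> 1 powr s" using assms(1) by (intro powr_mono2) auto
        then show ?thesis by (simp add: add_increasing2)
      next
        case False
        then have "\<bar>W r\<bar> powr s \<le> \<bar>W r\<bar> powr (2 + 4 / m)" using s2 by (intro powr_mono) auto
        then show ?thesis by simp
      qed
      also have "\<bar>W r\<bar> powr (2 + 4 / m) = (W r)\<^sup>2 * \<bar>W r\<bar> powr (4 / m)"
        by (cases "W r = 0") (simp_all add: powr_add)
      also have "\<bar>W r\<bar> powr (4 / m) \<le> (C * r powr (- m / 2)) powr (4 / m)"
        using bound[OF r] m by (intro powr_mono2) auto
      also have "\<dots> = C powr (4 / m) * r powr (- 2)"
        using C m by (simp add: powr_mult powr_powr)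
      finally have "\<bar>W r\<bar> powr s \<le> 1 + (W r)\<^sup>2 * (C powr (4 / m) * r powr (- 2))"
        by (simp add: mult_left_mono)
      then have "r powr (n - 1) * \<bar>W r\<bar> powr s \<le> r powr (n - 1) * (1 + (W r)\<^sup>2 * (C powr (4 / m) * r powr (- 2)))"
        by (intro mult_left_mono) auto
      also have "\<dots> = r powr (n - 1) + C powr (4 / m) * ((r powr (n - 1) * r powr (- 2)) * (W r)\<^sup>2)"
        by (simp add: algebra_simps)
      also have "r powr (n - 1) * r powr (- 2) = r powr (n - 3)" by (simp add: powr_add[symmetric])
      also have "r powr (n - 1) \<le> 1" using powr_mono'[of 0 "n - 1" r] r n by simp
      finally show "\<bar>r powr (n - 1) * \<bar>W r\<bar> powr s\<bar> \<le> 1 + C powr (4 / m) * (r powr (n - 3) * (W r)\<^sup>2)"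
        by (simp add: abs_mult)
    qed auto
  qed
qed

end

section \<open>The Nehari and Pohozaev identities\<close>

text \<open>Only positive radii matter, the origin being a null set; measurability is therefore
  asked of the restricted profile, which suits functions continuous on the open half-line.\<close>

lemma radial_transfer:
  fixes v :: "'a::euclidean_space \<Rightarrow> real"
  assumes v: "AE x in lebesgue. v x = F (norm x)" and [measurable]: "(\<lambda>r. if 0 < r then F r else 0) \<in> borel_measurable borel"
  shows "(LINT x|lebesgue. v x) = sph DIM('a) * (LBINT r:{0<..}. r powr (real DIM('a) - 1) * F r)"
    and "integrable lebesgue v \<longleftrightarrow> set_integrable lborel {0<..} (\<lambda>r. r powr (real DIM('a) - 1) * F r)"
proof -
  define F0 where "F0 r = (if 0 < r then F r else 0)" for r
  have [measurable]: "F0 \<in> borel_measurable borel" unfolding F0_def by measurable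
  have "AE x in lebesgue. x \<noteq> (0::'a)" by (rule AE_completion[OF AE_lborel_singleton])
  with v have ae: "AE x in lebesgue. F0 (norm x) = v x" by eventually_elim (auto simp: F0_def)
  have m: "(\<lambda>x::'a. F0 (norm x)) \<in> borel_measurable lebesgue" by (rule measurable_completion) measurable
  have mv: "v \<in> borel_measurable lebesgue" by (rule borel_measurable_AE[OF m ae])
  have eq: "radial_density DIM('a) r * F0 r = sph DIM('a) * (indicator {0<..} r *\<^sub>R (r powr (real DIM('a) - 1) * F r))" for r
    by (auto simp: radial_density_def F0_def split: split_indicator)
  have "(LINT x|lebesgue. v x) = (LINT x|lebesgue. F0 (norm (x::'a)))"
    by (rule integral_cong_AE[OF mv m]) (use ae in \<open>auto elim!: eventually_mono\<close>)
  also have "\<dots> = (LBINT x. F0 (norm (x::'a)))" by (rule integral_completion) measurable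
  also have "\<dots> = (LBINT r. radial_density DIM('a) r * F0 r)" by (rule integral_radial(1)) measurable
  finally show "(LINT x|lebesgue. v x) = sph DIM('a) * (LBINT r:{0<..}. r powr (real DIM('a) - 1) * F r)"
    unfolding eq by (simp add: set_lebesgue_integral_def)
  have "integrable lebesgue v \<longleftrightarrow> integrable lebesgue (\<lambda>x::'a. F0 (norm x))"
    by (rule integrable_cong_AE[OF mv m]) (use ae in \<open>auto elim!: eventually_mono\<close>)
  also have "\<dots> \<longleftrightarrow> integrable lborel (\<lambda>x::'a. F0 (norm x))" by (rule integrable_completion) measurable
  also have "\<dots> \<longleftrightarrow> integrable lborel (\<lambda>r. radial_density DIM('a) r * F0 r)" by (rule integral_radial(2)) measurable
  finally show "integrable lebesgue v \<longleftrightarrow> set_integrable lborel {0<..} (\<lambda>r. r powr (real DIM('a) - 1) * F r)"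
    unfolding eq set_integrable_def using sph_pos[of "DIM('a)"] by simp
qed

lemma radial_transfer_continuous:
  fixes v :: "'a::euclidean_space \<Rightarrow> real"
  assumes "AE x in lebesgue. v x = F (norm x)" "continuous_on {0<..} F"
  shows "(LINT x|lebesgue. v x) = sph DIM('a) * (LBINT r:{0<..}. r powr (real DIM('a) - 1) * F r)"
    and "integrable lebesgue v \<longleftrightarrow> set_integrable lborel {0<..} (\<lambda>r. r powr (real DIM('a) - 1) * F r)"
  by (rule radial_transfer[OF assms(1) borel_measurable_restrict_pos[OF assms(2)]])+

text \<open>If |G| stayed above a positive constant near 0 or near infinity, |G| / r would not be
  integrable. So there are points x_k tending to 0 and y_k to infinity along which G tends to 0, and
  dominated convergence on [x_k, y_k] gives the claim without knowing limits of G.\<close>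

lemma integral_derivative_zero:
  fixes G :: "real \<Rightarrow> real"
  assumes G: "\<And>r. 0 < r \<Longrightarrow> (G has_real_derivative G' r) (at r)"
    and G': "set_integrable lborel {0<..} G'" and Gr: "set_integrable lborel {0<..} (\<lambda>r. G r / r)"
  shows "(LBINT r:{0<..}. G' r) = 0"
proof -
  have Ga: "set_integrable lborel {0<..} (\<lambda>r. \<bar>G r / r\<bar>)" by (rule set_integrable_abs[OF Gr])
  have "\<exists>y\<ge>real (Suc k). \<bar>G y\<bar> < inverse (real (Suc k))" for k
  proof (rule ccontr)
    assume "\<not> (\<exists>y\<ge>real (Suc k). \<bar>G y\<bar> < inverse (real (Suc k)))"
    then have ge: "inverse (real (Suc k)) \<le> \<bar>G y\<bar>" if "real (Suc k) \<le> y" for y using that by (meson not_less)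
    have "inverse (real (Suc k)) \<le> y * \<bar>G y / y\<bar>" if "real (Suc k) \<le> y" for y
    proof -
      have "0 < real (Suc k)" by simp
      then have "0 < y" using that by linarith
      then show ?thesis using ge[OF that] by (simp add: abs_divide)
    qed
    moreover have "set_integrable lborel {1..} (\<lambda>r. \<bar>G r / r\<bar>)" by (rule set_integrable_subset[OF Ga]) auto
    ultimately show False
      using not_integrable_inverse_at_top[of "inverse (real (Suc k))" "real (Suc k)" "\<lambda>r. \<bar>G r / r\<bar>"] by auto
  qed
  then obtain y where y: "\<And>k. real (Suc k) \<le> y k" "\<And>k. \<bar>G (y k)\<bar> < inverse (real (Suc k))" by metis
  have "\<exists>x. 0 < x \<and> x \<le> inverse (real (Suc k)) \<and> \<bar>G x\<bar> < inverse (real (Suc k))" for k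
  proof (rule ccontr)
    assume neg: "\<not> (\<exists>x. 0 < x \<and> x \<le> inverse (real (Suc k)) \<and> \<bar>G x\<bar> < inverse (real (Suc k)))"
    have "inverse (real (Suc k)) \<le> x * \<bar>G x / x\<bar>" if "0 < x" "x \<le> inverse (real (Suc k))" for x
    proof -
      have "inverse (real (Suc k)) \<le> \<bar>G x\<bar>" using neg that by (meson not_less)
      then show ?thesis using that by (simp add: abs_divide)
    qed
    moreover have "set_integrable lborel {0<..1} (\<lambda>r. \<bar>G r / r\<bar>)" by (rule set_integrable_subset[OF Ga]) auto
    moreover have "0 < inverse (real (Suc k))" "inverse (real (Suc k)) \<le> 1" by (auto simp: field_simps)
    ultimately show False
      using not_integrable_inverse_at_0[of "inverse (real (Suc k))" "inverse (real (Suc k))" "\<lambda>r. \<bar>G r / r\<bar>"] by blast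
  qed
  then obtain x where x: "\<And>k. 0 < x k" "\<And>k. x k \<le> inverse (real (Suc k))" "\<And>k. \<bar>G (x k)\<bar> < inverse (real (Suc k))" by metis
  have xy: "x k \<le> y k" for k
  proof -
    have "inverse (real (Suc k)) \<le> 1" "1 \<le> real (Suc k)" by (auto simp: field_simps)
    then show ?thesis using x(2)[of k] y(1)[of k] by linarith
  qed
  have sub: "set_integrable lborel {x k..y k} G'" for k
    by (rule set_integrable_subset[OF G']) (use x(1)[of k] in auto)
  have val: "(LBINT r:{x k..y k}. G' r) = G (y k) - G (x k)" for k
  proof -
    have "(G' has_integral (G (y k) - G (x k))) {x k..y k}"
      using G x(1)[of k] by (intro fundamental_theorem_of_calculus xy)
        (auto simp: has_real_derivative_iff_has_vector_derivative[symmetric] intro!: DERIV_subset[OF G])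
    then show ?thesis using set_borel_integral_eq_integral(2)[OF sub[of k]] by (simp add: integral_unique)
  qed
  have inv0: "(\<lambda>k. inverse (real (Suc k))) \<longlonglongrightarrow> 0" by (rule LIMSEQ_inverse_real_of_nat)
  have "(\<lambda>k. G (y k)) \<longlonglongrightarrow> 0" "(\<lambda>k. G (x k)) \<longlonglongrightarrow> 0"
    by (rule Lim_null_comparison[OF _ inv0]; use y(2) x(3) in \<open>auto intro!: always_eventually less_imp_le\<close>)+
  then have lim0: "(\<lambda>k. LBINT r:{x k..y k}. G' r) \<longlonglongrightarrow> 0"
    unfolding val using tendsto_diff by fastforce
  have "(\<lambda>k. LBINT r:{x k..y k}. G' r) \<longlonglongrightarrow> (LBINT r:{0<..}. G' r)"
    unfolding set_lebesgue_integral_def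
  proof (rule integral_dominated_convergence[where w="\<lambda>r. \<bar>indicator {0<..} r *\<^sub>R G' r\<bar>"])
    show "integrable lborel (\<lambda>r. \<bar>indicator {0<..} r *\<^sub>R G' r\<bar>)"
      using integrable_abs[OF G'[unfolded set_integrable_def]] .
    show "(\<lambda>r. indicator {0<..} r *\<^sub>R G' r) \<in> borel_measurable lborel"
      using G' unfolding set_integrable_def by (rule borel_measurable_integrable)
    show "(\<lambda>r. indicator {x k..y k} r *\<^sub>R G' r) \<in> borel_measurable lborel" for k
      using sub[of k] unfolding set_integrable_def by (rule borel_measurable_integrable)
    show "AE r in lborel. norm (indicator {x k..y k} r *\<^sub>R G' r) \<le> \<bar>indicator {0<..} r *\<^sub>R G' r\<bar>" for k
      using x(1)[of k] by (intro AE_I2) (auto split: split_indicator)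
    show "AE r in lborel. (\<lambda>k. indicator {x k..y k} r *\<^sub>R G' r) \<longlonglongrightarrow> indicator {0<..} r *\<^sub>R G' r"
    proof (rule AE_I2)
      fix r :: real
      show "(\<lambda>k. indicator {x k..y k} r *\<^sub>R G' r) \<longlonglongrightarrow> indicator {0<..} r *\<^sub>R G' r"
      proof (cases "0 < r")
        case True
        obtain m1 where m1: "inverse (real (Suc m1)) < r" using reals_Archimedean[OF True] by blast
        obtain m2 :: nat where m2: "r \<le> real m2" using real_arch_simple by blast
        have "r \<in> {x k..y k}" if k: "max m1 m2 \<le> k" for k
        proof -
          have "inverse (real (Suc k)) \<le> inverse (real (Suc m1))" using k by (auto simp: field_simps)
          moreover have "real m2 \<le> real (Suc k)" using k by simp
          ultimately have "x k \<le> r" "r \<le> y k" using x(2)[of k] y(1)[of k] m1 m2 by linarith+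
          then show ?thesis by simp
        qed
        then have "eventually (\<lambda>k. indicator {x k..y k} r *\<^sub>R G' r = indicator {0<..} r *\<^sub>R G' r) sequentially"
          using True by (auto intro!: eventually_sequentiallyI[of "max m1 m2"])
        then show ?thesis by (rule tendsto_eventually)
      next
        case False
        then have "r \<notin> {x k..y k}" for k using x(1)[of k] by auto
        then show ?thesis using False by simp
      qed
    qed
  qed
  then show ?thesis using lim0 LIMSEQ_unique by blast
qed

lemma primitive_has_derivative:
  assumes f: "continuous_on UNIV f"
  shows "(primitive f has_real_derivative f t) (at t)" and "primitive f 0 = 0"
proof -
  define c where "c = \<bar>t\<bar> + 1"
  have "((\<lambda>u. LBINT y=ereal 0..ereal u. f y) has_vector_derivative f t) (at t within {- c..c})"
    by (rule interval_integral_FTC2) (auto simp: c_def intro: continuous_on_subset[OF f])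
  moreover have "at t within {- c..c} = at t"
    by (rule at_within_Icc_at) (auto simp: c_def)
  ultimately show "(primitive f has_real_derivative f t) (at t)"
    by (simp add: primitive_def[abs_def] has_real_derivative_iff_has_vector_derivative zero_ereal_def)
  show "primitive f 0 = 0" by (simp add: primitive_def)
qed

text \<open>The mean value theorem gives F(t) = f(\<xi>) t with |\<xi>| \<le> |t|, so f(t) t and
  F(t) obey the same bound with the same constant.\<close>

lemma primitive_growth:
  assumes f: "continuous_on UNIV f" and s: "1 < s1" "1 < s2" and "0 \<le> C"
    and growth: "\<And>t. \<bar>f t\<bar> \<le> C * (\<bar>t\<bar> powr (s1 - 1) + \<bar>t\<bar> powr (s2 - 1))"
  shows "\<bar>f t * t\<bar> \<le> C * (\<bar>t\<bar> powr s1 + \<bar>t\<bar> powr s2)" and "\<bar>primitive f t\<bar> \<le> C * (\<bar>t\<bar> powr s1 + \<bar>t\<bar> powr s2)"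
proof -
  have mult: "(\<bar>t\<bar> powr (s1 - 1) + \<bar>t\<bar> powr (s2 - 1)) * \<bar>t\<bar> = \<bar>t\<bar> powr s1 + \<bar>t\<bar> powr s2"
    by (cases "t = 0") (auto simp: powr_diff field_simps)
  have key: "\<bar>f \<xi> * t\<bar> \<le> C * (\<bar>t\<bar> powr s1 + \<bar>t\<bar> powr s2)" if "\<bar>\<xi>\<bar> \<le> \<bar>t\<bar>" for \<xi>
  proof -
    have "\<bar>f \<xi>\<bar> \<le> C * (\<bar>\<xi>\<bar> powr (s1 - 1) + \<bar>\<xi>\<bar> powr (s2 - 1))" by (rule growth)
    also have "\<dots> \<le> C * (\<bar>t\<bar> powr (s1 - 1) + \<bar>t\<bar> powr (s2 - 1))"
      using that s \<open>0 \<le> C\<close> by (intro mult_left_mono add_mono powr_mono2) auto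
    finally have "\<bar>f \<xi>\<bar> * \<bar>t\<bar> \<le> C * (\<bar>t\<bar> powr (s1 - 1) + \<bar>t\<bar> powr (s2 - 1)) * \<bar>t\<bar>" by (rule mult_right_mono) simp
    then show ?thesis by (simp only: mult.assoc mult abs_mult)
  qed
  show "\<bar>f t * t\<bar> \<le> C * (\<bar>t\<bar> powr s1 + \<bar>t\<bar> powr s2)" by (rule key) simp
  note P = primitive_has_derivative[OF f]
  consider "t = 0" | "0 < t" | "t < 0" by linarith
  then show "\<bar>primitive f t\<bar> \<le> C * (\<bar>t\<bar> powr s1 + \<bar>t\<bar> powr s2)"
  proof cases
    case 1
    then show ?thesis using P(2) by simp
  next
    case 2
    obtain \<xi> where \<xi>: "0 < \<xi>" "\<xi> < t" "primitive f t - primitive f 0 = (t - 0) * f \<xi>"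
      using MVT2[OF 2, of "primitive f" f] P(1) by blast
    then have "primitive f t = f \<xi> * t" using P(2) by simp
    then show ?thesis using key[of \<xi>] \<xi> by simp
  next
    case 3
    obtain \<xi> where \<xi>: "t < \<xi>" "\<xi> < 0" "primitive f 0 - primitive f t = (0 - t) * f \<xi>"
      using MVT2[OF 3, of "primitive f" f] P(1) by blast
    then have "primitive f t = f \<xi> * t" using P(2) by simp
    then show ?thesis using key[of \<xi>] \<xi> by simp
  qed
qed

text \<open>The delicate points are zeros of h: for q > 1 the derivative of |.|^q covers them, while
  for q = 1 the factor h^(q-1) has to be 1, which is the convention of \<open>pow0\<close>.\<close>

lemma powr_q_has_derivative:
  assumes "1 \<le> q" "\<And>r. 0 \<le> h r" "(h has_real_derivative h') (at r)"
  shows "((\<lambda>r. h r powr q) has_real_derivative q * pow0 (h r) (q - 1) * h') (at r)"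
proof (cases "q = 1")
  case True
  then have "(\<lambda>r. h r powr q) = h" using assms(2) by auto
  then show ?thesis using assms(3) True by (simp add: pow0_def)
next
  case False
  then have q: "1 < q" using assms(1) by simp
  have "((\<lambda>r. \<bar>h r\<bar> powr q) has_real_derivative q * (\<bar>h r\<bar> powr (q - 2) * h r) * h') (at r)"
    by (rule DERIV_chain2[OF has_real_derivative_abs_powr[OF q] assms(3)])
  moreover have "\<bar>h r\<bar> powr (q - 2) * h r = pow0 (h r) (q - 1)"
    using abs_powr_mult_self[of "h r" q] assms(2)[of r] q by (simp add: pow0_def)
  ultimately show ?thesis using assms(2) by simp
qed

section \<open>Energy identities for the regular profile\<close>

locale regular_radial_solution =
  fixes a p q b n \<omega> :: real and f W K :: "real \<Rightarrow> real" and u :: "'a::euclidean_space \<Rightarrow> real"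
  assumes n_eq: "n = real DIM('a)" and \<omega>_eq: "\<omega> = sph DIM('a)" and n: "2 \<le> n"
    and a: "0 < a" and p: "1 < p" and q: "1 \<le> q" and b: "1 < b" and f: "continuous_on UNIV f"
    and sol: "weak_radial_solution a p q b f u"
    and u_eq: "AE x in lebesgue. u x = W (norm x)"
    and W_deriv: "\<And>r. r > 0 \<Longrightarrow> (W has_real_derivative r powr - (n - 1) * K r) (at r)"
    and K_deriv: "\<And>r. r > 0 \<Longrightarrow> (K has_real_derivative
      r powr (n - 1) * (Phi a p q b u r * \<bar>W r\<bar> powr (p - 2) * W r - f (W r))) (at r)"
    and grad_eq: "AE x in lebesgue. weak_grad u x = (norm x powr - (n - 1) * K (norm x) / norm x) *\<^sub>R x"
begin

definition "W1 r = r powr - (n - 1) * K r"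
abbreviation "h \<equiv> h_mass p u"
abbreviation "\<Phi> \<equiv> Phi a p q b u"

lemma u_E: "u \<in> E_space p q b" and u_E_rad: "u \<in> E_rad p q b"
  using sol by (auto simp: weak_radial_solution_def E_rad_def)

lemma \<omega>: "0 < \<omega>" unfolding \<omega>_eq by (rule sph_pos) simp

lemma K_continuous: "continuous_on {0<..} K"
  using K_deriv by (intro continuous_at_imp_continuous_on ballI DERIV_isCont) auto

lemma W1_continuous: "continuous_on {0<..} W1"
  unfolding W1_def[abs_def] by (intro continuous_intros K_continuous) auto

lemma Wc: "continuous_on {0<..} W"
  using W_deriv by (intro continuous_at_imp_continuous_on ballI DERIV_isCont) auto

lemma dirichlet_eq: "dirichlet_integral u = \<omega> * (LBINT r:{0<..}. r powr (n - 1) * (W1 r)\<^sup>2)"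
  and dirichlet_integrable: "set_integrable lborel {0<..} (\<lambda>r. r powr (n - 1) * (W1 r)\<^sup>2)"
proof -
  have ae: "AE x in lebesgue. (norm (weak_grad u x))\<^sup>2 = (\<lambda>r. (W1 r)\<^sup>2) (norm x)"
    using grad_eq AE_completion[OF AE_lborel_singleton[of 0]]
  proof eventually_elim
    case (elim x)
    then have "norm (weak_grad u x) = \<bar>W1 (norm x)\<bar>" by (simp add: W1_def abs_mult)
    then show ?case by simp
  qed
  have c: "continuous_on {0<..} (\<lambda>r. (W1 r)\<^sup>2)" by (intro continuous_intros W1_continuous)
  note t = radial_transfer_continuous[OF ae c, folded n_eq \<omega>_eq]
  show "dirichlet_integral u = \<omega> * (LBINT r:{0<..}. r powr (n - 1) * (W1 r)\<^sup>2)"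
    unfolding dirichlet_integral_def by (rule t(1))
  have "integrable lebesgue (\<lambda>x. (norm (weak_grad u x))\<^sup>2)" using u_E by (simp add: E_space_def)
  then show "set_integrable lborel {0<..} (\<lambda>r. r powr (n - 1) * (W1 r)\<^sup>2)" using t(2) by simp
qed

sublocale radial_profile W W1 n
  by unfold_locales (use n W_deriv W1_continuous dirichlet_integrable in \<open>simp_all add: W1_def\<close>)

lemma mass_locally: "\<forall>\<rho>>0. set_integrable lebesgue (ball 0 \<rho>) (\<lambda>y. \<bar>u y\<bar> powr p)"
  using u_E by (simp add: E_space_def)

lemma h_borel [measurable]: "h \<in> borel_measurable borel" by (rule h_mass_borel[OF mass_locally])

lemma mass_density_continuous: "continuous_on {0<..} (\<lambda>r. \<omega> * (r powr (n - 1) * \<bar>W r\<bar> powr p))"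
  by (intro continuous_on_mult continuous_on_const power_continuous) (use p in auto)

lemma h_eq:
  assumes "0 < \<rho>"
  shows "h \<rho> = (LBINT r:{0<..<\<rho>}. \<omega> * (r powr (n - 1) * \<bar>W r\<bar> powr p))"
    and "set_integrable lborel {0<..<\<rho>} (\<lambda>r. \<omega> * (r powr (n - 1) * \<bar>W r\<bar> powr p))"
proof -
  have ae: "AE x in lebesgue. indicator (ball 0 \<rho>) x *\<^sub>R \<bar>u x\<bar> powr p = (\<lambda>r. indicator {..<\<rho>} r * \<bar>W r\<bar> powr p) (norm x)"
    using u_eq by eventually_elim (auto split: split_indicator)
  have "(\<lambda>r. if 0 < r then \<bar>W r\<bar> powr p else 0) \<in> borel_measurable borel"
    by (intro borel_measurable_restrict_pos continuous_on_abs_powr Wc) (use p in auto)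
  then have "(\<lambda>r. indicator {..<\<rho>} r * (if 0 < r then \<bar>W r\<bar> powr p else 0)) \<in> borel_measurable borel" by measurable
  also have "(\<lambda>r. indicator {..<\<rho>} r * (if 0 < r then \<bar>W r\<bar> powr p else 0)) =
      (\<lambda>r. if 0 < r then indicator {..<\<rho>} r * \<bar>W r\<bar> powr p else 0)" by auto
  finally have m: "(\<lambda>r. if 0 < r then indicator {..<\<rho>} r * \<bar>W r\<bar> powr p else 0) \<in> borel_measurable borel" .
  note t = radial_transfer[OF ae m, folded n_eq \<omega>_eq]
  have eq: "indicator {0<..} r *\<^sub>R (r powr (n - 1) * (indicator {..<\<rho>} r * \<bar>W r\<bar> powr p)) =
      indicator {0<..<\<rho>} r *\<^sub>R (r powr (n - 1) * \<bar>W r\<bar> powr p)" for r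
    by (auto split: split_indicator)
  have "h \<rho> = \<omega> * (LBINT r:{0<..<\<rho>}. r powr (n - 1) * \<bar>W r\<bar> powr p)"
    using t(1) unfolding h_mass_def set_lebesgue_integral_def eq .
  then show "h \<rho> = (LBINT r:{0<..<\<rho>}. \<omega> * (r powr (n - 1) * \<bar>W r\<bar> powr p))" by simp
  have "set_integrable lborel {0<..<\<rho>} (\<lambda>r. r powr (n - 1) * \<bar>W r\<bar> powr p)"
    using t(2) mass_locally assms unfolding set_integrable_def eq by simp
  then show "set_integrable lborel {0<..<\<rho>} (\<lambda>r. \<omega> * (r powr (n - 1) * \<bar>W r\<bar> powr p))"
    by (rule set_integrable_mult_right)
qed

lemma h_deriv:
  assumes "0 < r"
  shows "(h has_real_derivative \<omega> * (r powr (n - 1) * \<bar>W r\<bar> powr p)) (at r)"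
proof (rule primitive_of_has_derivative[OF mass_density_continuous _ assms])
  let ?m = "\<lambda>r. \<omega> * (r powr (n - 1) * \<bar>W r\<bar> powr p)"
  show "primitive_of ?m h"
    unfolding primitive_of_def
  proof (intro allI impI)
    fix s t :: real assume st: "0 < s" "s \<le> t"
    have i: "set_integrable lborel {s..<t} ?m"
      by (rule set_integrable_subset[OF h_eq(2)[of t]]) (use st in auto)
    have "(LBINT r:{0<..<t}. ?m r) = (LBINT r:{0<..<s}. ?m r) + (LBINT r:{s..<t}. ?m r)"
    proof -
      have "{0<..<t} = {0<..<s} \<union> {s..<t}" using st by auto
      moreover have "{0<..<s} \<inter> {s..<t} = {}" by auto
      ultimately show ?thesis using set_integral_Un[OF _ h_eq(2)[OF st(1)] i] by simp
    qed
    also have "(LBINT r:{s..<t}. ?m r) = integral {s..<t} ?m" by (rule set_borel_integral_eq_integral(2)[OF i])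
    also have "\<dots> = integral {s..t} ?m"
      by (rule integral_subset_negligible) (auto intro: negligible_subset[OF negligible_sing[of t]])
    finally show "h t - h s = integral {s..t} ?m" using h_eq(1) st by simp
  qed
qed

lemma h_continuous: "continuous_on {0<..} h"
  using h_deriv by (intro continuous_at_imp_continuous_on ballI DERIV_isCont) auto

lemma h_nonneg: "0 \<le> h r" by (rule h_mass_nonneg)

lemma coulomb_set_integrable: "set_integrable lborel {0<..} (\<lambda>\<rho>. \<rho> powr - b * h \<rho> powr q)"
  and coulomb_eq: "coulomb_integral p q b u = (LBINT \<rho>:{0<..}. \<rho> powr - b * h \<rho> powr q)"
proof -
  have "set_integrable lebesgue {0<..} (\<lambda>\<rho>. \<rho> powr - b * h \<rho> powr q)" using u_E by (simp add: E_space_def)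
  then show "set_integrable lborel {0<..} (\<lambda>\<rho>. \<rho> powr - b * h \<rho> powr q)"
    unfolding set_integrable_def by (subst (asm) integrable_completion) auto
  show "coulomb_integral p q b u = (LBINT \<rho>:{0<..}. \<rho> powr - b * h \<rho> powr q)"
    unfolding coulomb_integral_def set_lebesgue_integral_def by (rule integral_completion) measurable
qed

text \<open>As h is nondecreasing, h(R)^q times the tail integral R^(1-b) / (b-1) of \<rho>^(-b) is
  at most the Coulomb integral; the q-th root yields the exponent (b-1)/q.\<close>

lemma h_growth:
  assumes "0 < R"
  shows "h R \<le> ((b - 1) * coulomb_integral p q b u) powr (1 / q) * R powr ((b - 1) / q)"
proof -
  have "(LBINT \<rho>. h R powr q * (indicator {R..} \<rho> * \<rho> powr - b)) \<le> coulomb_integral p q b u"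
    unfolding coulomb_eq set_lebesgue_integral_def
  proof (rule integral_mono)
    show "integrable lborel (\<lambda>\<rho>. h R powr q * (indicator {R..} \<rho> * \<rho> powr - b))"
      by (intro integrable_mult_right integrable_powr_tail assms b)
    show "integrable lborel (\<lambda>\<rho>. indicator {0<..} \<rho> *\<^sub>R (\<rho> powr - b * h \<rho> powr q))"
      using coulomb_set_integrable by (simp add: set_integrable_def)
    fix \<rho> :: real
    have "h R powr q \<le> h \<rho> powr q" if "R \<le> \<rho>"
      using monoD[OF h_mass_mono[OF mass_locally] that] h_nonneg q by (intro powr_mono2) auto
    then show "h R powr q * (indicator {R..} \<rho> * \<rho> powr - b) \<le> indicator {0<..} \<rho> *\<^sub>R (\<rho> powr - b * h \<rho> powr q)"
      using assms by (auto simp: mult.commute[of "h R powr q"] split: split_indicator intro!: mult_left_mono)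
  qed
  then have "h R powr q * (R powr (1 - b) / (b - 1)) \<le> coulomb_integral p q b u"
    by (simp add: integrable_powr_tail(2)[OF assms b])
  then have "h R powr q * R powr (1 - b) \<le> (b - 1) * coulomb_integral p q b u"
    using b by (simp add: field_simps)
  then have "h R powr q * R powr (1 - b) * R powr (b - 1) \<le> (b - 1) * coulomb_integral p q b u * R powr (b - 1)"
    by (rule mult_right_mono) simp
  moreover have "R powr (1 - b) * R powr (b - 1) = 1" using assms unfolding powr_add[symmetric] by simp
  ultimately have le: "h R powr q \<le> (b - 1) * coulomb_integral p q b u * R powr (b - 1)"
    by (simp add: mult.assoc)
  have "h R = (h R powr q) powr (1 / q)" using q h_nonneg by (simp add: powr_powr)
  also have "\<dots> \<le> ((b - 1) * coulomb_integral p q b u * R powr (b - 1)) powr (1 / q)"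
    using le q by (intro powr_mono2) auto
  also have "\<dots> = ((b - 1) * coulomb_integral p q b u) powr (1 / q) * R powr ((b - 1) / q)"
    using assms by (simp add: powr_mult powr_powr)
  finally show ?thesis .
qed

lemma embedding:
  assumes "0 < s" "(b - 1) / q < n" "(b - 1) / q * (s + 2) < 2 * (n - 1) * (s - p)" "2 < n \<Longrightarrow> s \<le> 2 * n / (n - 2)"
  shows "set_integrable lborel {0<..} (\<lambda>r. r powr (n - 1) * \<bar>W r\<bar> powr s)"
proof -
  have "set_integrable lborel {1..} (\<lambda>r. r powr (n - 1) * \<bar>W r\<bar> powr s)"
    by (rule embedding_at_infinity[where h=h and \<omega>=\<omega> and p=p and \<nu>="(b - 1) / q" and Kh="((b - 1) * coulomb_integral p q b u) powr (1 / q)"])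
      (use assms p q b \<omega> h_deriv h_nonneg h_growth in auto)
  from set_integrable_Un[OF embedding_at_0[OF assms(1,4)] this]
  have "set_integrable lborel ({0<..1} \<union> {1..}) (\<lambda>r. r powr (n - 1) * \<bar>W r\<bar> powr s)" by simp
  moreover have "{0<..1} \<union> {1..} = {0::real<..}" by auto
  ultimately show ?thesis by simp
qed

text \<open>The density of the potential: \<Phi>' = - a \<kappa>, and \<kappa> h is the Coulomb
  integrand.\<close>

definition "\<kappa> \<rho> = \<rho> powr - b * pow0 (h \<rho>) (q - 1)"

lemma \<kappa>_nonneg: "0 \<le> \<kappa> \<rho>" by (simp add: \<kappa>_def pow0_def)

lemma \<kappa>_borel [measurable]: "\<kappa> \<in> borel_measurable borel" unfolding \<kappa>_def[abs_def] pow0_def by simp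

lemma \<kappa>_h: "\<kappa> \<rho> * h \<rho> = \<rho> powr - b * h \<rho> powr q"
proof -
  have "pow0 (h \<rho>) (q - 1) * h \<rho> = h \<rho> powr q"
  proof (cases "h \<rho> = 0")
    case False
    then have "0 < h \<rho>" using h_nonneg[of \<rho>] by simp
    then show ?thesis using q by (simp add: pow0_def powr_diff)
  qed simp
  then show ?thesis by (simp add: \<kappa>_def)
qed

lemma \<kappa>_continuous: "continuous_on {0<..} \<kappa>"
proof (cases "q = 1")
  case True
  then show ?thesis unfolding \<kappa>_def[abs_def] pow0_def by (auto intro!: continuous_intros)
next
  case False
  then have "continuous_on {0<..} (\<lambda>\<rho>. h \<rho> powr (q - 1))"
    using q h_nonneg by (intro continuous_on_powr' h_continuous continuous_on_const) auto
  then show ?thesis using False unfolding \<kappa>_def[abs_def] pow0_def by (auto intro!: continuous_intros)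
qed

lemma \<Phi>_deriv: "0 < r \<Longrightarrow> (\<Phi> has_real_derivative - a * \<kappa> r) (at r)"
proof (rule primitive_of_has_derivative)
  show "continuous_on {0<..} (\<lambda>r. - a * \<kappa> r)" by (intro continuous_intros \<kappa>_continuous)
  show "primitive_of (\<lambda>r. - a * \<kappa> r) \<Phi>" unfolding \<kappa>_def by (rule Phi_primitive(1)[OF u_E q b])
qed

lemma \<Phi>_continuous: "continuous_on {0<..} \<Phi>"
  using \<Phi>_deriv by (intro continuous_at_imp_continuous_on ballI DERIV_isCont) auto

text \<open>Tonelli's theorem on \<open>{r < \<rho>}\<close> turns the potential term into \<open>\<integral> \<kappa> h\<close>.\<close>

lemma potential_energy:
  shows "set_integrable lborel {0<..} (\<lambda>r. r powr (n - 1) * (\<Phi> r * \<bar>W r\<bar> powr p))"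
    and "\<omega> * (LBINT r:{0<..}. r powr (n - 1) * (\<Phi> r * \<bar>W r\<bar> powr p)) = a * coulomb_integral p q b u"
proof -
  define m where "m r = (if 0 < r then \<omega> * (r powr (n - 1) * \<bar>W r\<bar> powr p) else 0)" for r
  have [measurable]: "m \<in> borel_measurable borel"
    unfolding m_def by (rule borel_measurable_restrict_pos[OF mass_density_continuous])
  have mn: "0 \<le> m r" for r using \<omega> by (simp add: m_def)
  \<comment> \<open>Integrated first in \<rho>, T gives m \<Phi> / a; integrated first in r, it
    gives \<kappa> h. The nonnegative integral is used because finiteness of the potential term is
    part of the claim.\<close>
  define T where "T r \<rho> = (if 0 < r \<and> r < \<rho> then ennreal (m r) * ennreal (\<kappa> \<rho>) else 0)" for r \<rho>
  have [measurable]: "case_prod T \<in> borel_measurable (lborel \<Otimes>\<^sub>M lborel)"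
    unfolding T_def case_prod_beta' by measurable
  have inner1: "(\<integral>\<^sup>+\<rho>. T r \<rho> \<partial>lborel) = ennreal (indicator {0<..} r * (m r * (\<Phi> r / a)))" for r
  proof (cases "0 < r")
    case True
    have i: "integrable lborel (\<lambda>\<rho>. indicator {r<..} \<rho> *\<^sub>R \<kappa> \<rho>)"
      using E_space_Phi_integrable[OF u_E q b True] by (simp add: set_integrable_def \<kappa>_def)
    have "(\<integral>\<^sup>+\<rho>. T r \<rho> \<partial>lborel) = (\<integral>\<^sup>+\<rho>. ennreal (m r) * ennreal (indicator {r<..} \<rho> *\<^sub>R \<kappa> \<rho>) \<partial>lborel)"
      using True by (intro nn_integral_cong) (auto simp: T_def split: split_indicator)
    also have "\<dots> = ennreal (m r) * (\<integral>\<^sup>+\<rho>. ennreal (indicator {r<..} \<rho> *\<^sub>R \<kappa> \<rho>) \<partial>lborel)"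
      by (rule nn_integral_cmult) measurable
    also have "(\<integral>\<^sup>+\<rho>. ennreal (indicator {r<..} \<rho> *\<^sub>R \<kappa> \<rho>) \<partial>lborel) = ennreal (\<Phi> r / a)"
      using Phi_primitive(2)[OF u_E q b True, of a] a \<kappa>_nonneg
      by (subst nn_integral_eq_integral[OF i]) (auto simp: set_lebesgue_integral_def \<kappa>_def)
    finally show ?thesis using True by (simp add: ennreal_mult'[OF mn, symmetric])
  qed (simp add: T_def)
  have inner2: "(\<integral>\<^sup>+r. T r \<rho> \<partial>lborel) = ennreal (indicator {0<..} \<rho> *\<^sub>R (\<rho> powr - b * h \<rho> powr q))" for \<rho>
  proof (cases "0 < \<rho>")
    case True
    have i: "integrable lborel (\<lambda>r. indicator {0<..<\<rho>} r *\<^sub>R (\<omega> * (r powr (n - 1) * \<bar>W r\<bar> powr p)))"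
      using h_eq(2)[OF True] by (simp add: set_integrable_def)
    have eq: "indicator {0<..<\<rho>} r *\<^sub>R (\<omega> * (r powr (n - 1) * \<bar>W r\<bar> powr p)) = (if 0 < r \<and> r < \<rho> then m r else 0)" for r
      by (auto simp: m_def)
    have "(\<integral>\<^sup>+r. T r \<rho> \<partial>lborel) = (\<integral>\<^sup>+r. ennreal (\<kappa> \<rho>) * ennreal (if 0 < r \<and> r < \<rho> then m r else 0) \<partial>lborel)"
      by (intro nn_integral_cong) (auto simp: T_def mult.commute)
    also have "\<dots> = ennreal (\<kappa> \<rho>) * (\<integral>\<^sup>+r. ennreal (if 0 < r \<and> r < \<rho> then m r else 0) \<partial>lborel)"
      by (rule nn_integral_cmult) measurable
    also have "(\<integral>\<^sup>+r. ennreal (if 0 < r \<and> r < \<rho> then m r else 0) \<partial>lborel) = ennreal (h \<rho>)"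
      using i h_eq(1)[OF True] mn unfolding set_lebesgue_integral_def eq
      by (subst nn_integral_eq_integral) auto
    finally show ?thesis using True \<kappa>_nonneg \<kappa>_h[of \<rho>] by (simp add: ennreal_mult'[symmetric])
  next
    case False
    then have "T r \<rho> = 0" for r by (simp add: T_def)
    then show ?thesis using False by simp
  qed
  have pos: "0 \<le> indicator {0<..} r * (m r * (\<Phi> r / a))" for r
  proof (cases "0 < r")
    case True
    have "0 \<le> \<Phi> r"
      unfolding Phi_primitive(2)[OF u_E q b True] set_lebesgue_integral_def using a
      by (intro mult_nonneg_nonneg Bochner_Integration.integral_nonneg) (auto simp: pow0_def)
    then show ?thesis using mn a by simp
  qed simp
  have "(\<integral>\<^sup>+r. \<integral>\<^sup>+\<rho>. T r \<rho> \<partial>lborel \<partial>lborel) = (\<integral>\<^sup>+\<rho>. \<integral>\<^sup>+r. T r \<rho> \<partial>lborel \<partial>lborel)"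
    by (rule lborel_pair.Fubini'[symmetric]) measurable
  then have "(\<integral>\<^sup>+r. ennreal (indicator {0<..} r * (m r * (\<Phi> r / a))) \<partial>lborel) =
      (\<integral>\<^sup>+\<rho>. ennreal (indicator {0<..} \<rho> *\<^sub>R (\<rho> powr - b * h \<rho> powr q)) \<partial>lborel)"
    unfolding inner1 inner2 .
  also have "\<dots> = ennreal (coulomb_integral p q b u)"
    using coulomb_set_integrable unfolding coulomb_eq set_lebesgue_integral_def set_integrable_def
    by (intro nn_integral_eq_integral AE_I2) auto
  finally have nn: "(\<integral>\<^sup>+r. ennreal (indicator {0<..} r * (m r * (\<Phi> r / a))) \<partial>lborel) = ennreal (coulomb_integral p q b u)" .
  have c0: "0 \<le> coulomb_integral p q b u"
    unfolding coulomb_eq set_lebesgue_integral_def by (intro Bochner_Integration.integral_nonneg) auto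
  have [measurable]: "(\<lambda>r. if 0 < r then \<Phi> r else 0) \<in> borel_measurable borel"
    by (rule borel_measurable_restrict_pos[OF \<Phi>_continuous])
  have "(\<lambda>r. m r * (if 0 < r then \<Phi> r else 0) / a) \<in> borel_measurable borel" by measurable
  also have "(\<lambda>r. m r * (if 0 < r then \<Phi> r else 0) / a) = (\<lambda>r. indicator {0<..} r * (m r * (\<Phi> r / a)))"
    by (auto simp: m_def split: split_indicator)
  finally have meas: "(\<lambda>r. indicator {0<..} r * (m r * (\<Phi> r / a))) \<in> borel_measurable lborel" by simp
  have "has_bochner_integral lborel (\<lambda>r. indicator {0<..} r * (m r * (\<Phi> r / a))) (coulomb_integral p q b u)"
    by (rule has_bochner_integral_nn_integral[OF meas _ c0 nn]) (use pos in auto)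
  then have 1: "has_bochner_integral lborel (\<lambda>r. a / \<omega> * (indicator {0<..} r * (m r * (\<Phi> r / a)))) (a / \<omega> * coulomb_integral p q b u)"
    by (rule has_bochner_integral_mult_right) 
  have "a / \<omega> * (indicator {0<..} r * (m r * (\<Phi> r / a))) = indicator {0<..} r *\<^sub>R (r powr (n - 1) * (\<Phi> r * \<bar>W r\<bar> powr p))" for r
    using a \<omega> by (auto simp: m_def split: split_indicator)
  with 1 have 2: "has_bochner_integral lborel (\<lambda>r. indicator {0<..} r *\<^sub>R (r powr (n - 1) * (\<Phi> r * \<bar>W r\<bar> powr p))) (a / \<omega> * coulomb_integral p q b u)"
    by simp
  show "set_integrable lborel {0<..} (\<lambda>r. r powr (n - 1) * (\<Phi> r * \<bar>W r\<bar> powr p))"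
    unfolding set_integrable_def by (rule integrable.intros[OF 2])
  show "\<omega> * (LBINT r:{0<..}. r powr (n - 1) * (\<Phi> r * \<bar>W r\<bar> powr p)) = a * coulomb_integral p q b u"
    unfolding set_lebesgue_integral_def has_bochner_integral_integral_eq[OF 2] using \<omega> by simp
qed

lemma nehari: "dirichlet_integral u + a * coulomb_integral p q b u = (LINT x|lebesgue. f (u x) * u x)"
proof -
  have "(LINT x|lebesgue. weak_grad u x \<bullet> weak_grad u x) +
        (LINT x|lebesgue. \<Phi> (norm x) * \<bar>u x\<bar> powr (p - 2) * u x * u x) = (LINT x|lebesgue. f (u x) * u x)"
    using sol u_E_rad by (auto simp: weak_radial_solution_def)
  moreover have "(LINT x|lebesgue. weak_grad u x \<bullet> weak_grad u x) = dirichlet_integral u"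
    by (simp add: dirichlet_integral_def power2_norm_eq_inner)
  moreover have "(LINT x|lebesgue. \<Phi> (norm x) * \<bar>u x\<bar> powr (p - 2) * u x * u x) = a * coulomb_integral p q b u"
  proof -
    have "\<bar>t\<bar> powr (p - 2) * t * t = \<bar>t\<bar> powr p" for t :: real
      using p by (cases "t = 0") (auto simp: powr_diff power2_eq_square)
    then have ae: "AE x in lebesgue. \<Phi> (norm x) * \<bar>u x\<bar> powr (p - 2) * u x * u x = (\<lambda>r. \<Phi> r * \<bar>W r\<bar> powr p) (norm x)"
      using u_eq by (auto elim!: eventually_mono simp: mult.assoc)
    have "continuous_on {0<..} (\<lambda>r. \<Phi> r * \<bar>W r\<bar> powr p)"
      by (intro continuous_on_mult \<Phi>_continuous continuous_on_abs_powr Wc) (use p in auto)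
    from radial_transfer_continuous(1)[OF ae this, folded n_eq \<omega>_eq] show ?thesis using potential_energy(2) by simp
  qed
  ultimately show ?thesis by simp
qed

text \<open>The kinetic part of G is written as r^(2-n) K^2 / 2, equal to r^n W'^2 / 2, because the
  equation gives the derivative of K directly. The constant c is fixed by c q \<omega> = a / p,
  which makes the term with \<Phi>' cancel against the derivative of h^q.\<close>

lemma pohozaev:
  assumes P: "set_integrable lborel {0<..} (\<lambda>r. r powr (n - 1) * primitive f (W r))"
  shows "(n - 2) / 2 * dirichlet_integral u + a * (n * q + 1 - b) / (p * q) * coulomb_integral p q b u =
    n * (\<omega> * (LBINT r:{0<..}. r powr (n - 1) * primitive f (W r)))"
proof -
  define c where "c = a / (p * q * \<omega>)"
  define G where "G r = r powr (2 - n) * (K r)\<^sup>2 / 2 + r powr n * primitive f (W r)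
    - r powr n * \<Phi> r * \<bar>W r\<bar> powr p / p - c * (r powr (1 - b) * h r powr q)" for r
  define G' where "G' r = - ((n - 2) / 2) * (r powr (n - 1) * (W1 r)\<^sup>2) + n * (r powr (n - 1) * primitive f (W r))
    + - (n / p) * (r powr (n - 1) * (\<Phi> r * \<bar>W r\<bar> powr p)) + c * (b - 1) * (r powr - b * h r powr q)" for r
  have pq: "0 < p" "0 < q" using p q by auto
  note int = D P potential_energy(1) coulomb_set_integrable
  have "(LBINT r:{0<..}. G' r) = 0"
  proof (rule integral_derivative_zero)
    show "set_integrable lborel {0<..} G'"
      unfolding G'_def by (intro set_integral_add set_integrable_mult_right int)
    have "set_integrable lborel {0<..} (\<lambda>r. 1 / 2 * (r powr (n - 1) * (W1 r)\<^sup>2) + r powr (n - 1) * primitive f (W r)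
       + - (1 / p) * (r powr (n - 1) * (\<Phi> r * \<bar>W r\<bar> powr p)) + - c * (r powr - b * h r powr q))"
      by (intro set_integral_add set_integrable_mult_right int)
    also have "?this \<longleftrightarrow> set_integrable lborel {0<..} (\<lambda>r. G r / r)"
    proof (rule set_integrable_cong[OF refl refl])
      fix r :: real assume "r \<in> {0<..}"
      then have r: "0 < r" by simp
      have "r powr (n - 1) * (W1 r)\<^sup>2 = r powr (2 - n) * (K r)\<^sup>2 / r"
      proof -
        have "r powr (n - 1) * (r powr - (n - 1) * r powr - (n - 1)) = r powr (2 - n) * r powr (- 1)"
          unfolding powr_add[symmetric] by (rule arg_cong[where f="\<lambda>x. r powr x"]) simp
        then have "r powr (n - 1) * (W1 r)\<^sup>2 = r powr (2 - n) * r powr (- 1) * (K r)\<^sup>2"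
          unfolding W1_def power_mult_distrib power2_eq_square[of "r powr _"] mult.assoc[symmetric] by simp
        then show ?thesis using r by (simp add: powr_minus field_simps)
      qed
      moreover have "r powr (n - 1) = r powr n / r" using r by (simp add: powr_diff)
      moreover have "r powr - b = r powr (1 - b) / r" using r by (simp add: powr_diff powr_minus field_simps)
      ultimately show "1 / 2 * (r powr (n - 1) * (W1 r)\<^sup>2) + r powr (n - 1) * primitive f (W r)
         + - (1 / p) * (r powr (n - 1) * (\<Phi> r * \<bar>W r\<bar> powr p)) + - c * (r powr - b * h r powr q) = G r / r"
        using r by (simp add: G_def diff_divide_distrib add_divide_distrib)
    qed
    finally show "set_integrable lborel {0<..} (\<lambda>r. G r / r)" .
    fix r :: real assume r: "0 < r"
    define A where "A = r powr (n - 1)"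
    define w where "w = \<bar>W r\<bar> powr (p - 2) * W r"
    define x where "x = W1 r"
    have "A * r powr - (n - 1) = 1" using r unfolding A_def powr_add[symmetric] by simp
    then have K: "K r = A * x" by (simp add: x_def W1_def mult.assoc[symmetric])
    have rp: "r powr n = r * A" "r powr (1 - n) = 1 / A" "r powr (2 - n) = r / A"
    proof -
      show "r powr n = r * A" using r by (simp add: A_def powr_diff)
      show inv: "r powr (1 - n) = 1 / A" using r unfolding A_def by (simp add: powr_diff)
      have "r powr (2 - n) = r powr 1 * r powr (1 - n)" unfolding powr_add[symmetric] by simp
      then show "r powr (2 - n) = r / A" using r inv by simp
    qed
    have A: "0 < A" using r by (simp add: A_def)
    define k where "k = \<kappa> r"
    have rb: "r powr (1 - b) * pow0 (h r) (q - 1) = r * k"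
      using r by (simp add: k_def \<kappa>_def powr_diff powr_minus field_simps)
    have D1: "((\<lambda>r. r powr (2 - n) * (K r)\<^sup>2 / 2) has_real_derivative
        ((2 - n) * r powr (1 - n) * (K r)\<^sup>2 + 2 * K r * (A * (\<Phi> r * w - f (W r))) * r powr (2 - n)) / 2) (at r)"
    proof -
      have "((\<lambda>r. r powr (2 - n)) has_real_derivative (2 - n) * r powr (1 - n)) (at r)"
        using r by (auto intro!: derivative_eq_intros)
      moreover have "(K has_real_derivative A * (\<Phi> r * w - f (W r))) (at r)"
        using K_deriv[OF r] by (simp add: A_def w_def mult.assoc)
      then have "((\<lambda>r. (K r)\<^sup>2) has_real_derivative 2 * K r * (A * (\<Phi> r * w - f (W r)))) (at r)"
        by (auto intro!: derivative_eq_intros)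
      ultimately show ?thesis by (intro DERIV_cdivide DERIV_mult)
    qed
    have Wr: "(W has_real_derivative x) (at r)" using W[OF r] by (simp add: x_def)
    have Drn: "((\<lambda>r. r powr n) has_real_derivative n * A) (at r)" using r by (auto intro!: derivative_eq_intros simp: A_def)
    have D2: "((\<lambda>r. r powr n * primitive f (W r)) has_real_derivative
        n * A * primitive f (W r) + f (W r) * x * r powr n) (at r)"
      by (rule DERIV_mult[OF Drn DERIV_chain2[OF primitive_has_derivative(1)[OF f] Wr]])
    have D3: "((\<lambda>r. r powr n * \<Phi> r * \<bar>W r\<bar> powr p / p) has_real_derivative
        ((n * A * \<Phi> r + - a * k * r powr n) * \<bar>W r\<bar> powr p + p * w * x * (r powr n * \<Phi> r)) / p) (at r)"
      unfolding w_def k_def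
      by (intro DERIV_cdivide DERIV_mult Drn \<Phi>_deriv[OF r] DERIV_chain2[OF has_real_derivative_abs_powr[OF p] Wr])
    have D4: "((\<lambda>r. c * (r powr (1 - b) * h r powr q)) has_real_derivative
        c * ((1 - b) * r powr - b * h r powr q + q * pow0 (h r) (q - 1) * (\<omega> * (A * \<bar>W r\<bar> powr p)) * r powr (1 - b))) (at r)"
    proof -
      have "((\<lambda>r. r powr (1 - b)) has_real_derivative (1 - b) * r powr - b) (at r)"
        using r by (auto intro!: derivative_eq_intros)
      from DERIV_cmult[OF DERIV_mult[OF this powr_q_has_derivative[OF q h_nonneg h_deriv[OF r]]], of c]
      show ?thesis by (simp add: A_def)
    qed
    \<comment> \<open>Three pairs cancel: the f(W) W' terms, the \<Phi> |W|^(p-2) W W' terms, and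
      the two terms with \<kappa> |W|^p. What survives comes from differentiating the explicit
      powers of r.\<close>
    have "G' r = ((2 - n) * r powr (1 - n) * (K r)\<^sup>2 + 2 * K r * (A * (\<Phi> r * w - f (W r))) * r powr (2 - n)) / 2
      + (n * A * primitive f (W r) + f (W r) * x * r powr n)
      - ((n * A * \<Phi> r + - a * k * r powr n) * \<bar>W r\<bar> powr p + p * w * x * (r powr n * \<Phi> r)) / p
      - c * ((1 - b) * r powr - b * h r powr q + q * pow0 (h r) (q - 1) * (\<omega> * (A * \<bar>W r\<bar> powr p)) * r powr (1 - b))"
    proof -
      have "((2 - n) * r powr (1 - n) * (K r)\<^sup>2 + 2 * K r * (A * (\<Phi> r * w - f (W r))) * r powr (2 - n)) / 2
          = - ((n - 2) / 2) * (A * x\<^sup>2) + r * A * x * (\<Phi> r * w - f (W r))"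
        using A unfolding rp K by (simp add: field_simps power2_eq_square)
      moreover have "c * (q * pow0 (h r) (q - 1) * (\<omega> * (A * \<bar>W r\<bar> powr p)) * r powr (1 - b)) = a * k * (r * A) * \<bar>W r\<bar> powr p / p"
      proof -
        have "c * (q * pow0 (h r) (q - 1) * (\<omega> * (A * \<bar>W r\<bar> powr p)) * r powr (1 - b)) =
          (c * q * \<omega>) * (r powr (1 - b) * pow0 (h r) (q - 1)) * (A * \<bar>W r\<bar> powr p)" by simp
        also have "c * q * \<omega> = a / p" using pq \<omega> by (simp add: c_def)
        finally show ?thesis unfolding rb by simp
      qed
      moreover have "((n * A * \<Phi> r + - a * k * (r * A)) * \<bar>W r\<bar> powr p + p * w * x * (r * A * \<Phi> r)) / p =
          n / p * (A * (\<Phi> r * \<bar>W r\<bar> powr p)) - a * k * (r * A) * \<bar>W r\<bar> powr p / p + w * x * (r * A * \<Phi> r)"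
        using pq by (simp add: field_simps)
      ultimately show ?thesis
        unfolding G'_def distrib_left[of c] A_def[symmetric] x_def[symmetric] rp(1)
        by (simp add: algebra_simps)
    qed
    then show "(G has_real_derivative G' r) (at r)"
      unfolding G_def using DERIV_diff[OF DERIV_diff[OF DERIV_add[OF D1 D2] D3] D4] by simp
  qed
  then have "- ((n - 2) / 2) * (LBINT r:{0<..}. r powr (n - 1) * (W1 r)\<^sup>2) + n * (LBINT r:{0<..}. r powr (n - 1) * primitive f (W r))
    + - (n / p) * (LBINT r:{0<..}. r powr (n - 1) * (\<Phi> r * \<bar>W r\<bar> powr p)) + c * (b - 1) * coulomb_integral p q b u = 0"
    unfolding G'_def coulomb_eq
    by (simp only: set_integral_add set_integrable_mult_right set_integral_mult_right int)
  then have "\<omega> * (- ((n - 2) / 2) * (LBINT r:{0<..}. r powr (n - 1) * (W1 r)\<^sup>2) + n * (LBINT r:{0<..}. r powr (n - 1) * primitive f (W r))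
    + - (n / p) * (LBINT r:{0<..}. r powr (n - 1) * (\<Phi> r * \<bar>W r\<bar> powr p)) + c * (b - 1) * coulomb_integral p q b u) = 0" by simp
  then have "- ((n - 2) / 2) * dirichlet_integral u + n * (\<omega> * (LBINT r:{0<..}. r powr (n - 1) * primitive f (W r)))
    - n / p * (a * coulomb_integral p q b u) + \<omega> * c * (b - 1) * coulomb_integral p q b u = 0"
    unfolding dirichlet_eq potential_energy(2)[symmetric] by (simp add: algebra_simps)
  moreover have "\<omega> * c = a / (p * q)" using \<omega> by (simp add: c_def)
  ultimately have "- ((n - 2) / 2) * dirichlet_integral u + n * (\<omega> * (LBINT r:{0<..}. r powr (n - 1) * primitive f (W r)))
    - n / p * (a * coulomb_integral p q b u) + a / (p * q) * (b - 1) * coulomb_integral p q b u = 0" by simp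
  moreover have "a * (n * q + 1 - b) / (p * q) * coulomb_integral p q b u =
      n / p * (a * coulomb_integral p q b u) - a / (p * q) * (b - 1) * coulomb_integral p q b u"
    using pq by (simp add: field_simps)
  ultimately show ?thesis by linarith
qed

end

text \<open>Since \<open>b_star\<close> is at most 1 + N q, it follows that b - 1 < N q \<le> 2
  (N-1) q, so the denominator of \<open>two_lower_star\<close> is positive. Clearing it turns the
  lower bound on s into the last inequality, whose positive left side in turn forces s > p.\<close>

lemma exponent_conditions:
  fixes p q b s :: real
  assumes "N \<ge> 2" "1 < p" "1 \<le> q" "1 < b" "b < b_star N p q" "two_lower_star N p q b < s"
  shows "(b - 1) / q < real N" and "p < s" and "(b - 1) / q * (s + 2) < 2 * (real N - 1) * (s - p)"
proof -
  have bN: "b - 1 < real N * q"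
  proof (cases "N = 2")
    case False
    then have "0 \<le> p / two_star N" using assms by (simp add: two_star_def)
    then have "real N * q * (1 - p / two_star N) \<le> real N * q * 1"
      using assms by (intro mult_left_mono) auto
    moreover have "b < 1 + real N * q * (1 - p / two_star N)" using assms(5) False by (simp add: b_star_def)
    ultimately show ?thesis by linarith
  qed (use assms in \<open>simp add: b_star_def\<close>)
  then show "(b - 1) / q < real N" using assms by (simp add: field_simps)
  have "real N * q \<le> 2 * (real N - 1) * q" using assms by (intro mult_right_mono) auto
  with bN have den: "0 < 2 * (real N - 1) * q + 1 - b" by linarith
  have num: "0 < (real N - 1) * p * q + b - 1"
  proof -
    have "0 \<le> (real N - 1) * p * q" using assms by simp
    then show ?thesis using assms by linarith
  qed
  have "0 < two_lower_star N p q b" using den num by (simp add: two_lower_star_def)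
  then have s: "0 < s" using assms by linarith
  have main: "2 * ((real N - 1) * p * q + b - 1) < s * (2 * (real N - 1) * q + 1 - b)"
    using assms(6) den by (simp add: two_lower_star_def divide_less_eq)
  then have key: "(b - 1) * (s + 2) < 2 * (real N - 1) * (s - p) * q" by (simp add: algebra_simps)
  have "0 < (b - 1) * (s + 2)" using assms s by simp
  with key have "0 < 2 * (real N - 1) * (s - p) * q" by linarith
  then show "p < s" using assms by (simp add: zero_less_mult_iff)
  show "(b - 1) / q * (s + 2) < 2 * (real N - 1) * (s - p)"
    using key assms by (simp add: divide_less_eq)
qed

theorem theorem4p5:
  fixes N :: nat and a p q b C s1 s2 :: real
    and f :: "real \<Rightarrow> real" and u :: "real ^ 'n \<Rightarrow> real"
  assumes "N = CARD('n)" and "N \<ge> 2"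
    and "a > 0"
    and "1 < p" and "N \<ge> 3 \<Longrightarrow> p < two_star N"
    and "1 \<le> q" and "p * q > 2"
    and "1 < b" and "b < b_star N p q"
    and "continuous_on UNIV f"
    and "C > 0"
    and "\<And>t. \<bar>f t\<bar> \<le> C * (\<bar>t\<bar> powr (s1 - 1) + \<bar>t\<bar> powr (s2 - 1))"
    and "two_lower_star N p q b < s1" and "s1 \<le> s2"
    and "N \<ge> 3 \<Longrightarrow> s2 \<le> two_star N"
    and "weak_radial_solution a p q b f u"
  shows "integrable lebesgue (\<lambda>x. f (u x) * u x) \<and>
    integrable lebesgue (\<lambda>x. primitive f (u x)) \<and>
    (real N - 2) / 2 * dirichlet_integral u +
      a * (real N * q + 1 - b) / (p * q) * coulomb_integral p q b u =
      real N * (LINT x|lebesgue. primitive f (u x)) \<and>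
    dirichlet_integral u + a * coulomb_integral p q b u =
      (LINT x|lebesgue. f (u x) * u x) \<and>
    sigma_exp N p q b *
      (1 / 2 * dirichlet_integral u + a / (p * q) * coulomb_integral p q b u) =
      (LINT x|lebesgue. alpha_exp N p q b * f (u x) * u x - real N * primitive f (u x))"
proof -
  have N: "N = DIM(real ^ 'n)" using assms(1) by simp
  obtain W K where WK: "AE x in lebesgue. u x = W (norm x)"
    "\<And>r. r > 0 \<Longrightarrow> (W has_real_derivative r powr - (real N - 1) * K r) (at r)"
    "\<And>r. r > 0 \<Longrightarrow> (K has_real_derivative
      r powr (real N - 1) * (Phi a p q b u r * \<bar>W r\<bar> powr (p - 2) * W r - f (W r))) (at r)"
    "AE x in lebesgue. weak_grad u x = (norm x powr - (real N - 1) * K (norm x) / norm x) *\<^sub>R x"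
    using radial_solution_regular[OF assms(4,6,8,10,16), folded N] by blast
  interpret regular_radial_solution a p q b "real N" "sph N" f W K u
    by unfold_locales (use assms WK N in auto)
  \<comment> \<open>Because s1 \<le> s2, both exponents inherit the lower bound from s1 and, for N
    \<ge> 3, the upper bound from s2.\<close>
  have emb: "set_integrable lborel {0<..} (\<lambda>r. r powr (real N - 1) * \<bar>W r\<bar> powr s)"
    if s: "s = s1 \<or> s = s2" for s
  proof -
    have ls: "two_lower_star N p q b < s" using s assms(13,14) by auto
    note e = exponent_conditions[OF assms(2,4,6,8,9) ls]
    show ?thesis
    proof (rule embedding[OF _ e(1,3)])
      show "0 < s" using e(2) assms(4) by simp
      show "s \<le> 2 * real N / (real N - 2)" if "2 < real N"
        using that s assms(14,15) by (auto simp: two_star_def)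
    qed
  qed
  have s12: "1 < s1" "1 < s2" using exponent_conditions(2)[OF assms(2,4,6,8,9,13)] assms(4,14) by auto
  note growth = primitive_growth[OF f s12 _ assms(12)]
  have contP: "continuous_on UNIV (primitive f)"
    using primitive_has_derivative(1)[OF f] by (intro continuous_at_imp_continuous_on ballI DERIV_isCont) auto
  have H: "set_integrable lborel {0<..} (\<lambda>r. C * (r powr (real N - 1) * \<bar>W r\<bar> powr s1) + C * (r powr (real N - 1) * \<bar>W r\<bar> powr s2))"
    using emb by (intro set_integral_add set_integrable_mult_right) auto
  \<comment> \<open>Stated for a general g, since t f(t) and F(t) satisfy the same growth
    bound.\<close>
  have dominated: "set_integrable lborel {0<..} (\<lambda>r. r powr (real N - 1) * g (W r))"
    if g: "continuous_on UNIV g" "\<And>t. \<bar>g t\<bar> \<le> C * (\<bar>t\<bar> powr s1 + \<bar>t\<bar> powr s2)" for g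
  proof (rule set_integrable_bound_continuous[OF _ _ _ H])
    show "continuous_on {0<..} (\<lambda>r. r powr (real N - 1) * g (W r))"
      by (intro continuous_intros continuous_on_compose2[OF g(1) Wc]) auto
    fix r :: real
    have "r powr (real N - 1) * \<bar>g (W r)\<bar> \<le> r powr (real N - 1) * (C * (\<bar>W r\<bar> powr s1 + \<bar>W r\<bar> powr s2))"
      by (intro mult_left_mono g(2)) auto
    then show "\<bar>r powr (real N - 1) * g (W r)\<bar> \<le>
        C * (r powr (real N - 1) * \<bar>W r\<bar> powr s1) + C * (r powr (real N - 1) * \<bar>W r\<bar> powr s2)"
      by (simp add: abs_mult algebra_simps)
  qed auto
  have transfer: "integrable lebesgue (\<lambda>x. g (u x))"
    "(LINT x|lebesgue. g (u x)) = sph N * (LBINT r:{0<..}. r powr (real N - 1) * g (W r))"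
    if g: "continuous_on UNIV g" "\<And>t. \<bar>g t\<bar> \<le> C * (\<bar>t\<bar> powr s1 + \<bar>t\<bar> powr s2)" for g
  proof -
    have ae: "AE x in lebesgue. g (u x) = (\<lambda>r. g (W r)) (norm x)" using WK(1) by eventually_elim simp
    have c: "continuous_on {0<..} (\<lambda>r. g (W r))" by (intro continuous_on_compose2[OF g(1) Wc]) auto
    note t = radial_transfer_continuous[OF ae c, folded N]
    show "integrable lebesgue (\<lambda>x. g (u x))" using t(2) dominated[OF g] by simp
    show "(LINT x|lebesgue. g (u x)) = sph N * (LBINT r:{0<..}. r powr (real N - 1) * g (W r))" by (rule t(1))
  qed
  have contf: "continuous_on UNIV (\<lambda>t. f t * t)" by (intro continuous_intros f)
  have If: "integrable lebesgue (\<lambda>x. f (u x) * u x)"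
    by (rule transfer(1)[OF contf]) (use growth(1) assms(11) in auto)
  have g2: "\<bar>primitive f t\<bar> \<le> C * (\<bar>t\<bar> powr s1 + \<bar>t\<bar> powr s2)" for t using growth(2) assms(11) by auto
  have IP: "integrable lebesgue (\<lambda>x. primitive f (u x))" by (rule transfer(1)[OF contP g2])
  have poh: "(real N - 2) / 2 * dirichlet_integral u + a * (real N * q + 1 - b) / (p * q) * coulomb_integral p q b u =
      real N * (LINT x|lebesgue. primitive f (u x))"
    unfolding transfer(2)[OF contP g2] by (rule pohozaev[OF dominated[OF contP g2]])
  have scaling: "sigma_exp N p q b * (1 / 2 * dirichlet_integral u + a / (p * q) * coulomb_integral p q b u) =
      (LINT x|lebesgue. alpha_exp N p q b * f (u x) * u x - real N * primitive f (u x))"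
  proof -
    define \<alpha> where "\<alpha> = alpha_exp N p q b"
    \<comment> \<open>Rearranged, this reads \<sigma> = \<alpha> p q - (N q + 1 - b), so \<sigma> a
      / (p q) is exactly the Coulomb coefficient of \<alpha> times Nehari minus Pohozaev. The
      Dirichlet coefficient \<alpha> - (N-2)/2 is \<sigma>/2 by definition.\<close>
    have "\<alpha> * (p * q - 2) = real N * (q - 1) + 3 - b" using assms(7) by (simp add: \<alpha>_def alpha_exp_def)
    then have "2 * \<alpha> + 2 - real N = \<alpha> * (p * q) - (real N * q + 1 - b)" by (simp add: algebra_simps)
    then have "(2 * \<alpha> + 2 - real N) * (a / (p * q)) = \<alpha> * (p * q) * (a / (p * q)) - (real N * q + 1 - b) * (a / (p * q))"
      by (simp only: left_diff_distrib)
    also have "\<alpha> * (p * q) * (a / (p * q)) = \<alpha> * a" using assms(7) by auto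
    finally have coeff: "(2 * \<alpha> + 2 - real N) * (a / (p * q)) = \<alpha> * a - a * (real N * q + 1 - b) / (p * q)" by simp
    have "(LINT x|lebesgue. alpha_exp N p q b * f (u x) * u x - real N * primitive f (u x)) =
        \<alpha> * (LINT x|lebesgue. f (u x) * u x) - real N * (LINT x|lebesgue. primitive f (u x))"
      using If IP by (simp add: \<alpha>_def mult.assoc)
    also have "\<dots> = \<alpha> * (dirichlet_integral u + a * coulomb_integral p q b u) -
        ((real N - 2) / 2 * dirichlet_integral u + a * (real N * q + 1 - b) / (p * q) * coulomb_integral p q b u)"
      unfolding poh nehari ..
    also have "\<dots> = (\<alpha> + 1 - real N / 2) * dirichlet_integral u +
        (\<alpha> * a - a * (real N * q + 1 - b) / (p * q)) * coulomb_integral p q b u"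
      by (simp add: algebra_simps diff_divide_distrib)
    also have "\<dots> = (\<alpha> + 1 - real N / 2) * dirichlet_integral u +
        (2 * \<alpha> + 2 - real N) * (a / (p * q)) * coulomb_integral p q b u"
      unfolding coeff ..
    also have "\<dots> = (2 * \<alpha> + 2 - real N) * (1 / 2 * dirichlet_integral u + a / (p * q) * coulomb_integral p q b u)"
      unfolding distrib_left mult.assoc by (simp add: algebra_simps diff_divide_distrib add_divide_distrib)
    finally show ?thesis by (simp add: sigma_exp_def \<alpha>_def)
  qed
  show ?thesis using If IP poh nehari scaling by blast
qed

end
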